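(* Let $N\ge 2$, $R>0$, $p>1$. Assume that: (W) $W:\mathbb{R}^N\to\mathbb{R}$ is continuous, there are positive constants $\nu_1$, $C$ with $W(\xi)\ge \nu_1|\xi|^p-C$ for all $\xi\in\mathbb{R}^N$, and $W(\xi)=\tilde W(|\xi|)$ for an even continuous function $\tilde W:\mathbb{R}\to\mathbb{R}$. (G) $G:\mathbb{R}\to\mathbb{R}$ is continuous and there are constants $C,\nu_3,\nu_4\ge 0$ and $\varrho\in(0,p]$ such that for all $\mu\in\mathbb{R}$: $G(\mu)\ge-\nu_3|\mu|^{p-\varrho}-C$; if $p<N$, $G(\mu)\le\nu_4|\mu|^{p^*-\varrho}+C$ with $p^*=\frac{pN}{N-p}$; if $p=N$, $G(\mu)\le\nu_4|\mu|^{\tilde p}+C$ for some $\tilde p<\infty$. Furthermore assume that $\tilde W$ is increasing on $[0,\infty)$ and that $E(u)=\int_{B_R(0)}[W(\nabla u)+G(u)]\,dx$ has a global minimizer in $W_0^{1,p}(B_R(0))$. Let $M_0\ge 0$ be a constant such that $\tilde W$ is constant on $[-M_0,M_0]$ ($M_0=0$ is allowed). Then: (i) At least one global minimizer $u$ of $E$ is radially symmetric. If $G$ is decreasing on $[0,\infty)$ and $G(\mu)\le G(-\mu)$ for all $\mu>0$, then $u$ can be chosen in such a way that $u\ge 0$ and $\partial_r u\le -M_0$ almost everywhere. (ii) Any minimizer $u$ with the property that, for every $\nu\in\mathbb{R}$ and a.e. $x\in B_R(0)$, $$|\nu|>|\partial_r u(x)|\ \text{ implies }\ \tilde W(|\nu|)>\tilde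 W(|\partial_r u(x)|),\qquad ( * )$$ is radially symmetric. (iii) Assume in addition that $G$ is strictly decreasing on $[0,\infty)$ and $G(\mu)\le G(-\mu)$ for all $\mu>0$. Then every minimizer $u$ of $E$ satisfies $( * )$ and thus is radially symmetric. Furthermore, $u$ is either nonnegative or nonpositive in $B_R(0)$. Here, the latter case can occur only if $G(u)=G(-u)$, so that $|u|$ is a minimizer, too, then. If $u$ is nonnegative then $\partial_r u\le -M_0$ almost everywhere; in particular, $u$ is decreasing in radial direction.
   Context: $B_R(0)=\{x\in\mathbb{R}^N: |x|<R\}$, $|\cdot|$ is the Euclidean norm, and functions $u$ are real valued. $W_0^{1,p}(B_R(0))$ is the closure of $C_0^\infty(B_R(0))$ in $W^{1,p}(B_R(0))$. $\partial_r u(x):=\nabla u(x)\cdot\frac{x}{|x|}$ is the radial derivative. "Increasing" and "decreasing" are meant in the non-strict sense unless "strictly" is added. "Minimizer" means global minimizer of $E$ over $W_0^{1,p}(B_R(0))$. No upper growth bound on $W$ is assumed, so $E$ may take the value $+\infty$ on $W_0^{1,p}(B_R(0))$. A function is radially symmetric if it agrees a.e. with a function of $|x|$ only. Convexity of $W$ is not assumed. *)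

theory Defs
  imports "HOL-Analysis.Analysis"
begin

text \<open>Functions on an open set \<open>U\<close> are total functions whose values outside \<open>U\<close> are
  irrelevant; equality in Lebesgue and Sobolev spaces is equality almost everywhere on \<open>U\<close>.\<close>

definition partial_deriv :: "'n::finite \<Rightarrow> (real^'n \<Rightarrow> real) \<Rightarrow> real^'n \<Rightarrow> real" where
  "partial_deriv i f x = frechet_derivative f (at x) (axis i 1)"

primrec Ck :: "nat \<Rightarrow> (real^'n::finite \<Rightarrow> real) \<Rightarrow> bool" where
  "Ck 0 f \<longleftrightarrow> continuous_on UNIV f"
| "Ck (Suc k) f \<longleftrightarrow> (\<forall>x. f differentiable (at x)) \<and> (\<forall>i. Ck k (partial_deriv i f))"

definition test_functions :: "(real^'n::finite) set \<Rightarrow> (real^'n \<Rightarrow> real) set" where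
  "test_functions U = {\<phi>. (\<forall>k. Ck k \<phi>) \<and> compact (closure {x. \<phi> x \<noteq> 0}) \<and>
     closure {x. \<phi> x \<noteq> 0} \<subseteq> U}"

definition Lp_space ::
    "'a::euclidean_space set \<Rightarrow> real \<Rightarrow> ('a \<Rightarrow> 'b::euclidean_space) set" where
  "Lp_space U p = {f. f \<in> borel_measurable (lebesgue_on U) \<and>
     integrable (lebesgue_on U) (\<lambda>x. norm (f x) powr p)}"

definition locally_integrable_on ::
    "('a::euclidean_space \<Rightarrow> 'b::euclidean_space) \<Rightarrow> 'a set \<Rightarrow> bool" where
  "locally_integrable_on f U \<longleftrightarrow> (\<forall>K. compact K \<and> K \<subseteq> U \<longrightarrow> f absolutely_integrable_on K)"

definition weak_gradient ::
    "(real^'n::finite) set \<Rightarrow> (real^'n \<Rightarrow> real) \<Rightarrow> (real^'n \<Rightarrow> real^'n) \<Rightarrow> bool" where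
  "weak_gradient U u g \<longleftrightarrow> locally_integrable_on u U \<and> locally_integrable_on g U \<and>
     (\<forall>\<phi>\<in>test_functions U. \<forall>i.
        (LINT x|lebesgue_on U. u x * partial_deriv i \<phi> x) =
        - (LINT x|lebesgue_on U. g x $ i * \<phi> x))"

text \<open>The weak gradient is unique only up to null sets, so \<open>wgrad\<close> selects a representative;
  every notion below depends on it only through its class modulo equality a.e.\<close>

definition wgrad :: "(real^'n::finite) set \<Rightarrow> (real^'n \<Rightarrow> real) \<Rightarrow> real^'n \<Rightarrow> real^'n" where
  "wgrad U u = (SOME g. weak_gradient U u g)"

definition W1p :: "(real^'n::finite) set \<Rightarrow> real \<Rightarrow> (real^'n \<Rightarrow> real) set" where
  "W1p U p = {u \<in> Lp_space U p. \<exists>g \<in> Lp_space U p. weak_gradient U u g}"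

definition W1p_norm :: "(real^'n::finite) set \<Rightarrow> real \<Rightarrow> (real^'n \<Rightarrow> real) \<Rightarrow> real" where
  "W1p_norm U p u =
     ((LINT x|lebesgue_on U. \<bar>u x\<bar> powr p) +
      (LINT x|lebesgue_on U. norm (wgrad U u x) powr p)) powr (1 / p)"

definition W1p_0 :: "(real^'n::finite) set \<Rightarrow> real \<Rightarrow> (real^'n \<Rightarrow> real) set" where
  "W1p_0 U p = {u \<in> W1p U p.
     \<forall>\<epsilon>>0. \<exists>\<phi>\<in>test_functions U. W1p_norm U p (\<lambda>x. u x - \<phi> x) < \<epsilon>}"

text \<open>Integral with values in the extended reals: positive part minus negative part (\<open>ennreal\<close>
  truncates negative numbers to \<open>0\<close>). The integrands considered here have an integrable negative
  part, so the ambiguous difference of two infinities does not occur.\<close>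

definition ext_integral :: "'a measure \<Rightarrow> ('a \<Rightarrow> real) \<Rightarrow> ereal" where
  "ext_integral M f = enn2ereal (\<integral>\<^sup>+x. ennreal (f x) \<partial>M) - enn2ereal (\<integral>\<^sup>+x. ennreal (- f x) \<partial>M)"

definition energy ::
    "real \<Rightarrow> (real^'n::finite \<Rightarrow> real) \<Rightarrow> (real \<Rightarrow> real) \<Rightarrow> (real^'n \<Rightarrow> real) \<Rightarrow> ereal" where
  "energy R W G u =
     ext_integral (lebesgue_on (ball 0 R)) (\<lambda>x. W (wgrad (ball 0 R) u x) + G (u x))"

definition minimizer ::
    "real \<Rightarrow> real \<Rightarrow> (real^'n::finite \<Rightarrow> real) \<Rightarrow> (real \<Rightarrow> real) \<Rightarrow> (real^'n \<Rightarrow> real) \<Rightarrow> bool" where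
  "minimizer R p W G u \<longleftrightarrow> u \<in> W1p_0 (ball 0 R) p \<and>
     (\<forall>v \<in> W1p_0 (ball 0 R) p. energy R W G u \<le> energy R W G v)"

definition condition_W ::
    "real \<Rightarrow> (real^'n::finite \<Rightarrow> real) \<Rightarrow> (real \<Rightarrow> real) \<Rightarrow> bool" where
  "condition_W p W Wt \<longleftrightarrow>
     continuous_on UNIV W \<and>
     (\<exists>\<nu>1 C. \<nu>1 > 0 \<and> C > 0 \<and> (\<forall>\<xi>. W \<xi> \<ge> \<nu>1 * norm \<xi> powr p - C)) \<and>
     continuous_on UNIV Wt \<and> (\<forall>t. Wt (- t) = Wt t) \<and>
     (\<forall>\<xi>. W \<xi> = Wt (norm \<xi>))"

text \<open>\<open>N\<close> is the space dimension. In the case \<open>\<rho> = p\<close> the term \<open>\<bar>\<mu>\<bar> powr 0\<close> is \<open>0\<close> rather than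
  \<open>1\<close> at \<open>\<mu> = 0\<close>; as \<open>G\<close> is continuous and \<open>C\<close> is existentially quantified, this does not
  affect the condition.\<close>

definition condition_G :: "nat \<Rightarrow> real \<Rightarrow> (real \<Rightarrow> real) \<Rightarrow> bool" where
  "condition_G N p G \<longleftrightarrow>
     continuous_on UNIV G \<and>
     (\<exists>C \<nu>3 \<nu>4 \<rho>. C \<ge> 0 \<and> \<nu>3 \<ge> 0 \<and> \<nu>4 \<ge> 0 \<and> 0 < \<rho> \<and> \<rho> \<le> p \<and>
        (\<forall>\<mu>. G \<mu> \<ge> - \<nu>3 * \<bar>\<mu>\<bar> powr (p - \<rho>) - C) \<and>
        (p < real N \<longrightarrow>
           (\<forall>\<mu>. G \<mu> \<le> \<nu>4 * \<bar>\<mu>\<bar> powr (p * real N / (real N - p) - \<rho>) + C)) \<and>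
        (p = real N \<longrightarrow> (\<exists>pt::real. \<forall>\<mu>. G \<mu> \<le> \<nu>4 * \<bar>\<mu>\<bar> powr pt + C)))"

definition radially_symmetric_on :: "(real^'n::finite) set \<Rightarrow> (real^'n \<Rightarrow> real) \<Rightarrow> bool" where
  "radially_symmetric_on U u \<longleftrightarrow>
     (\<exists>f::real \<Rightarrow> real. AE x in lebesgue_on U. u x = f (norm x))"

definition radial_deriv :: "(real^'n::finite) set \<Rightarrow> (real^'n \<Rightarrow> real) \<Rightarrow> real^'n \<Rightarrow> real" where
  "radial_deriv U u x = wgrad U u x \<bullet> (x /\<^sub>R norm x)"

definition condition_star ::
    "(real^'n::finite) set \<Rightarrow> (real \<Rightarrow> real) \<Rightarrow> (real^'n \<Rightarrow> real) \<Rightarrow> bool" where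
  "condition_star U Wt u \<longleftrightarrow> (\<forall>\<nu>::real. AE x in lebesgue_on U.
     \<bar>\<nu>\<bar> > \<bar>radial_deriv U u x\<bar> \<longrightarrow> Wt \<bar>\<nu>\<bar> > Wt \<bar>radial_deriv U u x\<bar>)"

text \<open>Since \<open>u\<close> is only determined almost everywhere, monotonicity in the radial direction refers
  to a radial profile of \<open>u\<close>. The origin is excluded because \<open>u\<close> may be unbounded there.\<close>

definition radially_decreasing :: "real \<Rightarrow> (real^'n::finite \<Rightarrow> real) \<Rightarrow> bool" where
  "radially_decreasing R u \<longleftrightarrow> (\<exists>f::real \<Rightarrow> real. antimono_on {0<..<R} f \<and>
     (AE x in lebesgue_on (ball 0 R). u x = f (norm x)))"

end

theory Submission
  imports Defs
begin

text \<open>Let \<open>u\<close> be a minimizer. For almost every direction \<open>y\<close>, the restriction of \<open>u\<close> to the ray through \<open>y\<close>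
  is a radial profile which vanishes at \<open>R\<close>, and it defines a radial competitor. Since \<open>Wt\<close> is increasing
  and \<open>\<bar>\<partial>\<^sub>r u\<bar> \<le> norm (\<nabla> u)\<close>, the average over \<open>y\<close> of the energies of these competitors is at most the energy of \<open>u\<close>;
  hence almost every one of them is a minimizer, and \<open>Wt \<bar>\<partial>\<^sub>r u\<bar> = Wt (norm (\<nabla> u))\<close> almost everywhere.

  Under the condition of (ii) this equality forces the gradient to be radial. Then the mollifications of \<open>u\<close> are constant on spheres,
  because their derivative along a rotation field is the integral of \<open>\<nabla> u\<close> against a tangential field, and so
  \<open>u\<close> is radially symmetric.

  Let \<open>h = - \<partial>\<^sub>r u\<close> be a minimizing profile. Replacing \<open>\<bar>h r\<bar>\<close> by the right end point of the interval
  on which \<open>Wt\<close> takes the value \<open>Wt \<bar>h r\<bar>\<close> does not change the first term of the energy and makes the function as large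
  as possible, so that the second term decreases when \<open>G\<close> is decreasing. The new profile is nonnegative and at least \<open>M0\<close>.
  When \<open>G\<close> is strictly decreasing, a minimizer must coincide with its modification up to a sign.\<close>

section \<open>Smooth functions\<close>

text \<open>No Euler-Lagrange equation is at hand and \<open>energy\<close> may be infinite, so
  everything rests on comparing integrals: ordered integrands with equal integrals agree almost
  everywhere. The obstacle is the admissibility of the competitors. The profile of a single ray is
  only a measurable function of the radius, yet the function built from it must lie in
  \<open>W1p_0\<close>, whose definition asks for approximation by test functions that are smooth at
  the origin too. This is why a profile is described by its derivative \<open>h\<close>, why
  membership is proved for every \<open>h\<close> with finite p-th power in the weighted radial
  measure (\<open>W0rad_rprof\<close>), and why a Poincare inequality on rays appears. Averaging
  over directions never compares two rays, so radial symmetry of a given minimizer needs a separate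
  argument; it exploits that functions in the closure may be tested with functions that do not
  vanish on the boundary sphere. Since the spaces are defined through a selected weak gradient,
  pairs of Borel functions (\<open>W0\<close>) take its place throughout.\<close>

primrec C1k :: "nat \<Rightarrow> (real \<Rightarrow> real) \<Rightarrow> bool" where
  "C1k 0 f \<longleftrightarrow> continuous_on UNIV f"
| "C1k (Suc k) f \<longleftrightarrow> (\<exists>f'. (\<forall>t. (f has_real_derivative f' t) (at t)) \<and> C1k k f')"

lemma C1k_SucD: "C1k (Suc k) f \<Longrightarrow> C1k k f"
proof (induction k arbitrary: f)
  case 0
  then show ?case
    by (auto intro!: continuous_at_imp_continuous_on intro: DERIV_isCont)
next
  case (Suc k)
  then show ?case by (metis C1k.simps(2))
qed

lemma C1k_const: "C1k k (\<lambda>t. c)"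
  by (induction k arbitrary: c) (auto intro!: exI[of _ "\<lambda>_. 0"])

lemma C1k_add: "C1k k f \<Longrightarrow> C1k k g \<Longrightarrow> C1k k (\<lambda>t. f t + g t)"
proof (induction k arbitrary: f g)
  case 0
  then show ?case by (auto intro: continuous_intros)
next
  case (Suc k)
  then obtain f' g' where *: "\<And>t. (f has_real_derivative f' t) (at t)" "C1k k f'"
    "\<And>t. (g has_real_derivative g' t) (at t)" "C1k k g'" by auto
  show ?case
    using * Suc.IH[of f' g'] by (auto intro!: exI[of _ "\<lambda>t. f' t + g' t"] derivative_eq_intros)
qed

lemma C1k_mult: "C1k k f \<Longrightarrow> C1k k g \<Longrightarrow> C1k k (\<lambda>t. f t * g t)"
proof (induction k arbitrary: f g)
  case 0
  then show ?case by (auto intro: continuous_intros)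
next
  case (Suc k)
  then obtain f' g' where *: "\<And>t. (f has_real_derivative f' t) (at t)" "C1k k f'"
    "\<And>t. (g has_real_derivative g' t) (at t)" "C1k k g'" by auto
  have "C1k k (\<lambda>t. f' t * g t + f t * g' t)"
    using * C1k_SucD[OF Suc.prems(1)] C1k_SucD[OF Suc.prems(2)] by (intro C1k_add Suc.IH)
  then show ?case
    using * by (auto intro!: exI[of _ "\<lambda>t. f' t * g t + f t * g' t"] derivative_eq_intros)
qed

lemma C1k_affine: "C1k k f \<Longrightarrow> C1k k (\<lambda>t. f (a * t + b))"
proof (induction k arbitrary: f)
  case 0
  then show ?case
    by (auto intro!: continuous_intros elim!: continuous_on_compose2)
next
  case (Suc k)
  then obtain f' where *: "\<And>t. (f has_real_derivative f' t) (at t)" "C1k k f'" by auto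
  have "((\<lambda>t. f (a * t + b)) has_real_derivative f' (a * t + b) * a) (at t)" for t
    by (rule DERIV_chain2[OF *(1)]) (auto intro!: derivative_eq_intros)
  moreover have "C1k k (\<lambda>t. f' (a * t + b) * a)"
    by (intro C1k_mult C1k_const Suc.IH *)
  ultimately show ?case by (auto intro!: exI[of _ "\<lambda>t. f' (a * t + b) * a"])
qed

lemma C1k_antideriv: "(\<And>t. (m has_real_derivative f t) (at t)) \<Longrightarrow> C1k k f \<Longrightarrow> C1k k m"
  by (rule C1k_SucD) (auto simp del: C1k.simps(1))

text \<open>Differentiating \<open>flat_exp 0\<close> produces powers of 1/t. With these powers
  included, the family is closed under differentiation up to linear combinations, and one induction
  over k, for all n at once, gives smoothness.\<close>

definition flat_exp :: "nat \<Rightarrow> real \<Rightarrow> real" where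
  "flat_exp n t = (if t > 0 then (1/t) ^ n * exp (- (1/t)) else 0)"

lemma flat_exp_tendsto: "((\<lambda>t. flat_exp n t) \<longlongrightarrow> 0) (at_right 0)"
proof -
  have "((\<lambda>t::real. (inverse t) ^ n / exp (inverse t)) \<longlongrightarrow> 0) (at_right 0)"
    using filterlim_compose[OF tendsto_power_div_exp_0 filterlim_inverse_at_top_right] .
  then show ?thesis
    by (rule Lim_transform_eventually)
      (auto simp: eventually_at_right_field flat_exp_def exp_minus divide_inverse intro!: exI[of _ 1])
qed

lemma flat_exp_deriv:
  "(flat_exp n has_real_derivative (flat_exp (n + 2) t - real n * flat_exp (n + 1) t)) (at t)"
proof (cases "t = 0")
  case True
  \<comment> \<open>For positive s the quotient \<open>flat_exp n s / s\<close> is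
    \<open>flat_exp (n + 1) s\<close>, so the limit at 0 is already known.\<close>
  have R: "((\<lambda>s. flat_exp n s / s) \<longlongrightarrow> 0) (at_right 0)"
    by (rule Lim_transform_eventually[OF flat_exp_tendsto[of "Suc n"]])
      (auto simp: eventually_at_right_field flat_exp_def intro!: exI[of _ 1])
  have L: "((\<lambda>s. flat_exp n s / s) \<longlongrightarrow> 0) (at_left 0)"
    by (rule Lim_transform_eventually[OF tendsto_const])
      (auto simp: eventually_at_left_field flat_exp_def intro!: exI[of _ "-1"])
  have "((\<lambda>s. (flat_exp n s - flat_exp n 0) / (s - 0)) \<longlongrightarrow> 0) (at 0)"
    using L R by (simp add: filterlim_split_at flat_exp_def[of n 0])
  then show ?thesis
    using True by (simp add: has_field_derivative_iff flat_exp_def[of _ 0])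
next
  case False
  show ?thesis
  proof (cases "t > 0")
    case True
    have "((\<lambda>t. (1/t) ^ n * exp (- (1/t))) has_real_derivative
       (flat_exp (n + 2) t - real n * flat_exp (n + 1) t)) (at t)"
    proof -
      have "((\<lambda>t. (1/t) ^ n * exp (- (1/t))) has_real_derivative
        real n * (1/t) ^ (n - 1) * (- (1/t)\<^sup>2) * exp (- (1/t)) + (1/t) ^ n * (exp (- (1/t)) * (1/t)\<^sup>2)) (at t)"
        using True
        by (auto intro!: derivative_eq_intros simp: power2_eq_square)
      moreover have "real n * (1/t) ^ (n - 1) * (- (1/t)\<^sup>2) = - (real n * (1/t) ^ (n + 1))"
        by (cases n) (auto simp: power2_eq_square)
      moreover have "- (real n * q ^ (n + 1)) * e + q ^ n * (e * q\<^sup>2) = q ^ (n + 2) * e - real n * (q ^ (n + 1) * e)" for q e :: real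
        by (simp add: algebra_simps power2_eq_square)
      ultimately show ?thesis
        using True by (simp only: flat_exp_def if_True)
    qed
    then show ?thesis
      by (rule has_field_derivative_transform_within[where d = t])
        (use True in \<open>auto simp: flat_exp_def dist_real_def\<close>)
  next
    case F: False
    have "((\<lambda>t. 0) has_real_derivative
       (flat_exp (n + 2) t - real n * flat_exp (n + 1) t)) (at t)"
      using F by (auto simp: flat_exp_def)
    then show ?thesis
      by (rule has_field_derivative_transform_within[where d = "-t"])
        (use F False in \<open>auto simp: flat_exp_def dist_real_def\<close>)
  qed
qed

lemma C1k_flat_exp: "C1k k (flat_exp n)"
proof (induction k arbitrary: n)
  case 0
  then show ?case
    by (auto intro!: continuous_at_imp_continuous_on DERIV_isCont flat_exp_deriv)
next
  case (Suc k)
  have "C1k k (\<lambda>t. flat_exp (n + 2) t + (- real n) * flat_exp (n + 1) t)"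
    by (intro C1k_add C1k_mult C1k_const Suc)
  then show ?case
    using flat_exp_deriv[of n] by (auto intro!: exI[of _ "\<lambda>t. flat_exp (n + 2) t - real n * flat_exp (n + 1) t"])
qed

text \<open>The factors are positive exactly for t in (a + 1/k, b - 1/k), which keeps the support
  away from the end points. For fixed t in (a, b) both arguments tend to infinity and the product
  tends to 1, so the limit is the indicator of (a, b) although no bump has a plateau. For k = 0 both
  arguments are -1 and the bump vanishes.\<close>

definition bump :: "real \<Rightarrow> real \<Rightarrow> nat \<Rightarrow> real \<Rightarrow> real" where
  "bump a b k t = flat_exp 0 (real k * (t - a) - 1) * flat_exp 0 (real k * (b - t) - 1)"

lemma flat_exp_0_bounds: "0 \<le> flat_exp 0 t" "flat_exp 0 t \<le> 1"
  by (auto simp: flat_exp_def)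

lemma bump_bounds: "0 \<le> bump a b k t" "bump a b k t \<le> 1"
  using flat_exp_0_bounds by (auto simp: bump_def mult_le_one)

lemma C1k_bump: "C1k n (bump a b k)"
proof -
  have "C1k n (\<lambda>t. flat_exp 0 (real k * t + (- real k * a - 1)) * flat_exp 0 ((- real k) * t + (real k * b - 1)))"
    by (intro C1k_mult C1k_affine C1k_flat_exp)
  also have "(\<lambda>t. flat_exp 0 (real k * t + (- real k * a - 1)) * flat_exp 0 ((- real k) * t + (real k * b - 1)))
     = bump a b k"
    by (simp add: fun_eq_iff bump_def algebra_simps)
  finally show ?thesis .
qed

lemma bump_support: "bump a b k t \<noteq> 0 \<Longrightarrow> a + 1 / k < t \<and> t < b - 1 / k \<and> k > 0"
  by (cases "k = 0") (auto simp: bump_def flat_exp_def field_simps split: if_splits)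

lemma bump_tendsto: "(\<lambda>k. bump a b k t) \<longlonglongrightarrow> indicator {a<..<b} t"
proof (cases "a < t \<and> t < b")
  case True
  have *: "(\<lambda>k. flat_exp 0 (real k * s - 1)) \<longlonglongrightarrow> 1" if "s > 0" for s
  proof -
    have lim: "filterlim (\<lambda>k. real k * s - 1) at_top sequentially"
      using filterlim_tendsto_add_at_top[OF tendsto_const[of "-1"] filterlim_at_top_mult_tendsto_pos[OF tendsto_const that filterlim_real_sequentially]]
      by (simp add: mult.commute)
    then have ev: "eventually (\<lambda>k. real k * s - 1 > 0) sequentially"
      unfolding filterlim_at_top_dense by blast
    have "(\<lambda>k. exp (- (inverse (real k * s - 1)))) \<longlonglongrightarrow> 1"
      using tendsto_exp[OF tendsto_minus[OF tendsto_inverse_0_at_top[OF lim]]] by simp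
    then show ?thesis
      by (rule Lim_transform_eventually) (use ev in \<open>auto elim!: eventually_mono simp: flat_exp_def inverse_eq_divide\<close>)
  qed
  show ?thesis
    using tendsto_mult[OF *[of "t - a"] *[of "b - t"]] True by (simp add: bump_def)
next
  case False
  have "bump a b k t = 0" for k
  proof (rule ccontr)
    assume "bump a b k t \<noteq> 0"
    then have *: "a + 1 / k < t \<and> t < b - 1 / k \<and> k > 0" by (rule bump_support)
    moreover have "1 / real k \<ge> 0" by simp
    ultimately have "a < t" "t < b" by linarith+
    with False show False by simp
  qed
  then show ?thesis using False by (auto simp: indicator_def)
qed

lemma bump_measurable [measurable]: "bump a b k \<in> borel_measurable borel"
  using C1k_bump[of 0 a b k] by (auto intro: borel_measurable_continuous_onI)

section \<open>Smoothness in several variables and gradients\<close>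

lemma Ck_SucD: "Ck (Suc k) f \<Longrightarrow> Ck k f"
proof (induction k arbitrary: f)
  case 0
  then show ?case
    by (auto intro!: continuous_at_imp_continuous_on differentiable_imp_continuous_within)
next
  case (Suc k)
  then show ?case by (metis Ck.simps(2))
qed

lemma partial_deriv_eq: "(f has_derivative f') (at x) \<Longrightarrow> partial_deriv i f x = f' (axis i 1)"
  unfolding partial_deriv_def using frechet_derivative_at by metis

lemma Ck_imp_has_derivative:
  "Ck (Suc k) f \<Longrightarrow> (f has_derivative frechet_derivative f (at x)) (at x)"
  by (auto simp: frechet_derivative_works)

lemma Ck_const: "Ck k (\<lambda>t. c)"
proof (induction k arbitrary: c)
  case (Suc k)
  have "partial_deriv i (\<lambda>t. c) = (\<lambda>t. 0)" for i :: "'a"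
    by (rule ext) (subst partial_deriv_eq, rule has_derivative_const, simp)
  with Suc show ?case by auto
qed auto

lemma Ck_add: "Ck k f \<Longrightarrow> Ck k g \<Longrightarrow> Ck k (\<lambda>t. f t + g t)"
proof (induction k arbitrary: f g)
  case 0
  then show ?case by (auto intro: continuous_intros)
next
  case (Suc k)
  have "partial_deriv i (\<lambda>t. f t + g t) = (\<lambda>t. partial_deriv i f t + partial_deriv i g t)" for i
    by (rule ext, subst partial_deriv_eq)
      (rule has_derivative_add, (rule Ck_imp_has_derivative, rule Suc)+, simp add: partial_deriv_def)
  with Suc show ?case by (auto intro: differentiable_add)
qed

lemma Ck_mult: "Ck k f \<Longrightarrow> Ck k g \<Longrightarrow> Ck k (\<lambda>t. f t * g t)"
proof (induction k arbitrary: f g)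
  case 0
  then show ?case by (auto intro: continuous_intros)
next
  case (Suc k)
  have *: "partial_deriv i (\<lambda>t. f t * g t) = (\<lambda>t. f t * partial_deriv i g t + partial_deriv i f t * g t)" for i
    by (rule ext, subst partial_deriv_eq)
      (rule has_derivative_mult, (rule Ck_imp_has_derivative, rule Suc)+, simp add: partial_deriv_def)
  have "Ck k (\<lambda>t. f t * partial_deriv i g t + partial_deriv i f t * g t)" for i
    using Suc.prems Ck_SucD[OF Suc.prems(1)] Ck_SucD[OF Suc.prems(2)] by (intro Ck_add Suc.IH) auto
  with Suc.prems show ?case by (auto intro: differentiable_mult simp: *)
qed

lemma Ck_prod: "finite I \<Longrightarrow> (\<And>i. i \<in> I \<Longrightarrow> Ck k (f i)) \<Longrightarrow> Ck k (\<lambda>x. \<Prod>i\<in>I. f i x)"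
  by (induction I rule: finite_induct) (auto intro: Ck_const Ck_mult)

lemma Ck_component: "Ck k (\<lambda>x. x $ i)"
proof (cases k)
  case (Suc l)
  have d: "((\<lambda>x. x $ i) has_derivative (\<lambda>x. x $ i)) (at x)" for x :: "real^'a"
    by (intro bounded_linear_imp_has_derivative bounded_linear_vec_nth)
  have "partial_deriv j (\<lambda>x. x $ i) = (\<lambda>x. axis j 1 $ i)" for j :: "'a"
    by (rule ext) (subst partial_deriv_eq, rule d, simp)
  moreover have "(\<lambda>x. x $ i) differentiable (at x)" for x :: "real^'a"
    using d by (auto simp: differentiable_def)
  ultimately show ?thesis using Suc Ck_const by auto
qed (auto intro!: continuous_intros)

lemma Ck_sum: "finite I \<Longrightarrow> (\<And>i. i \<in> I \<Longrightarrow> Ck k (f i)) \<Longrightarrow> Ck k (\<lambda>x. \<Sum>i\<in>I. f i x)"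
  by (induction I rule: finite_induct) (auto intro: Ck_const Ck_add)

lemma Ck_compose: "C1k k m \<Longrightarrow> Ck k f \<Longrightarrow> Ck k (\<lambda>x. m (f x))"
proof (induction k arbitrary: m)
  case 0
  then show ?case by (auto intro: continuous_on_compose2)
next
  case (Suc k)
  then obtain m' where m': "\<And>t. (m has_real_derivative m' t) (at t)" "C1k k m'" by auto
  have d: "((\<lambda>x. m (f x)) has_derivative (\<lambda>h. m' (f x) * frechet_derivative f (at x) h)) (at x)" for x
    using has_derivative_compose[OF Ck_imp_has_derivative[OF Suc.prems(2)] m'(1)[unfolded has_field_derivative_def]]
    by simp
  have *: "partial_deriv i (\<lambda>x. m (f x)) = (\<lambda>x. m' (f x) * partial_deriv i f x)" for i
    by (rule ext, subst partial_deriv_eq, rule d) (simp add: partial_deriv_def)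
  have "Ck k (\<lambda>x. m' (f x) * partial_deriv i f x)" for i
    using Ck_mult[OF Suc.IH[OF m'(2) Ck_SucD[OF Suc.prems(2)]]] Suc.prems(2) by simp
  moreover have "(\<lambda>x. m (f x)) differentiable at x" for x
    using d by (auto simp: differentiable_def)
  ultimately show ?case by (simp add: *)
qed

text \<open>The norm is not smooth at its centre, but its square is a polynomial; all radial test
  functions and kernels below are therefore functions of the squared distance.\<close>

lemma Ck_inner_self_shift: "Ck k (\<lambda>y. (y - x) \<bullet> (y - x))"
proof -
  have "Ck k (\<lambda>y. \<Sum>i\<in>UNIV. (y $ i + (- (x $ i))) * (y $ i + (- (x $ i))))"
    by (intro Ck_sum Ck_mult Ck_add Ck_component Ck_const) auto
  then show ?thesis by (simp add: inner_vec_def)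
qed

definition grad :: "(real^'n::finite \<Rightarrow> real) \<Rightarrow> real^'n \<Rightarrow> real^'n" where
  "grad f x = (\<chi> i. partial_deriv i f x)"

lemma grad_nth [simp]: "grad f x $ i = partial_deriv i f x"
  by (simp add: grad_def)

lemma grad_inner:
  assumes "f differentiable (at x)"
  shows "grad f x \<bullet> v = frechet_derivative f (at x) v"
proof -
  interpret linear "frechet_derivative f (at x)"
    using assms by (rule linear_frechet_derivative)
  have "frechet_derivative f (at x) v = frechet_derivative f (at x) (\<Sum>i\<in>UNIV. (v $ i) *\<^sub>R axis i 1)"
    by (simp add: basis_expansion scalar_mult_eq_scaleR[symmetric])
  also have "\<dots> = (\<Sum>i\<in>UNIV. (v $ i) * partial_deriv i f x)"
    by (simp add: sum scale partial_deriv_def)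
  finally show ?thesis by (simp add: inner_vec_def mult.commute)
qed

lemma has_derivative_grad:
  assumes "f differentiable (at x)"
  shows "(f has_derivative (\<lambda>v. grad f x \<bullet> v)) (at x)"
  using assms grad_inner[OF assms] by (simp add: frechet_derivative_works)

lemma grad_eqI:
  assumes "(f has_derivative (\<lambda>v. g \<bullet> v)) (at x)"
  shows "grad f x = g"
  by (simp add: vec_eq_iff partial_deriv_eq[OF assms] inner_axis)

lemma grad_mult: "f differentiable (at x) \<Longrightarrow> g differentiable (at x) \<Longrightarrow>
    grad (\<lambda>x. f x * g x) x = f x *\<^sub>R grad g x + g x *\<^sub>R grad f x"
  by (rule grad_eqI, rule has_derivative_eq_rhs,
      rule has_derivative_mult[OF has_derivative_grad has_derivative_grad])
    (auto simp: inner_add_left fun_eq_iff)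

section \<open>Test functions and weak gradients\<close>

lemma test_functionsI:
  assumes "\<And>k. Ck k f" "compact K" "K \<subseteq> U" "\<And>x. f x \<noteq> 0 \<Longrightarrow> x \<in> K"
  shows "f \<in> test_functions U"
proof -
  have "closure {x. f x \<noteq> 0} \<subseteq> K"
    using assms by (intro closure_minimal) (auto simp: compact_imp_closed)
  then show ?thesis
    using assms compact_Int_closed[OF assms(2) closed_closure[of "{x. f x \<noteq> 0}"]]
    unfolding test_functions_def by (auto simp del: compact_closure simp: inf_absorb2)
qed

lemma test_functions_Ck: "f \<in> test_functions U \<Longrightarrow> Ck k f"
  by (simp add: test_functions_def)

lemma test_functions_support:
  assumes "f \<in> test_functions U"
  shows "\<exists>K. compact K \<and> K \<subseteq> U \<and> (\<forall>x. f x \<noteq> 0 \<longrightarrow> x \<in> K)"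
  using assms closure_subset[of "{x. f x \<noteq> 0}"] unfolding test_functions_def by blast

lemma test_functions_mono: "U \<subseteq> V \<Longrightarrow> test_functions U \<subseteq> test_functions V"
  unfolding test_functions_def by auto

lemma zero_test_function: "(\<lambda>x. 0) \<in> test_functions U"
  by (rule test_functionsI[of _ "{}"]) (auto intro: Ck_const)

lemma test_functions_mult:
  assumes "f \<in> test_functions U" "\<And>k. Ck k g"
  shows "(\<lambda>x. f x * g x) \<in> test_functions U"
proof -
  obtain K where "compact K" "K \<subseteq> U" "\<And>x. f x \<noteq> 0 \<Longrightarrow> x \<in> K"
    using test_functions_support[OF assms(1)] by blast
  then show ?thesis
    using Ck_mult[OF test_functions_Ck[OF assms(1)] assms(2)] by (intro test_functionsI[of _ K]) auto
qed

lemma test_functions_differentiable: "f \<in> test_functions U \<Longrightarrow> f differentiable (at x)"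
  using test_functions_Ck[of f U "Suc 0"] by simp

lemma Ck_continuous_grad:
  assumes "Ck (Suc 0) f"
  shows "continuous_on UNIV (grad f)"
  using assms unfolding grad_def by (auto intro!: continuous_on_vec_lambda)

lemma grad_eq_0_outside:
  assumes "closed K" "\<And>y. f y \<noteq> 0 \<Longrightarrow> y \<in> K" "x \<notin> K"
  shows "grad f x = 0"
proof (rule grad_eqI, rule has_derivative_transform_within_open[of "\<lambda>_. 0" _ _ UNIV "- K"])
  show "((\<lambda>_. 0) has_derivative (\<bullet>) 0) (at x)"
    using has_derivative_const[of 0] by (simp add: inner_zero_left[abs_def])
qed (use assms in auto)

lemma continuous_support_bounded:
  fixes f :: "'a::real_normed_vector \<Rightarrow> 'b::real_normed_vector"
  assumes "continuous_on UNIV f" "compact K" "\<And>x. x \<notin> K \<Longrightarrow> f x = 0"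
  shows "\<exists>B>0. \<forall>x. norm (f x) \<le> B"
proof -
  have "bounded (f ` K)"
    using assms by (intro compact_imp_bounded compact_continuous_image) (auto intro: continuous_on_subset)
  then obtain B where B: "B > 0" "\<And>x. x \<in> K \<Longrightarrow> norm (f x) \<le> B"
    by (auto simp: bounded_pos)
  have "norm (f x) \<le> B" for x
    using B assms(3)[of x] by (cases "x \<in> K") auto
  then show ?thesis using B(1) by blast
qed

lemma Ck_integrable:
  fixes f :: "real^'n::finite \<Rightarrow> 'b::euclidean_space"
  assumes "continuous_on UNIV f" "compact K" "\<And>x. x \<notin> K \<Longrightarrow> f x = 0"
  shows "integrable lborel f"
proof -
  have "set_integrable lborel K f"
    unfolding set_integrable_def using assms by (intro borel_integrable_compact) (auto intro: continuous_on_subset)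
  moreover have "(\<lambda>x. indicator K x *\<^sub>R f x) = f"
    using assms(3) by (auto simp: indicator_def fun_eq_iff)
  ultimately show ?thesis by (simp add: set_integrable_def)
qed

lemma test_functions_continuous:
  assumes "f \<in> test_functions U"
  shows "continuous_on UNIV f" "continuous_on UNIV (grad f)" "continuous_on UNIV (partial_deriv i f)"
proof -
  show "continuous_on UNIV f"
    using test_functions_Ck[OF assms, of 0] by simp
  show "continuous_on UNIV (grad f)"
    by (rule Ck_continuous_grad[OF test_functions_Ck[OF assms]])
  show "continuous_on UNIV (partial_deriv i f)"
    using test_functions_Ck[OF assms, of "Suc 0"] by simp
qed

lemma test_functions_bounds:
  assumes "f \<in> test_functions U"
  shows "\<exists>B>0. \<forall>x. \<bar>f x\<bar> \<le> B \<and> norm (grad f x) \<le> B"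
proof -
  obtain K where "compact K" "K \<subseteq> U" "\<And>x. f x \<noteq> 0 \<Longrightarrow> x \<in> K"
    using test_functions_support[OF assms] by blast
  note K = this(1,3)
  have "grad f x = 0" if "x \<notin> K" for x
    using grad_eq_0_outside[OF compact_imp_closed[OF K(1)] K(2)] that by simp
  with continuous_support_bounded[OF test_functions_continuous(2)[OF assms] K(1)]
  obtain B2 where B2: "B2 > 0" "\<And>x. norm (grad f x) \<le> B2"
    by blast
  have "f x = 0" if "x \<notin> K" for x using K(2)[of x] that by auto
  with continuous_support_bounded[OF test_functions_continuous(1)[OF assms] K(1)]
  obtain B1 where B1: "B1 > 0" "\<And>x. norm (f x) \<le> B1"
    by blast
  show ?thesis
  proof (intro exI[of _ "B1 + B2"] conjI allI)
    show "\<bar>f x\<bar> \<le> B1 + B2" "norm (grad f x) \<le> B1 + B2" for x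
      using B1(1) B1(2)[of x] B2(1) B2(2)[of x] by simp_all
  qed (use B1 B2 in simp)
qed

lemma test_functions_measurable:
  assumes "f \<in> test_functions U"
  shows "f \<in> borel_measurable borel" "grad f \<in> borel_measurable borel" "partial_deriv i f \<in> borel_measurable borel"
  using test_functions_continuous[OF assms] by (simp_all add: borel_measurable_continuous_onI)

text \<open>By translation invariance every difference quotient of \<open>f\<close> has integral 0,
  and dominated convergence passes this to the derivative. Integration by parts is then the product
  rule.\<close>

lemma integral_partial_deriv_eq_0:
  fixes f :: "real^'n::finite \<Rightarrow> real"
  assumes "f \<in> test_functions U"
  shows "(LINT x|lborel. partial_deriv i f x) = 0"
proof -
  obtain K where "compact K" "K \<subseteq> U" "\<And>x. f x \<noteq> 0 \<Longrightarrow> x \<in> K"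
    using test_functions_support[OF assms] by blast
  note K = this(1,3)
  obtain B where B: "B > 0" "\<And>x. \<bar>f x\<bar> \<le> B" "\<And>x. norm (grad f x) \<le> B"
    using test_functions_bounds[OF assms] by blast
  define e where "e = (axis i 1 :: real^'n)"
  have e: "norm e = 1" by (simp add: e_def)
  \<comment> \<open>The closed 1-neighbourhood of \<open>K\<close> contains the supports of all
    difference quotients with step at most 1, so \<open>B\<close> times its indicator is an
    integrable majorant.\<close>
  define K' where "K' = (\<lambda>(x, y). x + y) ` (K \<times> cball 0 1)"
  have K': "compact K'"
    unfolding K'_def using K by (intro compact_continuous_image compact_Times) (auto intro!: continuous_intros simp: case_prod_unfold)
  have inK': "x \<in> K'" if "x + t *\<^sub>R e \<in> K" "\<bar>t\<bar> \<le> 1" for x t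
    unfolding K'_def by (rule image_eqI[of _ _ "(x + t *\<^sub>R e, - (t *\<^sub>R e))"]) (use that e in simp_all)
  have pd: "((\<lambda>t. f (x + t *\<^sub>R e)) has_real_derivative partial_deriv i f (x + t *\<^sub>R e)) (at t)" for x t
  proof -
    have "((\<lambda>t. f (x + t *\<^sub>R e)) has_derivative (\<lambda>s. grad f (x + t *\<^sub>R e) \<bullet> (s *\<^sub>R e))) (at t)"
      by (rule has_derivative_compose[OF _ has_derivative_grad[OF test_functions_differentiable[OF assms]]])
        (auto intro!: derivative_eq_intros)
    then show ?thesis
      unfolding has_field_derivative_def
      by (rule has_derivative_eq_rhs) (simp add: fun_eq_iff e_def inner_axis mult.commute)
  qed
  define s where "s n x = (f (x + (1 / real (Suc n)) *\<^sub>R e) - f x) * real (Suc n)" for n x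
  have cont: "continuous_on UNIV f"
    by (rule test_functions_continuous[OF assms])
  have [measurable]: "f \<in> borel_measurable borel" "partial_deriv i f \<in> borel_measurable borel"
    using test_functions_measurable[OF assms] by auto
  have fint: "integrable lborel f"
    using K cont by (intro Ck_integrable[of f K]) auto
  have fint': "integrable lborel (\<lambda>x. f (x + c))" for c
    using lborel_distr_plus[of c] fint integrable_distr_eq[of "(+) c" lborel borel f]
    by (simp add: add.commute)
  have shift: "(LINT x|lborel. f (x + c)) = (LINT x|lborel. f x)" for c
    using lborel_distr_plus[of c] integral_distr[of "(+) c" lborel borel f]
    by (simp add: add.commute)
  have s0: "(LINT x|lborel. s n x) = 0" for n
    unfolding s_def using fint fint' shift by simp
  have "(\<lambda>n. LINT x|lborel. s n x) \<longlonglongrightarrow> (LINT x|lborel. partial_deriv i f x)"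
  proof (rule integral_dominated_convergence[where w = "\<lambda>x. indicator K' x * B"])
    have "set_integrable lborel K' (\<lambda>x. B)"
      unfolding set_integrable_def using K' by (intro borel_integrable_compact) auto
    then show "integrable lborel (\<lambda>x. indicat_real K' x * B)"
      by (simp add: set_integrable_def)
    show "AE x in lborel. (\<lambda>n. s n x) \<longlonglongrightarrow> partial_deriv i f x"
    proof (intro AE_I2)
      fix x :: "real^'n"
      have "((\<lambda>h. (f (x + h *\<^sub>R e) - f x) / h) \<longlongrightarrow> partial_deriv i f x) (at 0)"
        using pd[of x 0] by (simp add: has_field_derivative_iff)
      moreover have "filterlim (\<lambda>n. 1 / real (Suc n)) (at 0) sequentially"
        unfolding filterlim_at using LIMSEQ_inverse_real_of_nat by (auto simp: inverse_eq_divide)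
      ultimately have "((\<lambda>n. (f (x + (1 / real (Suc n)) *\<^sub>R e) - f x) / (1 / real (Suc n))) \<longlonglongrightarrow> partial_deriv i f x)"
        by (rule filterlim_compose)
      then show "(\<lambda>n. s n x) \<longlonglongrightarrow> partial_deriv i f x"
        by (simp add: s_def)
    qed
    show "AE x in lborel. norm (s n x) \<le> indicat_real K' x * B" for n
    proof (intro AE_I2)
      fix x :: "real^'n"
      define h where "h = 1 / real (Suc n)"
      have h: "0 < h" "h \<le> 1" by (auto simp: h_def)
      show "norm (s n x) \<le> indicat_real K' x * B"
      proof (cases "x \<in> K'")
        case True
        obtain z where "0 < z" "z < h" "f (x + h *\<^sub>R e) - f (x + 0 *\<^sub>R e) = (h - 0) * partial_deriv i f (x + z *\<^sub>R e)"
          using MVT2[OF h(1), of "\<lambda>t. f (x + t *\<^sub>R e)" "\<lambda>t. partial_deriv i f (x + t *\<^sub>R e)"] pd by blast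
        then have "s n x = partial_deriv i f (x + z *\<^sub>R e)"
          using h by (simp add: s_def h_def field_simps)
        then have "\<bar>s n x\<bar> \<le> norm (grad f (x + z *\<^sub>R e))"
          using component_le_norm_cart[of "grad f (x + z *\<^sub>R e)" i] by simp
        then show ?thesis using True B(3)[of "x + z *\<^sub>R e"] by simp
      next
        case False
        then have "f (x + h *\<^sub>R e) = 0" "f x = 0"
          using inK'[of x h] inK'[of x 0] h K(2)[of x] K(2)[of "x + h *\<^sub>R e"] by auto
        then show ?thesis using False by (simp add: s_def h_def)
      qed
    qed
  qed (simp_all add: s_def)
  then show ?thesis using s0 by (simp add: LIMSEQ_const_iff)
qed

lemma test_functions_by_parts:
  fixes f g :: "real^'n::finite \<Rightarrow> real"
  assumes f: "f \<in> test_functions U" and g: "g \<in> test_functions V"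
  shows "(LINT x|lborel. f x * partial_deriv i g x) = - (LINT x|lborel. partial_deriv i f x * g x)"
proof -
  obtain K where "compact K" "K \<subseteq> U" "\<And>x. f x \<noteq> 0 \<Longrightarrow> x \<in> K"
    using test_functions_support[OF f] by blast
  note K = this(1,3)
  have cont: "continuous_on UNIV f" "continuous_on UNIV g" "continuous_on UNIV (partial_deriv i f)"
    "continuous_on UNIV (partial_deriv i g)"
    by (rule test_functions_continuous[OF f] test_functions_continuous[OF g])+
  have f0: "partial_deriv i f x = 0" if "x \<notin> K" for x
    using grad_eq_0_outside[OF compact_imp_closed[OF K(1)] K(2)] that by (simp add: vec_eq_iff)
  have int: "integrable lborel (\<lambda>x. f x * partial_deriv i g x)" "integrable lborel (\<lambda>x. partial_deriv i f x * g x)"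
    by (rule Ck_integrable[of _ K]; use K f0 cont in \<open>force intro!: continuous_intros\<close>)+
  have "partial_deriv i (\<lambda>x. f x * g x) x = f x * partial_deriv i g x + partial_deriv i f x * g x" for x
    using arg_cong[OF grad_mult[OF test_functions_differentiable[OF f] test_functions_differentiable[OF g], of x], of "\<lambda>v. v $ i"]
    by (simp add: mult.commute)
  then have "(LINT x|lborel. f x * partial_deriv i g x + partial_deriv i f x * g x) = 0"
    using integral_partial_deriv_eq_0[OF test_functions_mult[OF f test_functions_Ck[OF g]], of i] by simp
  then show ?thesis using int by simp
qed

section \<open>Approximation of boxes and uniqueness of weak gradients\<close>

definition box_bump :: "real^'n::finite \<Rightarrow> real^'n \<Rightarrow> nat \<Rightarrow> real^'n \<Rightarrow> real" where
  "box_bump a b k x = (\<Prod>i\<in>UNIV. bump (a $ i) (b $ i) k (x $ i))"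

lemma box_bump_bounds: "0 \<le> box_bump a b k x" "box_bump a b k x \<le> 1"
  by (auto simp: box_bump_def bump_bounds intro!: prod_nonneg prod_le_1)

lemma box_bump_support: "box_bump a b k x \<noteq> 0 \<Longrightarrow> x \<in> box a b"
proof -
  assume "box_bump a b k x \<noteq> 0"
  then have *: "bump (a $ i) (b $ i) k (x $ i) \<noteq> 0" for i
    by (auto simp: box_bump_def)
  have "a $ i < x $ i \<and> x $ i < b $ i" for i
  proof -
    have "1 / real k \<ge> 0" by simp
    then show ?thesis using bump_support[OF *[of i]] by linarith
  qed
  then show ?thesis by (simp add: mem_box_cart)
qed

lemma box_bump_test: "cbox a b \<subseteq> U \<Longrightarrow> box_bump a b k \<in> test_functions U"
proof (rule test_functionsI[of _ "cbox a b"])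
  show "Ck m (box_bump a b k)" for m
    unfolding box_bump_def[abs_def] by (intro Ck_prod Ck_compose[OF C1k_bump Ck_component]) auto
  show "x \<in> cbox a b" if "box_bump a b k x \<noteq> 0" for x
    using box_bump_support[OF that] box_subset_cbox by blast
qed auto

lemma box_bump_tendsto: "(\<lambda>k. box_bump a b k x) \<longlonglongrightarrow> indicator (box a b) x"
proof -
  have "(\<lambda>k. box_bump a b k x) \<longlonglongrightarrow> (\<Prod>i\<in>UNIV. indicator {a $ i<..<b $ i} (x $ i))"
    unfolding box_bump_def by (intro tendsto_prod bump_tendsto)
  also have "(\<Prod>i\<in>UNIV. indicator {a $ i<..<b $ i} (x $ i)) = (indicator (box a b) x :: real)"
  proof (cases "x \<in> box a b")
    case True
    then show ?thesis by (simp add: mem_box_cart)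
  next
    case False
    then obtain i where "\<not> (a $ i < x $ i \<and> x $ i < b $ i)" by (auto simp: mem_box_cart)
    then have "indicator {a $ i<..<b $ i} (x $ i) = (0::real)" by (auto simp: indicator_def)
    then have "(\<Prod>i\<in>UNIV. indicator {a $ i<..<b $ i} (x $ i)) = (0::real)"
      by (intro prod_zero) auto
    then show ?thesis using False by simp
  qed
  finally show ?thesis .
qed

text \<open>The sets over which \<open>d\<close> integrates to 0 form a Dynkin system that contains
  the intersection-stable family of boxes, hence all Borel sets. That \<open>d\<close> vanishes
  outside one box supplies the integral over the whole space for the complement step.\<close>

lemma AE_zero_of_box_integrals:
  fixes d :: "'a::euclidean_space \<Rightarrow> real"
  assumes d: "integrable lborel d" and off: "\<And>x. x \<notin> box p q \<Longrightarrow> d x = 0"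
    and box: "\<And>a b. (LINT x:box a b|lborel. d x) = 0"
  shows "AE x in lborel. d x = 0"
proof (rule sigma_finite_measure.density_zero[OF sigma_finite_lborel d])
  have E: "Int_stable (range (\<lambda>(a, b). box a b :: 'a set))" "range (\<lambda>(a, b). box a b :: 'a set) \<subseteq> Pow UNIV"
    by (auto simp: Int_stable_def box_Int_box)
  have E2: "sigma_sets UNIV (range (\<lambda>(a, b). box a b :: 'a set)) = sets borel"
    by (subst borel_eq_box) (simp add: sets_measure_of)
  fix A :: "'a set" assume "A \<in> sets lborel"
  then have "A \<in> sigma_sets UNIV (range (\<lambda>(a, b). box a b :: 'a set))"
    by (simp add: E2)
  from E this show "(LINT x:A|lborel. d x) = 0"
  proof (induct rule: sigma_sets_induct_disjoint)
    case (basic A)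
    then show ?case using box by auto
  next
    case empty
    then show ?case by (simp add: set_lebesgue_integral_def)
  next
    case (compl A)
    then have [measurable]: "A \<in> sets borel"
      by (simp add: E2)
    have "(LINT x|lborel. d x) = (LINT x:box p q|lborel. d x)"
      unfolding set_lebesgue_integral_def using off
      by (intro Bochner_Integration.integral_cong) (auto simp: indicator_def)
    then have "(LINT x|lborel. d x) = 0" using box by simp
    moreover have "(LINT x:UNIV - A|lborel. d x) = (LINT x|lborel. d x - indicator A x *\<^sub>R d x)"
      unfolding set_lebesgue_integral_def
      by (intro Bochner_Integration.integral_cong) (auto simp: indicator_def)
    moreover have "integrable lborel (\<lambda>x. indicator A x *\<^sub>R d x)"
      using d by (intro integrable_mult_indicator) auto
    ultimately show ?case
      using d compl by (simp add: set_lebesgue_integral_def)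
  next
    case (union A)
    then have [measurable]: "A i \<in> sets borel" for i
      using union(2) by (auto simp: E2)
    have "set_integrable lborel (\<Union>i. A i) d"
      unfolding set_integrable_def using d by (intro integrable_mult_indicator) auto
    then have "(LINT x:(\<Union>i. A i)|lborel. d x) = (\<Sum>i. (LINT x:A i|lborel. d x))"
      using union(1) by (intro lebesgue_integral_countable_add) (auto simp: disjoint_family_on_def)
    then show ?case using union by simp
  qed
qed

lemma integral_lebesgue_on_borel:
  fixes f :: "'a::euclidean_space \<Rightarrow> 'b::{banach, second_countable_topology}"
  assumes "f \<in> borel_measurable borel" "S \<in> sets borel"
  shows "(LINT x|lebesgue_on S. f x) = (LINT x:S|lborel. f x)"
  using assms by (simp add: set_lebesgue_integral_def integral_restrict_space integral_completion)

lemma AE_lebesgue_on_iff: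
  "S \<in> sets lebesgue \<Longrightarrow> (AE x in lebesgue_on S. P x) \<longleftrightarrow> (AE x in lborel. x \<in> S \<longrightarrow> P x)"
  by (simp add: AE_restrict_space_iff AE_completion_iff)

text \<open>On a closed box inside \<open>U\<close> both gradients are integrable. The bumps turn
  the identities for test functions into vanishing integrals of each component of the difference
  over all smaller boxes, and countably many boxes exhaust \<open>U\<close>. Since \<open>u\<close>
  and \<open>v\<close> enter only under integrals, agreement almost everywhere suffices for
  them.\<close>

lemma weak_gradient_unique:
  fixes g :: "real^'n::finite \<Rightarrow> real^'n"
  assumes U: "open U" and g: "weak_gradient U u g" and h: "weak_gradient U v h"
    and uv: "AE x in lebesgue_on U. u x = v x"
  shows "AE x in lebesgue_on U. g x = h x"
proof -
  have [measurable]: "U \<in> sets lebesgue" using U by simp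
  have *: "AE x in lborel. x \<in> box a b \<longrightarrow> g x $ i = h x $ i" if ab: "cbox a b \<subseteq> U" for a b i
  proof -
    let ?d = "\<lambda>x. g x $ i - h x $ i"
    have ai: "g absolutely_integrable_on cbox a b" "h absolutely_integrable_on cbox a b"
      using g h ab unfolding weak_gradient_def locally_integrable_on_def by auto
    have gi: "set_integrable lebesgue (cbox a b) (\<lambda>x. f x $ i)"
      if "f absolutely_integrable_on cbox a b" for f :: "real^'n \<Rightarrow> real^'n"
      using integrable_bounded_linear[OF bounded_linear_vec_nth that[unfolded set_integrable_def], of i]
      by (simp add: set_integrable_def)
    have di: "integrable lebesgue (\<lambda>x. indicator (cbox a b) x * ?d x)"
      using set_integral_diff(1)[OF ai[THEN gi]] by (simp add: set_integrable_def)
    have [measurable]: "box a' b' \<in> sets lebesgue" "cbox a' b' \<in> sets lebesgue" for a' b' :: "real^'n" by simp_all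
    have di2: "integrable lebesgue (\<lambda>x. indicator (box a b) x * ?d x)"
    proof -
      have "integrable lebesgue (\<lambda>x. indicator (box a b) x *\<^sub>R (indicator (cbox a b) x * ?d x))"
        using di by (intro integrable_mult_indicator) auto
      also have "(\<lambda>x. indicator (box a b) x *\<^sub>R (indicator (cbox a b) x * ?d x)) = (\<lambda>x. indicator (box a b) x * ?d x)"
        using box_subset_cbox[of a b] by (auto simp: fun_eq_iff indicator_def)
      finally show ?thesis .
    qed
    have test0: "(LINT x|lebesgue. ?d x * \<phi> x) = 0" if phi: "\<phi> \<in> test_functions U" "\<And>x. \<phi> x \<noteq> 0 \<Longrightarrow> x \<in> cbox a b" for \<phi> :: "real^'n \<Rightarrow> real"
    proof -
      have \<phi>m[measurable]: "\<phi> \<in> borel_measurable lebesgue"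
        using test_functions_measurable(1)[OF phi(1)] by (intro measurable_completion) simp
      obtain B where B: "\<And>x. \<bar>\<phi> x\<bar> \<le> B"
        using test_functions_bounds[OF phi(1)] by blast
      have int: "integrable (lebesgue_on U) (\<lambda>x. f x $ i * \<phi> x)" if "f absolutely_integrable_on cbox a b" for f :: "real^'n \<Rightarrow> real^'n"
      proof -
        have I: "integrable lebesgue (\<lambda>x. (indicator (cbox a b) x *\<^sub>R f x $ i))"
          using gi[OF that] by (simp add: set_integrable_def)
        have "integrable lebesgue (\<lambda>x. (indicator (cbox a b) x *\<^sub>R f x $ i) * \<phi> x)"
        proof (rule Bochner_Integration.integrable_bound)
          show "integrable lebesgue (\<lambda>x. B * (indicator (cbox a b) x *\<^sub>R f x $ i))"
            using I by simp
          show "(\<lambda>x. (indicator (cbox a b) x *\<^sub>R f x $ i) * \<phi> x) \<in> borel_measurable lebesgue"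
            using borel_measurable_integrable[OF I] \<phi>m by (rule borel_measurable_times)
          have "\<bar>\<phi> x\<bar> \<le> \<bar>B\<bar>" for x using B[of x] by linarith
          then show "AE x in lebesgue. norm ((indicator (cbox a b) x *\<^sub>R f x $ i) * \<phi> x) \<le> norm (B * (indicator (cbox a b) x *\<^sub>R f x $ i))"
            by (intro AE_I2) (auto simp: abs_mult indicator_def mult.commute intro!: mult_right_mono)
        qed
        also have "(\<lambda>x. (indicator (cbox a b) x *\<^sub>R f x $ i) * \<phi> x) = (\<lambda>x. indicator U x *\<^sub>R (f x $ i * \<phi> x))"
          using phi(2) ab by (fastforce simp: fun_eq_iff indicator_def)
        finally show ?thesis by (simp add: integrable_restrict_space)
      qed
      have "(LINT x|lebesgue_on U. g x $ i * \<phi> x) = - (LINT x|lebesgue_on U. u x * partial_deriv i \<phi> x)"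
        using g phi(1) unfolding weak_gradient_def by auto
      also have "(LINT x|lebesgue_on U. u x * partial_deriv i \<phi> x) = (LINT x|lebesgue_on U. v x * partial_deriv i \<phi> x)"
      proof -
        have pm[measurable]: "partial_deriv i \<phi> \<in> borel_measurable lebesgue"
          using test_functions_measurable(3)[OF phi(1)] by (intro measurable_completion) simp
        have p0: "partial_deriv i \<phi> x = 0" if "x \<notin> cbox a b" for x
          using grad_eq_0_outside[OF closed_cbox phi(2) that] by (simp add: vec_eq_iff)
        have wi: "integrable lebesgue (\<lambda>x. indicator (cbox a b) x *\<^sub>R w x)" if "weak_gradient U w w'" for w w'
          using that ab unfolding weak_gradient_def locally_integrable_on_def set_integrable_def[symmetric] by auto
        have eq: "(LINT x|lebesgue_on U. w x * partial_deriv i \<phi> x) = (LINT x|lebesgue. (indicator (cbox a b) x *\<^sub>R w x) * partial_deriv i \<phi> x)" for w :: "real^'n \<Rightarrow> real"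
        proof -
          have "(LINT x|lebesgue_on U. w x * partial_deriv i \<phi> x) = (LINT x|lebesgue. indicator U x *\<^sub>R (w x * partial_deriv i \<phi> x))"
            by (rule integral_restrict_space) simp
          also have "(\<lambda>x. indicator U x *\<^sub>R (w x * partial_deriv i \<phi> x)) = (\<lambda>x. (indicator (cbox a b) x *\<^sub>R w x) * partial_deriv i \<phi> x)"
          proof
            fix x show "indicator U x *\<^sub>R (w x * partial_deriv i \<phi> x) = (indicator (cbox a b) x *\<^sub>R w x) * partial_deriv i \<phi> x"
              using p0[of x] ab by (cases "x \<in> cbox a b") (auto simp: indicator_def)
          qed
          finally show ?thesis .
        qed
        show ?thesis unfolding eq
        proof (rule integral_cong_AE)
          show "(\<lambda>x. (indicator (cbox a b) x *\<^sub>R u x) * partial_deriv i \<phi> x) \<in> borel_measurable lebesgue"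
            by (intro borel_measurable_times borel_measurable_integrable[OF wi[OF g]] pm)
          show "(\<lambda>x. (indicator (cbox a b) x *\<^sub>R v x) * partial_deriv i \<phi> x) \<in> borel_measurable lebesgue"
            by (intro borel_measurable_times borel_measurable_integrable[OF wi[OF h]] pm)
          have "AE x in lborel. x \<in> U \<longrightarrow> u x = v x"
            using uv by (subst (asm) AE_lebesgue_on_iff) auto
          then show "AE x in lebesgue. (indicator (cbox a b) x *\<^sub>R u x) * partial_deriv i \<phi> x = (indicator (cbox a b) x *\<^sub>R v x) * partial_deriv i \<phi> x"
            unfolding AE_completion_iff by eventually_elim (use ab in \<open>auto simp: indicator_def\<close>)
        qed
      qed
      also have "- \<dots> = (LINT x|lebesgue_on U. h x $ i * \<phi> x)"
        using h phi(1) unfolding weak_gradient_def by auto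
      finally have "(LINT x|lebesgue_on U. g x $ i * \<phi> x - h x $ i * \<phi> x) = 0"
        using ai[THEN int] by simp
      also have "(LINT x|lebesgue_on U. g x $ i * \<phi> x - h x $ i * \<phi> x) = (LINT x|lebesgue. ?d x * \<phi> x)"
        using phi(2) ab by (subst integral_restrict_space) (fastforce simp: indicator_def algebra_simps intro!: Bochner_Integration.integral_cong)+
      finally show ?thesis .
    qed
    have box0: "(LINT x|lebesgue. indicator (box a' b') x * ?d x) = 0" if "cbox a' b' \<subseteq> cbox a b" for a' b'
    proof -
      have "(\<lambda>k. LINT x|lebesgue. box_bump a' b' k x * (indicator (cbox a b) x * ?d x)) \<longlonglongrightarrow> (LINT x|lebesgue. indicator (box a' b') x * (indicator (cbox a b) x * ?d x))"
      proof (rule integral_dominated_convergence[where w = "\<lambda>x. \<bar>indicator (cbox a b) x * ?d x\<bar>"])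
        have [measurable]: "box_bump a' b' k \<in> borel_measurable lebesgue" for k
          using test_functions_measurable(1)[OF box_bump_test[OF order_refl]] by (intro measurable_completion) simp
        show "(\<lambda>x. box_bump a' b' k x * (indicator (cbox a b) x * ?d x)) \<in> borel_measurable lebesgue" for k
          by (intro borel_measurable_times borel_measurable_integrable[OF di]) measurable
        show "(\<lambda>x. indicator (box a' b') x * (indicator (cbox a b) x * ?d x)) \<in> borel_measurable lebesgue"
          by (intro borel_measurable_times borel_measurable_integrable[OF di]) measurable
        show "integrable lebesgue (\<lambda>x. \<bar>indicator (cbox a b) x * ?d x\<bar>)"
          using di by simp
        show "AE x in lebesgue. (\<lambda>k. box_bump a' b' k x * (indicator (cbox a b) x * ?d x)) \<longlonglongrightarrow> indicator (box a' b') x * (indicator (cbox a b) x * ?d x)"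
          by (intro AE_I2 tendsto_mult_right box_bump_tendsto)
        show "AE x in lebesgue. norm (box_bump a' b' k x * (indicator (cbox a b) x * ?d x)) \<le> \<bar>indicator (cbox a b) x * ?d x\<bar>" for k
          using box_bump_bounds[of a' b' k] by (auto simp: abs_mult intro!: mult_left_le_one_le)
      qed
      moreover have "(LINT x|lebesgue. box_bump a' b' k x * (indicator (cbox a b) x * ?d x)) = 0" for k
      proof -
        have in_box: "x \<in> cbox a b" if "box_bump a' b' k x \<noteq> 0" for x
          using box_bump_support[OF that] \<open>cbox a' b' \<subseteq> cbox a b\<close> box_subset_cbox by blast
        have "(\<lambda>x. box_bump a' b' k x * (indicator (cbox a b) x * ?d x)) = (\<lambda>x. ?d x * box_bump a' b' k x)"
          using in_box by (fastforce simp: fun_eq_iff indicator_def)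
        then show ?thesis
          using test0[OF box_bump_test in_box] that ab by simp
      qed
      moreover have "(\<lambda>x. indicator (box a' b') x * (indicator (cbox a b) x * ?d x)) = (\<lambda>x. indicator (box a' b') x * ?d x)"
        using that box_subset_cbox by (fastforce simp: fun_eq_iff indicator_def)
      ultimately show ?thesis by (simp add: LIMSEQ_const_iff)
    qed
    \<comment> \<open>\<open>AE_zero_of_box_integrals\<close> speaks about \<open>lborel\<close>, so
      the Lebesgue measurable difference is replaced by a Borel function, cut off outside the
      box.\<close>
    obtain e where e: "e \<in> borel_measurable lborel" "AE x in lborel. indicator (box a b) x * ?d x = e x"
      using completion_ex_borel_measurable_real[OF borel_measurable_integrable[OF di2]] by blast
    define e' where "e' x = indicator (box a b) x * e x" for x
    have e'm[measurable]: "e' \<in> borel_measurable borel"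
      unfolding e'_def[abs_def] using e(1) by simp
    have e': "AE x in lborel. indicator (box a b) x * ?d x = e' x"
      using e(2) by eventually_elim (auto simp: e'_def indicator_def)
    have "AE x in lborel. e' x = 0"
    proof (rule AE_zero_of_box_integrals[of _ a b])
      have "integrable lebesgue e'"
        using di2 by (rule integrable_cong_AE_imp) (use e' AE_completion in \<open>auto intro: measurable_completion\<close>)
      then show "integrable lborel e'"
        by (simp add: integrable_completion)
      show "e' x = 0" if "x \<notin> box a b" for x using that by (simp add: e'_def)
      show "(LINT x:box a' b'|lborel. e' x) = 0" for a' b'
      proof -
        \<comment> \<open>The closed box must stay inside \<open>cbox a b\<close>. The corners of an
          empty intersection give no such control, so that case is rewritten with corners in reverse
          order, for which the closed box is empty as well.\<close>
        obtain a'' b'' where c: "box a' b' \<inter> box a b = box a'' b''" "cbox a'' b'' \<subseteq> cbox a b"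
        proof (cases "box a' b' \<inter> box a b = {}")
          case True
          have "cbox (vec 1) (vec 0) = ({} :: (real^'n) set)" by (auto simp: mem_box_cart dest!: spec)
          then show ?thesis
            using True box_subset_cbox[of "vec 1 :: real^'n" "vec 0"] by (intro that[of "vec 1" "vec 0"]) auto
        next
          case False
          obtain a'' b'' where c: "box a' b' \<inter> box a b = box a'' b''"
            unfolding box_Int_box by blast
          then have "closure (box a'' b'') \<subseteq> cbox a b"
            using box_subset_cbox[of a b] by (intro closure_minimal) auto
          then show ?thesis using that[OF c] False c by (simp add: closure_box)
        qed
        have "(LINT x:box a' b'|lborel. e' x) = (LINT x|lebesgue. indicator (box a' b') x * e' x)"
          unfolding set_lebesgue_integral_def by (subst integral_completion) auto
        also have "\<dots> = (LINT x|lebesgue. indicator (box a'' b'') x * ?d x)"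
        proof (rule integral_cong_AE)
          have [measurable]: "e' \<in> borel_measurable lebesgue" by (rule measurable_completion) simp
          show "(\<lambda>x. indicator (box a' b') x * e' x) \<in> borel_measurable lebesgue" by measurable
          have "(\<lambda>x. indicator (box a'' b'') x * ?d x) = (\<lambda>x. indicator (box a'' b'') x * (indicator (cbox a b) x * ?d x))"
            using c box_subset_cbox by (fastforce simp: fun_eq_iff indicator_def)
          also have "\<dots> \<in> borel_measurable lebesgue"
            by (intro borel_measurable_times borel_measurable_integrable[OF di]) measurable
          finally show "(\<lambda>x. indicator (box a'' b'') x * ?d x) \<in> borel_measurable lebesgue" .
          show "AE x in lebesgue. indicator (box a' b') x * e' x = indicator (box a'' b'') x * ?d x"
            unfolding AE_completion_iff using e'
            by eventually_elim (use c in \<open>auto simp: indicator_def e'_def split: if_splits\<close>)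
        qed
        finally show ?thesis using box0[OF c(2)] by simp
      qed
    qed
    with e' show ?thesis by eventually_elim (auto simp: indicator_def split: if_splits)
  qed
  have **: "AE x in lborel. x \<in> cbox a b \<longrightarrow> g x = h x" if "cbox a b \<subseteq> U" for a b
  proof -
    have "AE x in lborel. \<forall>i\<in>UNIV. x \<in> box a b \<longrightarrow> g x $ i = h x $ i"
      using *[OF that] by (intro AE_finite_allI) auto
    \<comment> \<open>Only the open box has been reached; its boundary is negligible.\<close>
    moreover have "AE x in lborel. x \<notin> cbox a b - box a b"
    proof -
      have "cbox a b - box a b \<in> null_sets lebesgue"
        using negligible_frontier_interval[of a b] by (simp add: negligible_iff_null_sets)
      then have "AE x in lebesgue. x \<notin> cbox a b - box a b" by (rule AE_not_in)
      then show ?thesis by (simp add: AE_completion_iff)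
    qed
    ultimately show ?thesis by eventually_elim (auto simp: vec_eq_iff)
  qed
  obtain D where D: "countable D" "\<And>X. X \<in> D \<Longrightarrow> \<exists>a b. X = cbox a b" "D \<subseteq> Pow U" "\<Union>D = U"
    using open_countable_Union_open_cbox[OF U] by metis
  have "AE x in lborel. \<forall>X\<in>D. x \<in> X \<longrightarrow> g x = h x"
    unfolding AE_ball_countable[OF D(1)] using ** D(2,3) by blast
  then have "AE x in lborel. x \<in> U \<longrightarrow> g x = h x"
    by eventually_elim (use D(4) in auto)
  then show ?thesis by (subst AE_lebesgue_on_iff) auto
qed

section \<open>Powers of norms\<close>

text \<open>The p-th power of the norm is kept, not the norm itself: the approximation arguments
  work with a triangle inequality up to the factor \<open>2 powr p\<close>, and extended values
  spare integrability conditions.\<close>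

definition Np :: "'a measure \<Rightarrow> real \<Rightarrow> ('a \<Rightarrow> 'b::real_normed_vector) \<Rightarrow> ennreal" where
  "Np M p f = (\<integral>\<^sup>+x. ennreal (norm (f x) powr p) \<partial>M)"

lemma Np_cong_AE: "AE x in M. f x = g x \<Longrightarrow> Np M p f = Np M p g"
  unfolding Np_def by (rule nn_integral_cong_AE) (auto elim: eventually_mono)

lemma Np_mono_AE: "p \<ge> 0 \<Longrightarrow> AE x in M. norm (f x) \<le> norm (g x) \<Longrightarrow> Np M p f \<le> Np M p g"
  unfolding Np_def by (rule nn_integral_mono_AE) (auto elim!: eventually_mono intro!: ennreal_leI powr_mono2)

lemma Np_uminus: "Np M p (\<lambda>x. - f x) = Np M p f"
  by (simp add: Np_def)

lemma norm_add_powr_le: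
  fixes a b :: "'a::real_normed_vector"
  assumes "p \<ge> 0"
  shows "norm (a + b) powr p \<le> 2 powr p * (norm a powr p + norm b powr p)"
proof -
  have "norm (a + b) \<le> 2 * max (norm a) (norm b)"
    using norm_triangle_ineq[of a b] by linarith
  then have "norm (a + b) powr p \<le> (2 * max (norm a) (norm b)) powr p"
    using assms by (intro powr_mono2) auto
  also have "\<dots> = 2 powr p * max (norm a) (norm b) powr p"
    by (rule powr_mult)
  also have "max (norm a) (norm b) powr p \<le> norm a powr p + norm b powr p"
    by (simp add: max_def)
  finally show ?thesis by simp
qed

lemma Np_add:
  fixes f g :: "'a \<Rightarrow> 'b::{real_normed_vector, second_countable_topology}"
  assumes "p \<ge> 0" and [measurable]: "f \<in> borel_measurable M" "g \<in> borel_measurable M"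
  shows "Np M p (\<lambda>x. f x + g x) \<le> ennreal (2 powr p) * (Np M p f + Np M p g)"
proof -
  have "Np M p (\<lambda>x. f x + g x) \<le> (\<integral>\<^sup>+x. ennreal (2 powr p) * (ennreal (norm (f x) powr p) + ennreal (norm (g x) powr p)) \<partial>M)"
    unfolding Np_def
    by (intro nn_integral_mono)
      (simp add: ennreal_mult[symmetric] norm_add_powr_le[OF assms(1)] ennreal_leI flip: ennreal_plus)
  also have "\<dots> = ennreal (2 powr p) * (Np M p f + Np M p g)"
    unfolding Np_def by (simp add: nn_integral_cmult nn_integral_add)
  finally show ?thesis .
qed

lemma Np_triangle:
  fixes f g h :: "'a \<Rightarrow> 'b::{real_normed_vector, second_countable_topology}"
  assumes "p \<ge> 0" and [measurable]: "f \<in> borel_measurable M" "g \<in> borel_measurable M" "h \<in> borel_measurable M"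
  shows "Np M p (\<lambda>x. f x - h x) \<le> ennreal (2 powr p) * (Np M p (\<lambda>x. f x - g x) + Np M p (\<lambda>x. g x - h x))"
  using Np_add[OF assms(1), of "\<lambda>x. f x - g x" M "\<lambda>x. g x - h x"] by simp

lemma Np_eq_0:
  fixes f :: "'a \<Rightarrow> 'b::{real_normed_vector, second_countable_topology}"
  assumes "Np M p f = 0" and [measurable]: "f \<in> borel_measurable M"
  shows "AE x in M. f x = 0"
proof -
  have "AE x in M. ennreal (norm (f x) powr p) = 0"
    using assms(1) unfolding Np_def by (subst (asm) nn_integral_0_iff_AE) auto
  then show ?thesis by eventually_elim auto
qed

text \<open>Up to \<open>l\<close> the first term suffices; beyond it
  \<open>t = t powr (1 - p) * t powr p\<close>, and the first factor decreases in t. Integrated with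
  a well chosen \<open>l\<close>, this is Hoelder's inequality against a constant, up to a
  factor.\<close>

lemma le_powr_split:
  fixes t l p :: real
  assumes "l > 0" "p \<ge> 1" "t \<ge> 0"
  shows "t \<le> l + l powr (1 - p) * t powr p"
proof (cases "t \<le> l")
  case True
  then show ?thesis using assms by (smt (verit) mult_nonneg_nonneg powr_ge_zero)
next
  case False
  then have t: "t > l" "t > 0" using assms by auto
  have "t powr (1 - p) \<le> l powr (1 - p)"
    using t assms by (intro powr_mono2') auto
  then have "t powr (1 - p) * t powr p \<le> l powr (1 - p) * t powr p"
    by (intro mult_right_mono) auto
  moreover have "t powr (1 - p) * t powr p = t"
    using t by (simp flip: powr_add)
  ultimately show ?thesis using assms by linarith
qed

lemma nn_integral_norm_le_Np:
  fixes f :: "'a \<Rightarrow> 'b::{real_normed_vector, second_countable_topology}"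
  assumes "l > 0" "p \<ge> 1" and [measurable]: "f \<in> borel_measurable M"
  shows "(\<integral>\<^sup>+x. ennreal (norm (f x)) \<partial>M) \<le> ennreal l * emeasure M (space M) + ennreal (l powr (1 - p)) * Np M p f"
proof -
  have "(\<integral>\<^sup>+x. ennreal (norm (f x)) \<partial>M) \<le> (\<integral>\<^sup>+x. ennreal l + ennreal (l powr (1 - p)) * ennreal (norm (f x) powr p) \<partial>M)"
    using assms by (intro nn_integral_mono)
      (auto simp: ennreal_mult[symmetric] simp flip: ennreal_plus intro!: ennreal_leI le_powr_split)
  also have "\<dots> = ennreal l * emeasure M (space M) + ennreal (l powr (1 - p)) * Np M p f"
    unfolding Np_def by (subst nn_integral_add) (auto simp: nn_integral_cmult)
  finally show ?thesis .
qed

lemma Np_integrable: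
  fixes f :: "'a \<Rightarrow> 'b::{banach, second_countable_topology}"
  assumes "finite_measure M" "p \<ge> 1" and [measurable]: "f \<in> borel_measurable M" and "Np M p f < \<infinity>"
  shows "integrable M f"
proof (rule integrableI_bounded)
  have "(\<integral>\<^sup>+x. ennreal (norm (f x)) \<partial>M) \<le> ennreal 1 * emeasure M (space M) + ennreal (1 powr (1 - p)) * Np M p f"
    by (rule nn_integral_norm_le_Np) (use assms in auto)
  also have "\<dots> < \<infinity>"
    using assms(4) finite_measure.emeasure_finite[OF assms(1)] by (simp add: less_top)
  finally show "(\<integral>\<^sup>+x. ennreal (norm (f x)) \<partial>M) < \<infinity>" .
qed simp

lemma Np_integrable_powr:
  fixes f :: "'a \<Rightarrow> 'b::{banach, second_countable_topology}"
  assumes [measurable]: "f \<in> borel_measurable M" and "Np M p f < \<infinity>"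
  shows "integrable M (\<lambda>x. norm (f x) powr p)"
  using assms by (intro integrableI_bounded) (auto simp: Np_def)

section \<open>Polar coordinates\<close>

text \<open>Directions are represented by the points of the unit ball with its uniform distribution, through \<open>sgn\<close>; no
  surface measure is needed.\<close>

definition ballM :: "real \<Rightarrow> (real^'n::finite) measure" where
  "ballM R = density lborel (indicator (ball 0 R))"

definition sphM :: "(real^'n::finite) measure" where
  "sphM = uniform_measure lborel (ball 0 1)"

text \<open>The weight is the area of the sphere of radius r: the dimension times the volume of the
  unit ball times \<open>r ^ (CARD('n) - 1)\<close>. As \<open>sphM\<close> is a probability
  measure, the product of the two measures is carried to \<open>ballM\<close>. The type argument
  supplies the dimension.\<close>

definition radM :: "'n::finite itself \<Rightarrow> real \<Rightarrow> real measure" where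
  "radM _ R = density lborel (\<lambda>r. ennreal (measure lborel (ball 0 1 :: (real^'n) set) * (real CARD('n) * r ^ (CARD('n) - 1))) * indicator {0<..<R} r)"

lemma ball_in_borel [measurable, simp]: "ball a r \<in> sets (borel :: 'a::metric_space measure)"
  by (rule borel_open) simp

lemma emeasure_lborel_ball_not_top [simp]: "emeasure lborel (ball c r :: 'a::euclidean_space set) \<noteq> top"
  using emeasure_lborel_ball_finite[of c r] by (simp add: less_top)

lemma sets_ballM [simp, measurable_cong]: "sets (ballM R) = sets borel" and space_ballM [simp]: "space (ballM R) = UNIV"
  by (auto simp: ballM_def)

lemma sets_sphM [simp, measurable_cong]: "sets sphM = sets borel" and space_sphM [simp]: "space sphM = UNIV"
  by (auto simp: sphM_def)

lemma sets_radM [simp, measurable_cong]: "sets (radM n R) = sets borel" and space_radM [simp]: "space (radM n R) = UNIV"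
  by (auto simp: radM_def)

lemma finite_measure_ballM: "finite_measure (ballM R :: (real^'n::finite) measure)"
proof
  have "emeasure (ballM R) (space (ballM R :: (real^'n) measure)) = emeasure lborel (ball 0 R :: (real^'n) set)"
    by (simp add: ballM_def emeasure_density)
  then show "emeasure (ballM R) (space (ballM R :: (real^'n) measure)) \<noteq> \<infinity>"
    by simp
qed

lemma nn_integral_ballM_lborel:
  "f \<in> borel_measurable borel \<Longrightarrow> (\<integral>\<^sup>+x. f x \<partial>ballM R) = (\<integral>\<^sup>+x. f x * indicator (ball 0 R) x \<partial>lborel)"
  unfolding ballM_def by (subst nn_integral_density) (auto simp: mult.commute)

lemma nn_integral_ballM:
  "f \<in> borel_measurable borel \<Longrightarrow> (\<integral>\<^sup>+x. f x \<partial>ballM R) = (\<integral>\<^sup>+x. f x \<partial>lebesgue_on (ball 0 R))"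
  by (simp add: nn_integral_ballM_lborel nn_integral_restrict_space nn_integral_completion)

lemma AE_ballM: "(AE x in ballM R. P x) \<longleftrightarrow> (AE x in lebesgue_on (ball 0 R). P x)"
  unfolding ballM_def by (subst AE_density) (auto simp: AE_lebesgue_on_iff indicator_def)

lemma integral_ballM_lborel:
  fixes f :: "real^'n::finite \<Rightarrow> 'b::{banach, second_countable_topology}"
  assumes "f \<in> borel_measurable borel"
  shows "(LINT x|ballM R. f x) = (LINT x|lborel. indicator (ball 0 R) x *\<^sub>R f x)"
proof -
  have eq: "ballM R = density lborel (\<lambda>x :: real^'n. ennreal (indicator (ball 0 R) x))"
    unfolding ballM_def by (simp add: ennreal_indicator)
  show ?thesis unfolding eq using assms by (subst integral_density) auto
qed

lemma integral_ballM:
  fixes f :: "_ \<Rightarrow> 'b::{banach, second_countable_topology}"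
  assumes "f \<in> borel_measurable borel"
  shows "(LINT x|ballM R. f x) = (LINT x|lebesgue_on (ball 0 R). f x)"
  using assms by (simp add: integral_ballM_lborel integral_lebesgue_on_borel set_lebesgue_integral_def)

lemma integrable_ballM_lborel:
  fixes f :: "real^'n::finite \<Rightarrow> 'b::{banach, second_countable_topology}"
  assumes "f \<in> borel_measurable borel"
  shows "integrable (ballM R) f \<longleftrightarrow> integrable lborel (\<lambda>x. indicator (ball 0 R) x *\<^sub>R f x)"
proof -
  have eq: "ballM R = density lborel (\<lambda>x :: real^'n. ennreal (indicator (ball 0 R) x))"
    unfolding ballM_def by (simp add: ennreal_indicator)
  show ?thesis unfolding eq using assms by (subst integrable_density) auto
qed

lemma integrable_ballM:
  fixes f :: "_ \<Rightarrow> 'b::{banach, second_countable_topology}"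
  assumes "f \<in> borel_measurable borel"
  shows "integrable (ballM R) f \<longleftrightarrow> integrable (lebesgue_on (ball 0 R)) f"
  using assms by (simp add: integrable_ballM_lborel integrable_restrict_space integrable_completion)

lemma unit_ball_volume_pos: "measure lborel (ball 0 1 :: (real^'n::finite) set) > 0"
  by (rule content_ball_pos) simp

lemma emeasure_unit_ball: "emeasure lborel (ball 0 1 :: (real^'n::finite) set) = ennreal (measure lborel (ball 0 1 :: (real^'n) set))"
  by (intro emeasure_eq_ennreal_measure) auto

lemma ennreal_unit_ball_volume_nonzero: "ennreal (measure lborel (ball 0 1 :: (real^'n::finite) set)) \<noteq> 0"
  using unit_ball_volume_pos[where 'n = 'n] by (simp only: ennreal_eq_0_iff not_le)

lemma emeasure_sphM: "emeasure (sphM :: (real^'n::finite) measure) UNIV = 1"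
proof -
  have "emeasure lborel (ball 0 1 :: (real^'n) set) \<noteq> 0"
    using ennreal_unit_ball_volume_nonzero[where 'n = 'n] by (simp only: emeasure_unit_ball not_False_eq_True)
  then show ?thesis
    using emeasure_uniform_measure_1[where M = "lborel :: (real^'n) measure" and S = "ball 0 1"]
    by (simp add: sphM_def)
qed

lemma finite_measure_sphM: "finite_measure (sphM :: (real^'n::finite) measure)"
  by standard (simp add: emeasure_sphM)

lemma AE_sphM_nonzero: "AE y in (sphM :: (real^'n::finite) measure). y \<noteq> 0"
proof -
  have "AE y in lborel. (y :: real^'n) \<noteq> 0" by (rule AE_lborel_singleton)
  then show ?thesis unfolding sphM_def by (intro AE_uniform_measureI) (auto elim: eventually_mono)
qed

lemma nn_integral_sphM:
  fixes f :: "real^'n::finite \<Rightarrow> ennreal"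
  assumes [measurable]: "f \<in> borel_measurable borel"
  shows "(\<integral>\<^sup>+y. ennreal (measure lborel (ball 0 1 :: (real^'n) set)) * f y \<partial>sphM) = (\<integral>\<^sup>+y. f y * indicator (ball 0 1) y \<partial>lborel)"
proof -
  let ?V = "measure lborel (ball 0 1 :: (real^'n) set)"
  note V = emeasure_unit_ball[where 'n = 'n]
  have "(\<integral>\<^sup>+y. ennreal ?V * f y \<partial>sphM) = (\<integral>\<^sup>+y. (ennreal ?V * f y) * indicator (ball 0 1) y \<partial>lborel) / ennreal ?V"
    unfolding sphM_def by (subst nn_integral_uniform_measure) (auto simp: V)
  also have "(\<integral>\<^sup>+y. (ennreal ?V * f y) * indicator (ball 0 1) y \<partial>lborel) = ennreal ?V * (\<integral>\<^sup>+y. f y * indicator (ball 0 1) y \<partial>lborel)"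
    by (subst nn_integral_cmult[symmetric]) (auto simp: mult.assoc)
  also have "\<dots> / ennreal ?V = (\<integral>\<^sup>+y. f y * indicator (ball 0 1) y \<partial>lborel)"
    by (subst mult.commute) (rule ennreal_mult_divide_eq[OF ennreal_unit_ball_volume_nonzero ennreal_neq_top])
  finally show ?thesis .
qed

lemma nn_integral_radM:
  assumes [measurable]: "f \<in> borel_measurable borel"
  shows "(\<integral>\<^sup>+r. f r \<partial>radM TYPE('n::finite) R) = ennreal (measure lborel (ball 0 1 :: (real^'n) set)) *
    (\<integral>\<^sup>+r. ennreal (real CARD('n) * r ^ (CARD('n) - 1)) * indicator {0<..<R} r * f r \<partial>lborel)"
proof -
  have "(\<integral>\<^sup>+r. f r \<partial>radM TYPE('n) R) = (\<integral>\<^sup>+r. ennreal (measure lborel (ball 0 1 :: (real^'n) set)) *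
     (ennreal (real CARD('n) * r ^ (CARD('n) - 1)) * indicator {0<..<R} r * f r) \<partial>lborel)"
    unfolding radM_def
    by (subst nn_integral_density)
      (auto intro!: nn_integral_cong simp: indicator_def ennreal_mult mult.assoc)
  then show ?thesis by (simp add: nn_integral_cmult)
qed

lemma AE_radM: "(AE r in radM TYPE('n::finite) R. P r) \<longleftrightarrow> (AE r in lborel. 0 < r \<and> r < R \<longrightarrow> P r)"
  unfolding radM_def
  by (subst AE_density) (use unit_ball_volume_pos[where 'n = 'n] in \<open>auto simp: indicator_def ennreal_zero_less_mult_iff\<close>)

lemma finite_measure_radM: "finite_measure (radM TYPE('n::finite) R)"
proof
  have "emeasure (radM TYPE('n) R) (space (radM TYPE('n) R)) = (\<integral>\<^sup>+r. 1 \<partial>radM TYPE('n) R)"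
    by simp
  also have "\<dots> \<le> ennreal (measure lborel (ball 0 1 :: (real^'n) set)) *
    (\<integral>\<^sup>+r. ennreal (real CARD('n) * \<bar>R\<bar> ^ (CARD('n) - 1)) * indicator {0<..<R} r \<partial>lborel)"
    by (subst nn_integral_radM)
      (auto simp: indicator_def intro!: mult_left_mono nn_integral_mono ennreal_leI power_mono)
  also have "\<dots> < \<infinity>"
    by (cases "R \<ge> 0") (simp_all add: nn_integral_cmult_indicator ennreal_mult_less_top)
  finally show "emeasure (radM TYPE('n) R) (space (radM TYPE('n) R)) \<noteq> \<infinity>" by simp
qed

lemma nn_integral_lborel_scale:
  fixes h :: "'a::euclidean_space \<Rightarrow> ennreal"
  assumes [measurable]: "h \<in> borel_measurable borel" and "s > 0"
  shows "(\<integral>\<^sup>+z. h z \<partial>lborel) = ennreal (s ^ DIM('a)) * (\<integral>\<^sup>+y. h (s *\<^sub>R y) \<partial>lborel)"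
  by (subst lborel_affine[of s 0])
    (use assms in \<open>auto simp: nn_integral_density nn_integral_distr nn_integral_cmult\<close>)

lemma nn_integral_inverse_power_tail:
  assumes "a > 0" "n > 0"
  shows "(\<integral>\<^sup>+s. ennreal (real n / s ^ (n + 1)) * indicator {a<..} s \<partial>lborel) = ennreal (1 / a ^ n)"
proof -
  have "(\<integral>\<^sup>+s. ennreal (real n / s ^ (n + 1)) * indicator {a<..} s \<partial>lborel) = (\<integral>\<^sup>+s. ennreal (real n / s ^ (n + 1)) * indicator {a..} s \<partial>lborel)"
    using AE_lborel_singleton[of a] by (intro nn_integral_cong_AE) (auto elim!: eventually_mono simp: indicator_def)
  also have "\<dots> = ennreal (0 - (- (1 / a ^ n)))"
  proof (rule nn_integral_FTC_atLeast)
    show "((\<lambda>s. - (1 / s ^ n)) has_real_derivative real n / s ^ (n + 1)) (at s)" if "a \<le> s" for s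
    proof -
      have "((\<lambda>s. - (inverse (s ^ n))) has_real_derivative (inverse (s ^ n) * (real n * s ^ (n - 1)) * inverse (s ^ n))) (at s)"
        using that assms by (auto intro!: derivative_eq_intros)
      also have "inverse (s ^ n) * (real n * s ^ (n - 1)) * inverse (s ^ n) = real n / s ^ (n + 1)"
        using that assms by (cases n) (auto simp: field_simps)
      finally show ?thesis by (simp add: inverse_eq_divide)
    qed
    show "((\<lambda>s::real. - (1 / s ^ n)) \<longlongrightarrow> 0) at_top"
    proof -
      have "((\<lambda>s::real. 1 / s ^ n) \<longlongrightarrow> 0) at_top"
        by (rule tendsto_divide_0[OF tendsto_const filterlim_at_top_imp_at_infinity[OF filterlim_pow_at_top[OF assms(2) filterlim_ident]]])
      from tendsto_minus[OF this] show ?thesis by simp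
    qed
  qed (use assms in auto)
  finally show ?thesis by simp
qed

text \<open>Directions are averaged over the solid unit ball, so a surplus radial variable has to be
  removed again. With r = |y| s in the inner integral and then z = s y, the constraint |y| < 1
  becomes |z| < s, and what remains in s is the integral of N / s^(N + 1) over s > |z|. It equals 1
  / |z|^N and cancels the weight |z|^N left by the substitutions.\<close>

lemma nn_integral_polar:
  fixes f :: "real^'n::finite \<Rightarrow> ennreal"
  assumes [measurable]: "f \<in> borel_measurable borel"
  shows "(\<integral>\<^sup>+x. f x \<partial>ballM R) = (\<integral>\<^sup>+y. (\<integral>\<^sup>+r. f (r *\<^sub>R sgn y) \<partial>radM TYPE('n) R) \<partial>sphM)"
proof -
  let ?N = "CARD('n)" and ?V = "measure lborel (ball 0 1 :: (real^'n) set)"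
  define F where "F z = f z * indicator (ball 0 R) z" for z
  have [measurable]: "F \<in> borel_measurable borel" unfolding F_def[abs_def] by measurable
  have [measurable]: "(sgn :: real^'n \<Rightarrow> real^'n) \<in> borel_measurable borel"
    unfolding sgn_div_norm[abs_def] by measurable
  have "(\<integral>\<^sup>+y. (\<integral>\<^sup>+r. f (r *\<^sub>R sgn y) \<partial>radM TYPE('n) R) \<partial>sphM) =
    (\<integral>\<^sup>+y. ennreal ?V * (\<integral>\<^sup>+r. ennreal (real ?N * r ^ (?N - 1)) * indicator {0<..<R} r * f (r *\<^sub>R sgn y) \<partial>lborel) \<partial>sphM)"
    by (intro nn_integral_cong, subst nn_integral_radM) auto
  also have "\<dots> = (\<integral>\<^sup>+y. (\<integral>\<^sup>+r. ennreal (real ?N * r ^ (?N - 1)) * indicator {0<..<R} r * f (r *\<^sub>R sgn y) \<partial>lborel) * indicator (ball 0 1) y \<partial>lborel)"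
    by (rule nn_integral_sphM) measurable
  \<comment> \<open>Substitution r = |y| s, under which \<open>r *\<^sub>R sgn y\<close> becomes
    \<open>s *\<^sub>R y\<close>. The origin, where \<open>sgn\<close> vanishes, is a null
    set.\<close>
  also have "\<dots> = (\<integral>\<^sup>+y. (\<integral>\<^sup>+s. (ennreal (real ?N * s ^ (?N - 1)) * indicator {0<..} s) * (ennreal (norm y ^ ?N) * F (s *\<^sub>R y) * indicator (ball 0 1) y) \<partial>lborel) \<partial>lborel)"
  proof (rule nn_integral_cong_AE)
    have "(\<integral>\<^sup>+r. ennreal (real ?N * r ^ (?N - 1)) * indicator {0<..<R} r * f (r *\<^sub>R sgn y) \<partial>lborel) * indicator (ball 0 1) y =
      (\<integral>\<^sup>+s. (ennreal (real ?N * s ^ (?N - 1)) * indicator {0<..} s) * (ennreal (norm y ^ ?N) * F (s *\<^sub>R y) * indicator (ball 0 1) y) \<partial>lborel)"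
      if y: "y \<noteq> 0" for y :: "real^'n"
    proof -
      define t where "t = norm y"
      have t: "t > 0" using y by (simp add: t_def)
      have "(\<integral>\<^sup>+r. ennreal (real ?N * r ^ (?N - 1)) * indicator {0<..<R} r * f (r *\<^sub>R sgn y) \<partial>lborel) =
        (\<integral>\<^sup>+s. ennreal t * (ennreal (real ?N * (t * s) ^ (?N - 1)) * indicator {0<..<R} (t * s) * f ((t * s) *\<^sub>R sgn y)) \<partial>lborel)"
        using t by (subst nn_integral_real_affine[where c = t and t = 0]) (auto simp: nn_integral_cmult)
      also have "\<dots> = (\<integral>\<^sup>+s. (ennreal (real ?N * s ^ (?N - 1)) * indicator {0<..} s) * (ennreal (t ^ ?N) * F (s *\<^sub>R y)) \<partial>lborel)"
      proof (rule nn_integral_cong)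
        fix s :: real
        have a: "(t * s) *\<^sub>R sgn y = s *\<^sub>R y"
          using y by (simp add: t_def sgn_div_norm)
        have b: "t * t ^ (?N - 1) = t ^ ?N"
          by (metis power_eq_if zero_less_card_finite less_numeral_extra(3))
        have c: "t * (real ?N * (t * s) ^ (?N - 1)) = (real ?N * s ^ (?N - 1)) * t ^ ?N"
          by (simp add: power_mult_distrib algebra_simps flip: b)
        show "ennreal t * (ennreal (real ?N * (t * s) ^ (?N - 1)) * indicator {0<..<R} (t * s) * f ((t * s) *\<^sub>R sgn y)) =
          (ennreal (real ?N * s ^ (?N - 1)) * indicator {0<..} s) * (ennreal (t ^ ?N) * F (s *\<^sub>R y))"
        proof (cases "0 < s \<and> t * s < R")
          case True
          then have "ennreal t * ennreal (real ?N * (t * s) ^ (?N - 1)) = ennreal (real ?N * s ^ (?N - 1)) * ennreal (t ^ ?N)"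
            using t c by (simp flip: ennreal_mult)
          moreover have "norm (s *\<^sub>R y) < R" using True by (simp add: t_def mult.commute)
          ultimately show ?thesis
            using True t by (simp add: a F_def mult.assoc[symmetric])
        next
          case False
          then have "\<not> (0 < t * s \<and> t * s < R)" using t by (simp add: zero_less_mult_iff)
          moreover have "s > 0 \<Longrightarrow> \<not> norm (s *\<^sub>R y) < R" using False by (auto simp: t_def mult.commute)
          ultimately show ?thesis by (auto simp: F_def indicator_def)
        qed
      qed
      finally have "(\<integral>\<^sup>+r. ennreal (real ?N * r ^ (?N - 1)) * indicator {0<..<R} r * f (r *\<^sub>R sgn y) \<partial>lborel) = \<dots>" .
      then show ?thesis
        by (simp add: t_def mult.assoc flip: nn_integral_multc)
    qed
    then show "AE y in lborel. (\<integral>\<^sup>+r. ennreal (real ?N * r ^ (?N - 1)) * indicator {0<..<R} r * f (r *\<^sub>R sgn y) \<partial>lborel) * indicator (ball 0 1) y =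
      (\<integral>\<^sup>+s. (ennreal (real ?N * s ^ (?N - 1)) * indicator {0<..} s) * (ennreal (norm y ^ ?N) * F (s *\<^sub>R y) * indicator (ball 0 1) y) \<partial>lborel)"
      using AE_lborel_singleton[of "0 :: real^'n"] by (auto elim: eventually_mono)
  qed
  also have "\<dots> = (\<integral>\<^sup>+s. (\<integral>\<^sup>+y. (ennreal (real ?N * s ^ (?N - 1)) * indicator {0<..} s) * (ennreal (norm y ^ ?N) * F (s *\<^sub>R y) * indicator (ball 0 1) y) \<partial>lborel) \<partial>(lborel :: real measure))"
    by (rule lborel_pair.Fubini'[symmetric]) measurable
  \<comment> \<open>Substitution z = s y for fixed s > 0, with Jacobian s^N; for s \<le> 0 both
    sides are 0.\<close>
  also have "\<dots> = (\<integral>\<^sup>+s. (\<integral>\<^sup>+z. (ennreal (real ?N / s ^ (?N + 1)) * (if norm z < s then 1 else 0)) * (ennreal (norm z ^ ?N) * F z) \<partial>lborel) \<partial>lborel)"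
  proof (rule nn_integral_cong)
    fix s :: real
    show "(\<integral>\<^sup>+y. (ennreal (real ?N * s ^ (?N - 1)) * indicator {0<..} s) * (ennreal (norm y ^ ?N) * F (s *\<^sub>R y) * indicator (ball 0 1) y) \<partial>lborel) =
      (\<integral>\<^sup>+z. (ennreal (real ?N / s ^ (?N + 1)) * (if norm z < s then 1 else 0)) * (ennreal (norm z ^ ?N) * F z) \<partial>lborel)"
    proof (cases "s > 0")
      case True
      have "(\<integral>\<^sup>+z. (ennreal (real ?N / s ^ (?N + 1)) * (if norm z < s then 1 else 0)) * (ennreal (norm z ^ ?N) * F z) \<partial>lborel)
        = (\<integral>\<^sup>+y. ennreal (s ^ ?N) * ((ennreal (real ?N / s ^ (?N + 1)) * (if norm (s *\<^sub>R y) < s then 1 else 0)) * (ennreal (norm (s *\<^sub>R y) ^ ?N) * F (s *\<^sub>R y))) \<partial>(lborel :: (real^'n) measure))"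
        using True by (subst nn_integral_lborel_scale[of _ s]) (auto simp: nn_integral_cmult)
      also have "\<dots> = (\<integral>\<^sup>+y. (ennreal (real ?N * s ^ (?N - 1)) * indicator {0<..} s) * (ennreal (norm y ^ ?N) * F (s *\<^sub>R y) * indicator (ball 0 1) y) \<partial>lborel)"
      proof (rule nn_integral_cong)
        fix y :: "real^'n"
        have b: "s ^ ?N * s ^ ?N / s ^ (?N + 1) = s ^ (?N - 1)"
        proof -
          obtain m where m: "CARD('n) = Suc m" using zero_less_card_finite gr0_conv_Suc by metis
          show ?thesis using True unfolding m by (simp add: field_simps)
        qed
        have "s ^ ?N * (real ?N / s ^ (?N + 1)) * norm (s *\<^sub>R y) ^ ?N = real ?N * (s ^ ?N * s ^ ?N / s ^ (?N + 1)) * norm y ^ ?N"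
          using True by (simp add: power_mult_distrib field_simps)
        then have "ennreal (s ^ ?N) * ennreal (real ?N / s ^ (?N + 1)) * ennreal (norm (s *\<^sub>R y) ^ ?N) = ennreal (real ?N * s ^ (?N - 1)) * ennreal (norm y ^ ?N)"
          unfolding b using True by (simp flip: ennreal_mult)
        moreover have "(if norm (s *\<^sub>R y) < s then 1 else 0) = (indicator (ball 0 1) y :: ennreal)"
          using True by (auto simp: indicator_def)
        ultimately show "ennreal (s ^ ?N) * ((ennreal (real ?N / s ^ (?N + 1)) * (if norm (s *\<^sub>R y) < s then 1 else 0)) * (ennreal (norm (s *\<^sub>R y) ^ ?N) * F (s *\<^sub>R y))) =
          (ennreal (real ?N * s ^ (?N - 1)) * indicator {0<..} s) * (ennreal (norm y ^ ?N) * F (s *\<^sub>R y) * indicator (ball 0 1) y)"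
        proof -
          assume *: "ennreal (s ^ ?N) * ennreal (real ?N / s ^ (?N + 1)) * ennreal (norm (s *\<^sub>R y) ^ ?N) = ennreal (real ?N * s ^ (?N - 1)) * ennreal (norm y ^ ?N)"
            and **: "(if norm (s *\<^sub>R y) < s then 1 else 0) = (indicator (ball 0 1) y :: ennreal)"
          have "ennreal (s ^ ?N) * ((ennreal (real ?N / s ^ (?N + 1)) * (if norm (s *\<^sub>R y) < s then 1 else 0)) * (ennreal (norm (s *\<^sub>R y) ^ ?N) * F (s *\<^sub>R y))) =
            (ennreal (s ^ ?N) * ennreal (real ?N / s ^ (?N + 1)) * ennreal (norm (s *\<^sub>R y) ^ ?N)) * (F (s *\<^sub>R y) * indicator (ball 0 1) y)"
            unfolding ** by (simp only: mult_ac)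
          also have "\<dots> = (ennreal (real ?N * s ^ (?N - 1)) * indicator {0<..} s) * (ennreal (norm y ^ ?N) * F (s *\<^sub>R y) * indicator (ball 0 1) y)"
            unfolding * using True by (simp add: mult_ac)
          finally show ?thesis .
        qed
      qed
      finally show ?thesis by simp
    next
      case False
      then have "(if norm z < s then 1 else 0) = (0::ennreal)" for z :: "real^'n"
        using norm_ge_zero[of z] by (auto simp del: norm_ge_zero)
      then show ?thesis using False by simp
    qed
  qed
  also have "\<dots> = (\<integral>\<^sup>+z. (\<integral>\<^sup>+s. (ennreal (real ?N / s ^ (?N + 1)) * (if norm z < s then 1 else 0)) * (ennreal (norm z ^ ?N) * F z) \<partial>(lborel :: real measure)) \<partial>lborel)"
    by (rule lborel_pair.Fubini') measurable
  \<comment> \<open>Integrating out s is \<open>nn_integral_inverse_power_tail\<close> with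
    \<open>norm z\<close> as lower end.\<close>
  also have "\<dots> = (\<integral>\<^sup>+z. F z \<partial>lborel)"
  proof (rule nn_integral_cong_AE)
    have "(\<integral>\<^sup>+s. (ennreal (real ?N / s ^ (?N + 1)) * (if norm z < s then 1 else 0)) * (ennreal (norm z ^ ?N) * F z) \<partial>(lborel :: real measure)) = F z"
      if "z \<noteq> 0" for z :: "real^'n"
    proof -
      have "(\<integral>\<^sup>+s. (ennreal (real ?N / s ^ (?N + 1)) * (if norm z < s then 1 else 0)) * (ennreal (norm z ^ ?N) * F z) \<partial>(lborel :: real measure)) =
         ennreal (1 / norm z ^ ?N) * (ennreal (norm z ^ ?N) * F z)"
      proof (subst nn_integral_multc)
        have "(\<integral>\<^sup>+s. ennreal (real ?N / s ^ (?N + 1)) * (if norm z < s then 1 else 0) \<partial>lborel) = (\<integral>\<^sup>+s. ennreal (real ?N / s ^ (?N + 1)) * indicator {norm z<..} s \<partial>lborel)"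
          by (intro nn_integral_cong) (auto simp: indicator_def)
        then show "(\<integral>\<^sup>+s. ennreal (real ?N / s ^ (?N + 1)) * (if norm z < s then 1 else 0) \<partial>lborel) * (ennreal (norm z ^ ?N) * F z) = ennreal (1 / norm z ^ ?N) * (ennreal (norm z ^ ?N) * F z)"
          using that nn_integral_inverse_power_tail[of "norm z" ?N] by simp
      qed simp
      also have "\<dots> = ennreal (1 / norm z ^ ?N * norm z ^ ?N) * F z"
        by (subst ennreal_mult) (auto simp: mult.assoc)
      finally show ?thesis using that by simp
    qed
    then show "AE z in lborel. (\<integral>\<^sup>+s. (ennreal (real ?N / s ^ (?N + 1)) * (if norm z < s then 1 else 0)) * (ennreal (norm z ^ ?N) * F z) \<partial>(lborel :: real measure)) = F z"
      using AE_lborel_singleton[of "0 :: real^'n"] by (auto elim: eventually_mono)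
  qed
  finally show ?thesis by (simp add: nn_integral_ballM_lborel F_def)
qed

section \<open>Null sets and integrals along rays\<close>

lemma sgn_measurable [measurable]: "(sgn :: 'a::euclidean_space \<Rightarrow> 'a) \<in> borel_measurable borel"
  unfolding sgn_div_norm[abs_def] by measurable

lemma pair_sigma_finite_polar: "pair_sigma_finite (sphM :: (real^'n::finite) measure) (radM TYPE('n) R)"
  by (intro pair_sigma_finite.intro finite_measure.axioms(1) finite_measure_sphM finite_measure_radM)

text \<open>As an identity of image measures, the polar formula transports null sets and
  integrability, and Fubini for the product measure then works ray by ray.\<close>

lemma ballM_eq_distr:
  "ballM R = distr (sphM \<Otimes>\<^sub>M radM TYPE('n) R) borel (\<lambda>(y, r). r *\<^sub>R sgn (y :: real^'n::finite))"
proof (rule measure_eqI)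
  fix A assume "A \<in> sets (ballM R :: (real^'n) measure)"
  then have [measurable]: "A \<in> sets borel" by simp
  interpret pair_sigma_finite "sphM :: (real^'n) measure" "radM TYPE('n) R" by (rule pair_sigma_finite_polar)
  have "emeasure (ballM R) A = (\<integral>\<^sup>+x. indicator A x \<partial>ballM R)"
    by simp
  also have "\<dots> = (\<integral>\<^sup>+y. (\<integral>\<^sup>+r. indicator A (r *\<^sub>R sgn y) \<partial>radM TYPE('n) R) \<partial>sphM)"
    by (rule nn_integral_polar) simp
  also have "\<dots> = (\<integral>\<^sup>+z. indicator A (case z of (y, r) \<Rightarrow> r *\<^sub>R sgn y) \<partial>(sphM \<Otimes>\<^sub>M radM TYPE('n) R))"
    by (subst M2.nn_integral_fst[symmetric]) auto
  also have "\<dots> = (\<integral>\<^sup>+x. indicator A x \<partial>distr (sphM \<Otimes>\<^sub>M radM TYPE('n) R) borel (\<lambda>(y, r). r *\<^sub>R sgn y))"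
    by (subst nn_integral_distr) auto
  also have "\<dots> = emeasure (distr (sphM \<Otimes>\<^sub>M radM TYPE('n) R) borel (\<lambda>(y, r). r *\<^sub>R sgn y)) A"
    by simp
  finally show "emeasure (ballM R) A = emeasure (distr (sphM \<Otimes>\<^sub>M radM TYPE('n) R) borel (\<lambda>(y, r). r *\<^sub>R sgn y)) A" .
qed simp

lemma AE_polar:
  assumes "AE x in (ballM R :: (real^'n::finite) measure). P x"
  shows "AE y in sphM. AE r in radM TYPE('n) R. P (r *\<^sub>R sgn y)"
proof -
  interpret pair_sigma_finite "sphM :: (real^'n) measure" "radM TYPE('n) R" by (rule pair_sigma_finite_polar)
  have "AE z in (sphM \<Otimes>\<^sub>M radM TYPE('n) R). P (case z of (y, r) \<Rightarrow> r *\<^sub>R sgn (y :: real^'n))"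
    using assms unfolding ballM_eq_distr by (rule AE_distrD[rotated]) simp
  from AE_pair[OF this] show ?thesis by simp
qed

text \<open>This direction asks for a measurable \<open>P\<close>: null slices make a set null only
  when Fubini applies to it.\<close>

lemma AE_polar_conv:
  fixes P :: "real^'n::finite \<Rightarrow> bool"
  assumes [measurable]: "Measurable.pred borel P"
    and "AE y in sphM. AE r in radM TYPE('n) R. P (r *\<^sub>R sgn y)"
  shows "AE x in ballM R. P x"
proof -
  interpret pair_sigma_finite "sphM :: (real^'n) measure" "radM TYPE('n) R" by (rule pair_sigma_finite_polar)
  have "AE z in (sphM \<Otimes>\<^sub>M radM TYPE('n) R). P (case z of (y, r) \<Rightarrow> r *\<^sub>R sgn (y :: real^'n))"
  proof -
    have m: "Measurable.pred (sphM \<Otimes>\<^sub>M radM TYPE('n) R) (\<lambda>z. P (case z of (y, r) \<Rightarrow> r *\<^sub>R sgn (y :: real^'n)))"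
      by measurable
    show ?thesis by (rule AE_pair_measure[OF predE[OF m]]) (use assms(2) in simp)
  qed
  then show ?thesis
    unfolding ballM_eq_distr by (subst AE_distr_iff) auto
qed

lemma integrable_polar:
  fixes f :: "real^'n::finite \<Rightarrow> real"
  assumes [measurable]: "f \<in> borel_measurable borel" and int: "integrable (ballM R) f"
  shows "AE y in sphM. integrable (radM TYPE('n) R) (\<lambda>r. f (r *\<^sub>R sgn y))"
    and "integrable sphM (\<lambda>y. LINT r|radM TYPE('n) R. f (r *\<^sub>R sgn y))"
    and "(LINT y|sphM. LINT r|radM TYPE('n) R. f (r *\<^sub>R sgn y)) = (LINT x|ballM R. f x)"
proof -
  interpret pair_sigma_finite "sphM :: (real^'n) measure" "radM TYPE('n) R" by (rule pair_sigma_finite_polar)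
  have *: "integrable (sphM \<Otimes>\<^sub>M radM TYPE('n) R) (\<lambda>(y, r). f (r *\<^sub>R sgn y))"
    using int unfolding ballM_eq_distr by (subst (asm) integrable_distr_eq) (auto simp: split_beta')
  show "AE y in sphM. integrable (radM TYPE('n) R) (\<lambda>r. f (r *\<^sub>R sgn y))"
    using AE_integrable_fst[OF *] by simp
  show "integrable sphM (\<lambda>y. LINT r|radM TYPE('n) R. f (r *\<^sub>R sgn y))"
    using integrable_fst[OF *] by simp
  show "(LINT y|sphM. LINT r|radM TYPE('n) R. f (r *\<^sub>R sgn y)) = (LINT x|ballM R. f x)"
    using integral_fst[OF *] unfolding ballM_eq_distr by (subst integral_distr) (auto simp: split_beta')
qed

lemma AE_sphM_ex:
  assumes "AE y in (sphM :: (real^'n::finite) measure). P y"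
  obtains y where "y \<noteq> 0" "P y"
proof -
  have "ae_filter (sphM :: (real^'n) measure) \<noteq> bot"
    by (simp add: ae_filter_eq_bot_iff emeasure_sphM)
  moreover have "AE y in (sphM :: (real^'n) measure). y \<noteq> 0 \<and> P y"
    using assms AE_sphM_nonzero by eventually_elim auto
  ultimately show ?thesis using that eventually_happens by blast
qed

lemma distr_norm_ballM: "distr (ballM R :: (real^'n::finite) measure) borel norm = radM TYPE('n) R"
proof (rule measure_eqI)
  fix A assume "A \<in> sets (distr (ballM R :: (real^'n) measure) borel norm)"
  then have [measurable]: "A \<in> sets borel" by simp
  have "emeasure (distr (ballM R :: (real^'n) measure) borel norm) A = (\<integral>\<^sup>+x. indicator A x \<partial>distr (ballM R :: (real^'n) measure) borel norm)"
    by simp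
  also have "\<dots> = (\<integral>\<^sup>+x. indicator A (norm x) \<partial>(ballM R :: (real^'n) measure))"
    by (subst nn_integral_distr) auto
  also have "\<dots> = (\<integral>\<^sup>+y. (\<integral>\<^sup>+r. indicator A (norm (r *\<^sub>R sgn y)) \<partial>radM TYPE('n) R) \<partial>(sphM :: (real^'n) measure))"
    by (rule nn_integral_polar) simp
  also have "\<dots> = (\<integral>\<^sup>+y. emeasure (radM TYPE('n) R) A \<partial>(sphM :: (real^'n) measure))"
  proof (rule nn_integral_cong_AE)
    show "AE y in (sphM :: (real^'n) measure). (\<integral>\<^sup>+r. indicator A (norm (r *\<^sub>R sgn y)) \<partial>radM TYPE('n) R) = emeasure (radM TYPE('n) R) A"
      using AE_sphM_nonzero
    proof eventually_elim
      case (elim y)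
      have "(\<integral>\<^sup>+r. indicator A (norm (r *\<^sub>R sgn y)) \<partial>radM TYPE('n) R) = (\<integral>\<^sup>+r. indicator A r \<partial>radM TYPE('n) R)"
        by (intro nn_integral_cong_AE) (auto simp: AE_radM norm_sgn elim)
      then show ?case by simp
    qed
  qed
  also have "\<dots> = emeasure (radM TYPE('n) R) A"
    by (simp add: emeasure_sphM)
  finally show "emeasure (distr (ballM R :: (real^'n) measure) borel norm) A = emeasure (radM TYPE('n) R) A" .
qed simp

lemma nn_integral_radial:
  "f \<in> borel_measurable borel \<Longrightarrow> (\<integral>\<^sup>+x. f (norm x) \<partial>(ballM R :: (real^'n::finite) measure)) = (\<integral>\<^sup>+r. f r \<partial>radM TYPE('n) R)"
  by (simp add: nn_integral_distr flip: distr_norm_ballM)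

lemma integrable_radial:
  fixes f :: "real \<Rightarrow> real"
  shows "f \<in> borel_measurable borel \<Longrightarrow> integrable (ballM R :: (real^'n::finite) measure) (\<lambda>x. f (norm x)) \<longleftrightarrow> integrable (radM TYPE('n) R) f"
  by (simp add: integrable_distr_eq flip: distr_norm_ballM)

lemma integral_radial:
  fixes f :: "real \<Rightarrow> real"
  shows "f \<in> borel_measurable borel \<Longrightarrow> (LINT x|(ballM R :: (real^'n::finite) measure). f (norm x)) = (LINT r|radM TYPE('n) R. f r)"
  by (simp add: integral_distr flip: distr_norm_ballM)

lemma AE_radial: "(AE x in (ballM R :: (real^'n::finite) measure). P (norm x)) \<longleftrightarrow> (AE r in radM TYPE('n) R. P r)"
proof
  assume "AE x in (ballM R :: (real^'n) measure). P (norm x)"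
  from AE_polar[OF this] obtain y :: "real^'n" where y: "y \<noteq> 0" "AE r in radM TYPE('n) R. P (norm (r *\<^sub>R sgn y))"
    by (rule AE_sphM_ex)
  then show "AE r in radM TYPE('n) R. P r"
    by (auto simp: AE_radM norm_sgn elim!: eventually_mono)
next
  assume "AE r in radM TYPE('n) R. P r"
  then show "AE x in (ballM R :: (real^'n) measure). P (norm x)"
    unfolding distr_norm_ballM[symmetric] by (rule AE_distrD[rotated]) simp
qed

lemma Np_radial: "f \<in> borel_measurable borel \<Longrightarrow> Np (ballM R :: (real^'n::finite) measure) p (\<lambda>x. f (norm x)) = Np (radM TYPE('n) R) p f"
  for f :: "real \<Rightarrow> real"
  unfolding Np_def by (rule nn_integral_radial[where f = "\<lambda>r. ennreal (norm (f r) powr p)"]) simp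

lemma Np_polar:
  fixes f :: "real^'n::finite \<Rightarrow> 'b::euclidean_space"
  shows "f \<in> borel_measurable borel \<Longrightarrow> Np (ballM R) p f = (\<integral>\<^sup>+y. Np (radM TYPE('n) R) p (\<lambda>r. f (r *\<^sub>R sgn y)) \<partial>sphM)"
  unfolding Np_def by (rule nn_integral_polar) simp

section \<open>Integration from the boundary\<close>

text \<open>The Bochner integral is 0 where \<open>h\<close> is not integrable on (r, R), and the
  interval is empty for r \<ge> R. These defaults let the power bound hold for every Borel
  \<open>h\<close>.\<close>

definition wint :: "real \<Rightarrow> (real \<Rightarrow> real) \<Rightarrow> real \<Rightarrow> real" where
  "wint R h r = (LINT s:{r<..<R}|lborel. h s)"

lemma wint_measurable [measurable]:
  assumes [measurable]: "h \<in> borel_measurable borel"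
  shows "wint R h \<in> borel_measurable borel"
proof -
  have "wint R h = (\<lambda>r. LINT s|lborel. (if r < s \<and> s < R then h s else 0))"
    unfolding wint_def set_lebesgue_integral_def
    by (intro ext Bochner_Integration.integral_cong) (auto simp: indicator_def)
  also have "\<dots> \<in> borel_measurable borel" by measurable
  finally show ?thesis .
qed

text \<open>Hoelder's inequality on an interval of length at most \<open>R\<close>, with the extra
  factor \<open>2 powr p\<close> that comes from splitting by \<open>le_powr_split\<close>. Without
  integrability the left side is 0 by default.\<close>

lemma wint_powr_le:
  assumes [measurable]: "h \<in> borel_measurable borel" and "p \<ge> 1" "R > 0" "r \<ge> 0"
  shows "ennreal (\<bar>wint R h r\<bar> powr p) \<le>
    ennreal (2 powr p * R powr (p - 1)) * (\<integral>\<^sup>+s. ennreal (\<bar>h s\<bar> powr p) * indicator {r<..<R} s \<partial>lborel)"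
proof (cases "r < R \<and> set_integrable lborel {r<..<R} h")
  case False
  then have "wint R h r = 0"
    by (auto simp: wint_def set_lebesgue_integral_def set_integrable_def not_integrable_integral_eq)
  then show ?thesis by simp
next
  case True
  define I where "I = (\<integral>\<^sup>+s. ennreal (\<bar>h s\<bar> powr p) * indicator {r<..<R} s \<partial>lborel)"
  show ?thesis
  proof (cases "I = top")
    case True
    have "2 powr p * R powr (p - 1) > 0" using assms by simp
    then have "ennreal (2 powr p * R powr (p - 1)) * I = top"
      using True by (simp add: ennreal_mult_top ennreal_eq_0_iff not_le del: ennreal_mult'')
    then show ?thesis by (simp add: I_def)
  next
    case False
    then obtain i where i: "i \<ge> 0" "I = ennreal i" by (metis ennreal_cases)
    have bd: "\<bar>wint R h r\<bar> \<le> l * R + l powr (1 - p) * i" if "l > 0" for l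
    proof -
      have "ennreal \<bar>wint R h r\<bar> \<le> (\<integral>\<^sup>+s. ennreal (norm (indicator {r<..<R} s *\<^sub>R h s)) \<partial>lborel)"
        using True integral_norm_bound_ennreal[of lborel "\<lambda>s. indicator {r<..<R} s *\<^sub>R h s"]
        by (simp add: wint_def set_lebesgue_integral_def set_integrable_def)
      also have "\<dots> \<le> (\<integral>\<^sup>+s. ennreal l * indicator {r<..<R} s + ennreal (l powr (1 - p)) * (ennreal (\<bar>h s\<bar> powr p) * indicator {r<..<R} s) \<partial>lborel)"
        using le_powr_split[OF that \<open>p \<ge> 1\<close>] that
        by (intro nn_integral_mono) (auto simp: indicator_def ennreal_mult[symmetric] simp flip: ennreal_plus intro!: ennreal_leI)
      also have "\<dots> = ennreal l * emeasure lborel {r<..<R} + ennreal (l powr (1 - p)) * I"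
        unfolding I_def by (subst nn_integral_add) (auto simp: nn_integral_cmult nn_integral_cmult_indicator)
      also have "\<dots> \<le> ennreal (l * R + l powr (1 - p) * i)"
        using True that assms i by (auto simp: ennreal_mult[symmetric] simp flip: ennreal_plus intro!: ennreal_leI)
      finally show ?thesis
        using that assms i by (subst (asm) ennreal_le_iff) auto
    qed
    have "\<bar>wint R h r\<bar> powr p \<le> 2 powr p * R powr (p - 1) * i"
    proof (cases "i = 0")
      case True
      have "\<bar>wint R h r\<bar> \<le> 0"
      proof (rule field_le_epsilon)
        fix e :: real assume "e > 0"
        then show "\<bar>wint R h r\<bar> \<le> 0 + e" using bd[of "e / R"] assms True by simp
      qed
      then show ?thesis using True by simp
    next
      case False
      \<comment> \<open>This value makes the two terms of the bound equal,
        \<open>l powr (1 - p) * i = l * R\<close>; the p-th power of their sum is the claimed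
        constant times \<open>i\<close>.\<close>
      define l where "l = (i / R) powr (1 / p)"
      have l: "l > 0" "l powr p = i / R" using False i assms by (auto simp: l_def powr_powr)
      have "l powr (1 - p) * i = l * R"
        using l False i assms by (simp add: powr_diff field_simps)
      then have "\<bar>wint R h r\<bar> \<le> 2 * (l * R)" using bd[OF l(1)] by (simp add: algebra_simps)
      then have "\<bar>wint R h r\<bar> powr p \<le> (2 * (l * R)) powr p"
        using assms by (intro powr_mono2) auto
      also have "\<dots> = 2 powr p * (l powr p * R powr p)"
        by (simp add: powr_mult)
      also have "\<dots> = 2 powr p * R powr (p - 1) * i"
        unfolding l using assms by (simp add: powr_diff)
      finally show ?thesis .
    qed
    then show ?thesis
      using i unfolding I_def[symmetric] by (simp add: ennreal_mult[symmetric] ennreal_leI)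
  qed
qed

text \<open>After Fubini a value \<open>h s\<close> is counted only for radii r < s, and there the
  weight at r is at most the weight at s. The weighted inequality thus follows from the unweighted
  pointwise bound; the last factor \<open>R\<close> is the length of the range of r.\<close>

lemma wint_poincare:
  assumes [measurable]: "h \<in> borel_measurable borel" and "p \<ge> 1" "R > 0"
  shows "Np (radM TYPE('n::finite) R) p (wint R h) \<le> ennreal (2 powr p * R powr p) * Np (radM TYPE('n) R) p h"
proof -
  let ?N = "CARD('n)" and ?V = "ennreal (measure lborel (ball 0 1 :: (real^'n) set))"
  define c where "c r = ennreal (real ?N * r ^ (?N - 1))" for r
  define K where "K = ennreal (2 powr p * R powr (p - 1))"
  define a where "a s = ennreal (\<bar>h s\<bar> powr p)" for s
  have [measurable]: "a \<in> borel_measurable borel" "c \<in> borel_measurable borel"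
    unfolding a_def[abs_def] c_def[abs_def] by measurable
  have c_mono: "c r \<le> c s" if "0 < r" "r < s" for r s
    unfolding c_def using that by (intro ennreal_leI mult_left_mono power_mono) auto
  have "Np (radM TYPE('n) R) p (wint R h) = ?V * (\<integral>\<^sup>+r. c r * indicator {0<..<R} r * ennreal (\<bar>wint R h r\<bar> powr p) \<partial>lborel)"
    unfolding Np_def by (subst nn_integral_radM) (auto simp: c_def)
  also have "\<dots> \<le> ?V * (\<integral>\<^sup>+r. c r * indicator {0<..<R} r * (K * (\<integral>\<^sup>+s. a s * indicator {r<..<R} s \<partial>lborel)) \<partial>lborel)"
  proof (rule mult_left_mono[OF nn_integral_mono])
    fix r
    show "c r * indicator {0<..<R} r * ennreal (\<bar>wint R h r\<bar> powr p) \<le> c r * indicator {0<..<R} r * (K * (\<integral>\<^sup>+s. a s * indicator {r<..<R} s \<partial>lborel))"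
    proof (cases "0 < r")
      case True
      then show ?thesis
        unfolding K_def a_def by (intro mult_left_mono wint_powr_le assms) auto
    qed simp
  qed simp
  also have "(\<integral>\<^sup>+r. c r * indicator {0<..<R} r * (K * (\<integral>\<^sup>+s. a s * indicator {r<..<R} s \<partial>lborel)) \<partial>lborel) =
    (\<integral>\<^sup>+r. (\<integral>\<^sup>+s. c r * indicator {0<..<R} r * (K * (a s * (if r < s \<and> s < R then 1 else 0))) \<partial>lborel) \<partial>lborel)"
  proof (rule nn_integral_cong)
    fix r
    have "(\<integral>\<^sup>+s. a s * indicator {r<..<R} s \<partial>lborel) = (\<integral>\<^sup>+s. a s * (if r < s \<and> s < R then 1 else 0) \<partial>lborel)"
      by (intro nn_integral_cong) (auto simp: indicator_def)
    then show "c r * indicator {0<..<R} r * (K * (\<integral>\<^sup>+s. a s * indicator {r<..<R} s \<partial>lborel)) =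
      (\<integral>\<^sup>+s. c r * indicator {0<..<R} r * (K * (a s * (if r < s \<and> s < R then 1 else 0))) \<partial>lborel)"
      by (simp add: nn_integral_cmult)
  qed
  also have "\<dots> = (\<integral>\<^sup>+s. (\<integral>\<^sup>+r. c r * indicator {0<..<R} r * (K * (a s * (if r < s \<and> s < R then 1 else 0))) \<partial>lborel) \<partial>lborel)"
    by (rule lborel_pair.Fubini'[symmetric]) measurable
  also have "\<dots> \<le> (\<integral>\<^sup>+s. (\<integral>\<^sup>+r. (K * (c s * indicator {0<..<R} s * a s)) * indicator {0<..<R} r \<partial>lborel) \<partial>lborel)"
  proof (intro nn_integral_mono)
    fix r s
    show "c r * indicator {0<..<R} r * (K * (a s * (if r < s \<and> s < R then 1 else 0))) \<le> (K * (c s * indicator {0<..<R} s * a s)) * indicator {0<..<R} r"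
      using mult_right_mono[OF c_mono[of r s], of "K * a s"] by (auto simp: indicator_def mult_ac)
  qed
  also have "\<dots> = (\<integral>\<^sup>+s. (K * ennreal R) * (c s * indicator {0<..<R} s * a s) \<partial>lborel)"
    using assms by (intro nn_integral_cong, subst nn_integral_cmult_indicator) (auto simp: mult_ac)
  also have "\<dots> = (K * ennreal R) * (\<integral>\<^sup>+s. c s * indicator {0<..<R} s * a s \<partial>lborel)"
    by (rule nn_integral_cmult) simp
  also have "?V * \<dots> = (K * ennreal R) * Np (radM TYPE('n) R) p h"
    unfolding Np_def by (subst nn_integral_radM) (auto simp: c_def a_def mult_ac)
  also have "K * ennreal R = ennreal (2 powr p * R powr p)"
    using assms by (simp add: K_def powr_diff flip: ennreal_mult)
  finally show ?thesis by (simp add: mult_left_mono)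
qed

text \<open>On (r, R) the weight is bounded below by a positive constant, so the weighted condition
  gives plain integrability away from the origin. Hence \<open>wint R h r\<close> is a true integral
  for every r > 0.\<close>

lemma set_integrable_radM:
  fixes h :: "real \<Rightarrow> real"
  assumes [measurable]: "h \<in> borel_measurable borel" and "p \<ge> 1" "Np (radM TYPE('n::finite) R) p h < \<infinity>" "r > 0"
  shows "set_integrable lborel {r<..<R} h"
proof -
  let ?N = "CARD('n)" and ?V = "ennreal (measure lborel (ball 0 1 :: (real^'n) set))"
  have int: "integrable (radM TYPE('n) R) h"
    by (rule Np_integrable[OF finite_measure_radM]) (use assms in auto)
  have "?V * ennreal (real ?N * r ^ (?N - 1)) * (\<integral>\<^sup>+s. ennreal (norm (indicator {r<..<R} s *\<^sub>R h s)) \<partial>lborel) =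
    ?V * (\<integral>\<^sup>+s. ennreal (real ?N * r ^ (?N - 1)) * ennreal (norm (indicator {r<..<R} s *\<^sub>R h s)) \<partial>lborel)"
    by (subst nn_integral_cmult) (auto simp: mult.assoc)
  also have "\<dots> \<le> ?V * (\<integral>\<^sup>+s. ennreal (real ?N * s ^ (?N - 1)) * indicator {0<..<R} s * ennreal (norm (h s)) \<partial>lborel)"
    using \<open>r > 0\<close>
    by (intro mult_left_mono nn_integral_mono) (auto simp: indicator_def intro!: mult_right_mono ennreal_leI power_mono)
  also have "\<dots> = (\<integral>\<^sup>+s. ennreal (norm (h s)) \<partial>radM TYPE('n) R)"
    by (subst nn_integral_radM) auto
  also have "\<dots> < \<infinity>" using int by (simp add: integrable_iff_bounded)
  finally have *: "?V * ennreal (real ?N * r ^ (?N - 1)) * (\<integral>\<^sup>+s. ennreal (norm (indicator {r<..<R} s *\<^sub>R h s)) \<partial>lborel) < \<infinity>" .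
  have "ennreal (real ?N * r ^ (?N - 1)) \<noteq> 0"
    using \<open>r > 0\<close> by (simp only: ennreal_eq_0_iff not_le) simp
  then have "(\<integral>\<^sup>+s. ennreal (norm (indicator {r<..<R} s *\<^sub>R h s)) \<partial>lborel) < \<infinity>"
    using * ennreal_unit_ball_volume_nonzero[where 'n = 'n] unfolding infinity_ennreal_def ennreal_mult_less_top by auto
  then show ?thesis unfolding set_integrable_def by (intro integrableI_bounded) auto
qed

lemma wint_diff:
  assumes "set_integrable lborel {r<..<R} h" "set_integrable lborel {r<..<R} k"
  shows "wint R (\<lambda>s. h s - k s) r = wint R h r - wint R k r"
  using assms unfolding wint_def by (rule set_integral_diff)

lemma wint_diff_poincare:
  assumes [measurable]: "h \<in> borel_measurable borel" "k \<in> borel_measurable borel" and "p \<ge> 1" "R > 0"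
    "Np (radM TYPE('n::finite) R) p h < \<infinity>" "Np (radM TYPE('n) R) p k < \<infinity>"
  shows "Np (radM TYPE('n) R) p (\<lambda>r. wint R h r - wint R k r) \<le> ennreal (2 powr p * R powr p) * Np (radM TYPE('n) R) p (\<lambda>r. h r - k r)"
proof -
  have "Np (radM TYPE('n) R) p (\<lambda>r. wint R h r - wint R k r) = Np (radM TYPE('n) R) p (wint R (\<lambda>s. h s - k s))"
    by (intro Np_cong_AE) (auto simp: AE_radM intro!: AE_I2 wint_diff[symmetric] set_integrable_radM[where p = p and 'n = 'n] assms)
  also have "\<dots> \<le> ennreal (2 powr p * R powr p) * Np (radM TYPE('n) R) p (\<lambda>r. h r - k r)"
    by (rule wint_poincare) (use assms in auto)
  finally show ?thesis .
qed

section \<open>The closure of the test functions\<close>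

locale ball_sobolev =
  fixes N :: "'n::finite itself" and R p :: real
  assumes R_pos: "R > 0" and p_gt_1: "p > 1"
begin

abbreviation bal :: "(real^'n) measure" where "bal \<equiv> ballM R"
abbreviation sph :: "(real^'n) measure" where "sph \<equiv> sphM"
abbreviation tst :: "(real^'n \<Rightarrow> real) set" where "tst \<equiv> test_functions (ball 0 R)"

text \<open>The closure of the pairs \<open>(\<phi>, \<nabla> \<phi>)\<close> in \<open>L\<^sup>p\<close>, with Borel representatives.\<close>

definition W0 :: "(real^'n \<Rightarrow> real) \<Rightarrow> (real^'n \<Rightarrow> real^'n) \<Rightarrow> bool" where
  "W0 u g \<longleftrightarrow> u \<in> borel_measurable borel \<and> g \<in> borel_measurable borel \<and>
    (\<forall>e>0. \<exists>\<phi>\<in>tst. Np bal p (\<lambda>x. u x - \<phi> x) \<le> ennreal e \<and> Np bal p (\<lambda>x. g x - grad \<phi> x) \<le> ennreal e)"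

lemma p_ge: "p \<ge> 0" "p \<ge> 1" "p > 0" "p \<noteq> 0"
  using p_gt_1 by auto

lemma W0_measurable: "W0 u g \<Longrightarrow> u \<in> borel_measurable borel" "W0 u g \<Longrightarrow> g \<in> borel_measurable borel"
  by (auto simp: W0_def)

lemma Np_bounded:
  fixes f :: "'a \<Rightarrow> 'b::real_normed_vector"
  assumes "finite_measure M" "AE x in M. norm (f x) \<le> B"
  shows "Np M p f < \<infinity>"
proof -
  have "Np M p f \<le> (\<integral>\<^sup>+x. ennreal (B powr p) \<partial>M)"
    unfolding Np_def using assms(2) p_ge
    by (intro nn_integral_mono_AE) (auto elim!: eventually_mono intro!: ennreal_leI powr_mono2)
  also have "\<dots> < \<infinity>"
    using finite_measure.emeasure_finite[OF assms(1)] by (simp add: ennreal_mult_less_top less_top)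
  finally show ?thesis .
qed

lemma test_Np_finite:
  assumes "\<phi> \<in> tst"
  shows "Np bal p \<phi> < \<infinity>" "Np bal p (grad \<phi>) < \<infinity>"
proof -
  obtain B where "\<And>x. \<bar>\<phi> x\<bar> \<le> B" "\<And>x. norm (grad \<phi> x) \<le> B"
    using test_functions_bounds[OF assms] by blast
  then show "Np bal p \<phi> < \<infinity>" "Np bal p (grad \<phi>) < \<infinity>"
    using Np_bounded[OF finite_measure_ballM AE_I2, where f = \<phi> and B = B] Np_bounded[OF finite_measure_ballM AE_I2, where f = "grad \<phi>" and B = B] by simp_all
qed

lemma Np_finite_diff:
  fixes f g :: "'a \<Rightarrow> 'b::{real_normed_vector, second_countable_topology}"
  assumes "f \<in> borel_measurable M" "g \<in> borel_measurable M" "Np M p (\<lambda>x. f x - g x) < \<infinity>" "Np M p g < \<infinity>"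
  shows "Np M p f < \<infinity>"
proof -
  have "Np M p f \<le> ennreal (2 powr p) * (Np M p (\<lambda>x. f x - g x) + Np M p g)"
    using Np_triangle[OF p_ge(1) assms(1,2), of "\<lambda>_. 0"] by simp
  also have "\<dots> < \<infinity>" using assms by (simp add: ennreal_mult_less_top)
  finally show ?thesis .
qed

lemma W0_Np_finite:
  assumes "W0 u g"
  shows "Np bal p u < \<infinity>" "Np bal p g < \<infinity>"
proof -
  obtain \<phi> where \<phi>: "\<phi> \<in> tst" "Np bal p (\<lambda>x. u x - \<phi> x) \<le> ennreal 1" "Np bal p (\<lambda>x. g x - grad \<phi> x) \<le> ennreal 1"
    using assms unfolding W0_def by (meson zero_less_one)
  have [measurable]: "u \<in> borel_measurable borel" "g \<in> borel_measurable borel"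
    "\<phi> \<in> borel_measurable borel" "grad \<phi> \<in> borel_measurable borel"
    using W0_measurable[OF assms] test_functions_measurable[OF \<phi>(1)] by auto
  have "Np bal p (\<lambda>x. u x - \<phi> x) < \<infinity>" "Np bal p (\<lambda>x. g x - grad \<phi> x) < \<infinity>"
    using \<phi>(2,3) by (auto intro: le_less_trans)
  then show "Np bal p u < \<infinity>" "Np bal p g < \<infinity>"
    using test_Np_finite[OF \<phi>(1)] Np_finite_diff[of u bal \<phi>] Np_finite_diff[of g bal "grad \<phi>"] by simp_all
qed

text \<open>A closure is closed: the errors of two successive approximations are added, each shrunk
  beforehand by the constant of the triangle inequality.\<close>

lemma W0_approx:
  assumes [measurable]: "u \<in> borel_measurable borel" "g \<in> borel_measurable borel"
    and ap: "\<And>e. e > 0 \<Longrightarrow> \<exists>v h. W0 v h \<and> Np bal p (\<lambda>x. u x - v x) \<le> ennreal e \<and> Np bal p (\<lambda>x. g x - h x) \<le> ennreal e"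
  shows "W0 u g"
  unfolding W0_def
proof (intro conjI allI impI)
  fix e :: real assume "e > 0"
  define d where "d = e / (2 * 2 powr p)"
  have d: "d > 0" "2 powr p * (d + d) = e" using \<open>e > 0\<close> by (auto simp: d_def)
  obtain v h where v: "W0 v h" "Np bal p (\<lambda>x. u x - v x) \<le> ennreal d" "Np bal p (\<lambda>x. g x - h x) \<le> ennreal d"
    using ap[OF d(1)] by blast
  obtain \<phi> where \<phi>: "\<phi> \<in> tst" "Np bal p (\<lambda>x. v x - \<phi> x) \<le> ennreal d" "Np bal p (\<lambda>x. h x - grad \<phi> x) \<le> ennreal d"
    using v(1) d(1) unfolding W0_def by meson
  have [measurable]: "v \<in> borel_measurable borel" "h \<in> borel_measurable borel"
    "\<phi> \<in> borel_measurable borel" "grad \<phi> \<in> borel_measurable borel"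
    using W0_measurable[OF v(1)] test_functions_measurable[OF \<phi>(1)] by auto
  have e: "ennreal e = ennreal (2 powr p) * (ennreal d + ennreal d)"
    using d by (simp flip: ennreal_plus ennreal_mult)
  have "Np bal p (\<lambda>x. u x - \<phi> x) \<le> ennreal (2 powr p) * (Np bal p (\<lambda>x. u x - v x) + Np bal p (\<lambda>x. v x - \<phi> x))"
    by (rule Np_triangle) (use p_ge in auto)
  also have "\<dots> \<le> ennreal e" unfolding e by (intro mult_left_mono add_mono v \<phi>) auto
  finally have 1: "Np bal p (\<lambda>x. u x - \<phi> x) \<le> ennreal e" .
  have "Np bal p (\<lambda>x. g x - grad \<phi> x) \<le> ennreal (2 powr p) * (Np bal p (\<lambda>x. g x - h x) + Np bal p (\<lambda>x. h x - grad \<phi> x))"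
    by (rule Np_triangle) (use p_ge in auto)
  also have "\<dots> \<le> ennreal e" unfolding e by (intro mult_left_mono add_mono v \<phi>) auto
  finally show "\<exists>\<phi>\<in>tst. Np bal p (\<lambda>x. u x - \<phi> x) \<le> ennreal e \<and> Np bal p (\<lambda>x. g x - grad \<phi> x) \<le> ennreal e"
    using 1 \<phi>(1) by blast
qed auto

lemma Np_zero_AE: "AE x in M. f x = g x \<Longrightarrow> Np M p (\<lambda>x. f x - g x) = 0"
  using p_ge Np_cong_AE[of "\<lambda>x. f x - g x" "\<lambda>x. 0" M p] by (auto simp: Np_def elim: eventually_mono)

lemma W0_cong_AE:
  assumes "W0 u g" "v \<in> borel_measurable borel" "h \<in> borel_measurable borel"
    "AE x in bal. v x = u x" "AE x in bal. h x = g x"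
  shows "W0 v h"
  using assms Np_zero_AE[OF assms(4)] Np_zero_AE[OF assms(5)] by (intro W0_approx) (auto intro!: exI[of _ u] exI[of _ g])

lemma W0_test: "\<phi> \<in> tst \<Longrightarrow> W0 \<phi> (grad \<phi>)"
  unfolding W0_def using test_functions_measurable[of \<phi>] Np_zero_AE[of \<phi> \<phi> bal] Np_zero_AE[of "grad \<phi>" "grad \<phi>" bal]
  by (auto intro!: bexI[of _ \<phi>])

lemma test_functions_lincomb:
  assumes f: "f \<in> test_functions U" and g: "g \<in> test_functions U"
  shows "(\<lambda>x. a * f x + b * g x) \<in> test_functions U"
proof -
  obtain K where K: "compact K" "K \<subseteq> U" "\<forall>x. f x \<noteq> 0 \<longrightarrow> x \<in> K"
    using test_functions_support[OF f] by blast
  obtain L where L: "compact L" "L \<subseteq> U" "\<forall>x. g x \<noteq> 0 \<longrightarrow> x \<in> L"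
    using test_functions_support[OF g] by blast
  show ?thesis
  proof (rule test_functionsI[of _ "K \<union> L"])
    show "Ck k (\<lambda>x. a * f x + b * g x)" for k
      by (intro Ck_add Ck_mult Ck_const test_functions_Ck[OF f] test_functions_Ck[OF g])
    show "x \<in> K \<union> L" if "a * f x + b * g x \<noteq> 0" for x
      using that K(3) L(3) by (cases "f x = 0"; cases "g x = 0") auto
  qed (use K L in auto)
qed

lemma W0_lincomb:
  assumes "W0 u g" "W0 v h"
  shows "W0 (\<lambda>x. a * u x + b * v x) (\<lambda>x. a *\<^sub>R g x + b *\<^sub>R h x)"
  unfolding W0_def
proof (intro conjI allI impI)
  have [measurable]: "u \<in> borel_measurable borel" "g \<in> borel_measurable borel" "v \<in> borel_measurable borel" "h \<in> borel_measurable borel"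
    using assms W0_measurable by auto
  show "(\<lambda>x. a * u x + b * v x) \<in> borel_measurable borel" "(\<lambda>x. a *\<^sub>R g x + b *\<^sub>R h x) \<in> borel_measurable borel"
    by measurable
  fix e :: real assume "e > 0"
  define c where "c = \<bar>a\<bar> powr p + \<bar>b\<bar> powr p + 1"
  have c: "c > 0" by (simp add: c_def add_nonneg_pos)
  define d where "d = e / (2 powr p * c)"
  have d: "d > 0" "2 powr p * (c * d) = e" using \<open>e > 0\<close> c by (auto simp: d_def)
  obtain \<phi> where \<phi>: "\<phi> \<in> tst" "Np bal p (\<lambda>x. u x - \<phi> x) \<le> ennreal d" "Np bal p (\<lambda>x. g x - grad \<phi> x) \<le> ennreal d"
    using assms(1) d(1) unfolding W0_def by meson
  obtain \<psi> where \<psi>: "\<psi> \<in> tst" "Np bal p (\<lambda>x. v x - \<psi> x) \<le> ennreal d" "Np bal p (\<lambda>x. h x - grad \<psi> x) \<le> ennreal d"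
    using assms(2) d(1) unfolding W0_def by meson
  have [measurable]: "\<phi> \<in> borel_measurable borel" "grad \<phi> \<in> borel_measurable borel" "\<psi> \<in> borel_measurable borel" "grad \<psi> \<in> borel_measurable borel"
    using test_functions_measurable[OF \<phi>(1)] test_functions_measurable[OF \<psi>(1)] by auto
  have gr: "grad (\<lambda>x. a * \<phi> x + b * \<psi> x) x = a *\<^sub>R grad \<phi> x + b *\<^sub>R grad \<psi> x" for x
    by (rule grad_eqI)
      (auto intro!: derivative_eq_intros has_derivative_grad[OF test_functions_differentiable[OF \<phi>(1)]]
         has_derivative_grad[OF test_functions_differentiable[OF \<psi>(1)]] simp: inner_add_left)
  have gen: "Np bal p (\<lambda>x. a *\<^sub>R f1 x + b *\<^sub>R f2 x) \<le> ennreal e"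
    if [measurable]: "f1 \<in> borel_measurable borel" "f2 \<in> borel_measurable borel"
      and le: "Np bal p f1 \<le> ennreal d" "Np bal p f2 \<le> ennreal d" for f1 f2 :: "real^'n \<Rightarrow> 'b::euclidean_space"
  proof -
    have sc: "Np bal p (\<lambda>x. t *\<^sub>R f x) = ennreal (\<bar>t\<bar> powr p) * Np bal p f" if [measurable]: "f \<in> borel_measurable borel" for t and f :: "real^'n \<Rightarrow> 'b"
      unfolding Np_def by (subst nn_integral_cmult[symmetric]) (auto simp: powr_mult ennreal_mult)
    have "Np bal p (\<lambda>x. a *\<^sub>R f1 x + b *\<^sub>R f2 x) \<le> ennreal (2 powr p) * (ennreal (\<bar>a\<bar> powr p) * Np bal p f1 + ennreal (\<bar>b\<bar> powr p) * Np bal p f2)"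
      using Np_add[OF p_ge(1), of "\<lambda>x. a *\<^sub>R f1 x" bal "\<lambda>x. b *\<^sub>R f2 x"] by (simp add: sc)
    also have "\<dots> \<le> ennreal (2 powr p) * (ennreal (\<bar>a\<bar> powr p) * ennreal d + ennreal (\<bar>b\<bar> powr p) * ennreal d)"
      by (intro mult_left_mono add_mono le) auto
    also have "\<dots> = ennreal (2 powr p * (\<bar>a\<bar> powr p * d + \<bar>b\<bar> powr p * d))"
      using d(1) by (simp flip: ennreal_plus ennreal_mult)
    also have "\<dots> \<le> ennreal e"
      using d(1) unfolding d(2)[symmetric] c_def by (intro ennreal_leI mult_left_mono) (auto simp: algebra_simps)
    finally show ?thesis .
  qed
  have "(\<lambda>x. a * u x + b * v x - (a * \<phi> x + b * \<psi> x)) = (\<lambda>x. a *\<^sub>R (u x - \<phi> x) + b *\<^sub>R (v x - \<psi> x))"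
    by (auto simp: fun_eq_iff algebra_simps)
  moreover have "(\<lambda>x. a *\<^sub>R g x + b *\<^sub>R h x - grad (\<lambda>x. a * \<phi> x + b * \<psi> x) x) = (\<lambda>x. a *\<^sub>R (g x - grad \<phi> x) + b *\<^sub>R (h x - grad \<psi> x))"
    by (auto simp: fun_eq_iff algebra_simps gr)
  ultimately show "\<exists>\<phi>\<in>tst. Np bal p (\<lambda>x. a * u x + b * v x - \<phi> x) \<le> ennreal e \<and> Np bal p (\<lambda>x. a *\<^sub>R g x + b *\<^sub>R h x - grad \<phi> x) \<le> ennreal e"
    using gen[OF _ _ \<phi>(2) \<psi>(2)] gen[OF _ _ \<phi>(3) \<psi>(3)]
    by (intro bexI[OF _ test_functions_lincomb[OF \<phi>(1) \<psi>(1), of a b]]) simp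
qed

text \<open>On a set of finite volume, approximation in p-th power gives approximation in L1, which
  is what is used against bounded functions. The choices of \<open>l\<close> and \<open>d\<close>
  make each of the two terms of \<open>nn_integral_norm_le_Np\<close> at most half of
  \<open>e\<close>.\<close>

lemma W0_L1:
  assumes "W0 u g" "e > 0"
  obtains \<phi> where "\<phi> \<in> tst" "(\<integral>\<^sup>+x. ennreal (norm (u x - \<phi> x)) \<partial>bal) \<le> ennreal e" "(\<integral>\<^sup>+x. ennreal (norm (g x - grad \<phi> x)) \<partial>bal) \<le> ennreal e"
proof -
  define V where "V = measure bal UNIV"
  have V: "V \<ge> 0" "emeasure bal UNIV = ennreal V"
    using finite_measure.emeasure_eq_measure[OF finite_measure_ballM] by (auto simp: V_def)
  define l where "l = e / (2 * (V + 1))"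
  have l: "l > 0" "l * V \<le> e / 2" using assms(2) V by (auto simp: l_def field_simps)
  define d where "d = e / (2 * l powr (1 - p))"
  have d: "d > 0" "l powr (1 - p) * d = e / 2" using assms(2) l(1) by (auto simp: d_def)
  obtain \<phi> where \<phi>: "\<phi> \<in> tst" "Np bal p (\<lambda>x. u x - \<phi> x) \<le> ennreal d" "Np bal p (\<lambda>x. g x - grad \<phi> x) \<le> ennreal d"
    using assms(1) d(1) unfolding W0_def by meson
  have [measurable]: "u \<in> borel_measurable borel" "g \<in> borel_measurable borel"
    "\<phi> \<in> borel_measurable borel" "grad \<phi> \<in> borel_measurable borel"
    using W0_measurable[OF assms(1)] test_functions_measurable[OF \<phi>(1)] by auto
  have gen: "(\<integral>\<^sup>+x. ennreal (norm (f x)) \<partial>bal) \<le> ennreal e"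
    if [measurable]: "f \<in> borel_measurable borel" and le: "Np bal p f \<le> ennreal d" for f :: "real^'n \<Rightarrow> 'b::euclidean_space"
  proof -
    have "(\<integral>\<^sup>+x. ennreal (norm (f x)) \<partial>bal) \<le> ennreal l * emeasure bal (space bal) + ennreal (l powr (1 - p)) * Np bal p f"
      by (rule nn_integral_norm_le_Np) (use l p_ge in auto)
    also have "\<dots> \<le> ennreal l * ennreal V + ennreal (l powr (1 - p)) * ennreal d"
      using le V by (auto intro!: add_mono mult_left_mono)
    also have "\<dots> = ennreal (l * V + l powr (1 - p) * d)"
      using l d V by (simp flip: ennreal_plus ennreal_mult)
    also have "\<dots> \<le> ennreal e"
      using l d by (intro ennreal_leI) auto
    finally show ?thesis .
  qed
  show ?thesis
    using gen[OF _ \<phi>(2)] gen[OF _ \<phi>(3)] by (intro that[OF \<phi>(1)]) auto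
qed

lemma W0_integrable:
  assumes "W0 u g"
  shows "integrable bal u" "integrable bal g"
  using W0_measurable[OF assms] W0_Np_finite[OF assms] p_ge
  by (auto intro!: Np_integrable[where p = p] finite_measure_ballM)

lemma test_by_parts_bal:
  assumes "\<phi> \<in> tst" "\<psi> \<in> test_functions UNIV"
  shows "(LINT x|bal. \<phi> x * partial_deriv i \<psi> x) = - (LINT x|bal. grad \<phi> x $ i * \<psi> x)"
proof -
  have [measurable]: "\<phi> \<in> borel_measurable borel" "partial_deriv i \<phi> \<in> borel_measurable borel"
    "\<psi> \<in> borel_measurable borel" "partial_deriv i \<psi> \<in> borel_measurable borel"
    using test_functions_measurable[OF assms(1)] test_functions_measurable[OF assms(2)] by auto
  obtain K where K: "compact K" "K \<subseteq> ball 0 R" "\<forall>x. \<phi> x \<noteq> 0 \<longrightarrow> x \<in> K"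
    using test_functions_support[OF assms(1)] by blast
  have \<phi>0: "\<phi> x = 0" if "x \<notin> ball 0 R" for x
    using K that by blast
  have "grad \<phi> x = 0" if "x \<notin> ball 0 R" for x
    by (rule grad_eq_0_outside[of K]) (use K that compact_imp_closed in auto)
  then have g0: "partial_deriv i \<phi> x = 0" if "x \<notin> ball 0 R" for x
    using that by (simp add: vec_eq_iff)
  have "(LINT x|bal. \<phi> x * partial_deriv i \<psi> x) = (LINT x|lborel. \<phi> x * partial_deriv i \<psi> x)"
    using \<phi>0 by (subst integral_ballM_lborel) (auto intro!: Bochner_Integration.integral_cong simp: indicator_def)
  also have "\<dots> = - (LINT x|lborel. partial_deriv i \<phi> x * \<psi> x)"
    by (rule test_functions_by_parts[OF assms])
  also have "(LINT x|lborel. partial_deriv i \<phi> x * \<psi> x) = (LINT x|bal. grad \<phi> x $ i * \<psi> x)"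
    using g0 by (subst integral_ballM_lborel) (auto intro!: Bochner_Integration.integral_cong simp: indicator_def)
  finally show ?thesis .
qed

lemma integrable_mult_bounded:
  fixes f k :: "'a \<Rightarrow> real"
  assumes "integrable M f" "k \<in> borel_measurable M" "\<And>x. \<bar>k x\<bar> \<le> B"
  shows "integrable M (\<lambda>x. f x * k x)"
proof (rule Bochner_Integration.integrable_bound[of _ "\<lambda>x. B * f x"])
  have "\<bar>f x\<bar> * \<bar>k x\<bar> \<le> \<bar>B\<bar> * \<bar>f x\<bar>" for x
    using assms(3)[of x] by (subst mult.commute) (intro mult_right_mono, auto)
  then show "AE x in M. norm (f x * k x) \<le> norm (B * f x)"
    by (auto simp: abs_mult)
qed (use assms in auto)

text \<open>Here \<open>\<psi>\<close> may be nonzero on the boundary sphere. The approximating test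
  functions vanish near it, so no boundary term arises; this is how the zero boundary values enter
  the mollification argument. Both sides are continuous in L1 because \<open>\<psi>\<close> and its
  gradient are bounded.\<close>

lemma W0_weak:
  assumes W: "W0 u g" and \<psi>: "\<psi> \<in> test_functions UNIV"
  shows "(LINT x|bal. u x * partial_deriv i \<psi> x) = - (LINT x|bal. g x $ i * \<psi> x)"
proof -
  obtain B where B: "B > 0" "\<And>x. \<bar>\<psi> x\<bar> \<le> B" "\<And>x. norm (grad \<psi> x) \<le> B"
    using test_functions_bounds[OF \<psi>] by blast
  have B': "\<bar>partial_deriv i \<psi> x\<bar> \<le> B" for x
    using component_le_norm_cart[of "grad \<psi> x" i] B(3)[of x] by simp
  note um [measurable] = W0_measurable[OF W]
  note pm [measurable] = test_functions_measurable[OF \<psi>]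
  have gi: "integrable bal (\<lambda>x. f x $ i)" if "integrable bal f" for f :: "real^'n \<Rightarrow> real^'n"
    using integrable_bounded_linear[OF bounded_linear_vec_nth that] .
  let ?D = "(LINT x|bal. u x * partial_deriv i \<psi> x) + (LINT x|bal. g x $ i * \<psi> x)"
  have "\<bar>?D\<bar> \<le> 0"
  proof (rule field_le_epsilon)
    fix e :: real assume "e > 0"
    then have e: "e / (2 * B) > 0" using B by simp
    obtain \<phi> where \<phi>: "\<phi> \<in> tst" "(\<integral>\<^sup>+x. ennreal (norm (u x - \<phi> x)) \<partial>bal) \<le> ennreal (e / (2 * B))" "(\<integral>\<^sup>+x. ennreal (norm (g x - grad \<phi> x)) \<partial>bal) \<le> ennreal (e / (2 * B))"
      by (rule W0_L1[OF W e])
    note pm2 [measurable] = test_functions_measurable[OF \<phi>(1)]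
    have gen: "\<bar>LINT x|bal. f x * k x\<bar> \<le> e / 2" if f: "integrable bal f" and k: "k \<in> borel_measurable borel" "\<And>x. \<bar>k x\<bar> \<le> B"
      and le: "(\<integral>\<^sup>+x. ennreal \<bar>f x\<bar> \<partial>bal) \<le> ennreal (e / (2 * B))" for f k :: "real^'n \<Rightarrow> real"
    proof -
      have i: "integrable bal (\<lambda>x. f x * k x)"
        by (rule integrable_mult_bounded[OF f _ k(2)]) (use k in simp)
      have "ennreal \<bar>LINT x|bal. f x * k x\<bar> \<le> (\<integral>\<^sup>+x. ennreal \<bar>f x * k x\<bar> \<partial>bal)"
        using integral_norm_bound_ennreal[OF i] by simp
      also have "\<dots> \<le> (\<integral>\<^sup>+x. ennreal B * ennreal \<bar>f x\<bar> \<partial>bal)"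
      proof (rule nn_integral_mono)
        fix x
        have "\<bar>f x * k x\<bar> \<le> B * \<bar>f x\<bar>"
          using mult_right_mono[OF k(2)[of x], of "\<bar>f x\<bar>"] by (simp add: abs_mult mult.commute)
        then show "ennreal \<bar>f x * k x\<bar> \<le> ennreal B * ennreal \<bar>f x\<bar>"
          using B(1) by (simp add: ennreal_leI flip: ennreal_mult)
      qed
      also have "\<dots> = ennreal B * (\<integral>\<^sup>+x. ennreal \<bar>f x\<bar> \<partial>bal)"
        using f by (intro nn_integral_cmult) auto
      also have "\<dots> \<le> ennreal B * ennreal (e / (2 * B))"
        by (intro mult_left_mono le) auto
      also have "\<dots> = ennreal (e / 2)"
        using B(1) \<open>e > 0\<close> by (simp flip: ennreal_mult)
      finally show ?thesis using \<open>e > 0\<close> by simp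
    qed
    note ints = W0_integrable[OF W] W0_integrable[OF W0_test[OF \<phi>(1)]]
    have I1: "integrable bal (\<lambda>x. u x - \<phi> x)" and I2: "integrable bal (\<lambda>x. g x $ i - grad \<phi> x $ i)"
      using Bochner_Integration.integrable_diff[OF ints(1,3)] Bochner_Integration.integrable_diff[OF gi[OF ints(2)] gi[OF ints(4)]] by simp_all
    have J: "integrable bal (\<lambda>x. u x * partial_deriv i \<psi> x)" "integrable bal (\<lambda>x. \<phi> x * partial_deriv i \<psi> x)"
      "integrable bal (\<lambda>x. g x $ i * \<psi> x)" "integrable bal (\<lambda>x. grad \<phi> x $ i * \<psi> x)"
      using integrable_mult_bounded[OF ints(1) _ B'] integrable_mult_bounded[OF ints(3) _ B'] integrable_mult_bounded[OF gi[OF ints(2)] _ B(2)] integrable_mult_bounded[OF gi[OF ints(4)] _ B(2)] pm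
      by auto
    have "?D = (LINT x|bal. (u x - \<phi> x) * partial_deriv i \<psi> x) + (LINT x|bal. (g x $ i - grad \<phi> x $ i) * \<psi> x)"
      using test_by_parts_bal[OF \<phi>(1) \<psi>, of i] J by (simp add: left_diff_distrib)
    moreover have "\<bar>LINT x|bal. (u x - \<phi> x) * partial_deriv i \<psi> x\<bar> \<le> e / 2"
      using gen[OF I1 pm(3) B'] \<phi>(2) by simp
    moreover have "\<bar>LINT x|bal. (g x $ i - grad \<phi> x $ i) * \<psi> x\<bar> \<le> e / 2"
    proof (rule gen[OF I2 pm(1) B(2)])
      have "(\<integral>\<^sup>+x. ennreal \<bar>g x $ i - grad \<phi> x $ i\<bar> \<partial>bal) \<le> (\<integral>\<^sup>+x. ennreal (norm (g x - grad \<phi> x)) \<partial>bal)"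
        using component_le_norm_cart[of "g x - grad \<phi> x" i for x] by (intro nn_integral_mono ennreal_leI) simp
      then show "(\<integral>\<^sup>+x. ennreal \<bar>g x $ i - grad \<phi> x $ i\<bar> \<partial>bal) \<le> ennreal (e / (2 * B))"
        using \<phi>(3) by (rule order_trans)
    qed
    ultimately show "\<bar>?D\<bar> \<le> 0 + e" by linarith
  qed
  then show ?thesis by linarith
qed

section \<open>Radial functions\<close>

text \<open>A profile is given by \<open>h = - \<partial>\<^sub>r u\<close>, so that \<open>u\<close> is recovered from its boundary value \<open>0\<close> as \<open>wint R h\<close>.\<close>

definition rprof :: "(real \<Rightarrow> real) \<Rightarrow> bool" where
  "rprof h \<longleftrightarrow> h \<in> borel_measurable borel \<and> Np (radM TYPE('n) R) p h < \<infinity>"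

definition W0rad :: "(real \<Rightarrow> real) \<Rightarrow> bool" where
  "W0rad h \<longleftrightarrow> W0 (\<lambda>x. wint R h (norm x)) (\<lambda>x. - h (norm x) *\<^sub>R sgn x)"

lemma rprof_measurable: "rprof h \<Longrightarrow> h \<in> borel_measurable borel"
  by (simp add: rprof_def)

lemma rprof_set_integrable: "rprof h \<Longrightarrow> r > 0 \<Longrightarrow> set_integrable lborel {r<..<R} h"
  using set_integrable_radM[of h p R r, where 'n = 'n] p_ge by (simp add: rprof_def)

lemma Np_gradient_radial_le:
  assumes [measurable]: "h \<in> borel_measurable borel"
  shows "Np bal p (\<lambda>x. - h (norm x) *\<^sub>R sgn x) \<le> Np (radM TYPE('n) R) p h"
proof -
  have "Np bal p (\<lambda>x. - h (norm x) *\<^sub>R sgn x) \<le> Np bal p (\<lambda>x. h (norm x))"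
    by (rule Np_mono_AE[OF p_ge(1)]) (auto simp: norm_sgn intro!: AE_I2)
  also have "\<dots> = Np (radM TYPE('n) R) p h" by (rule Np_radial) simp
  finally show ?thesis .
qed

text \<open>Convergence of the profiles suffices: the gradient is controlled by \<open>h\<close>
  directly, the function by the Poincare inequality. The summand 1 in \<open>C\<close> lets one
  constant serve both estimates.\<close>

lemma W0rad_approx:
  assumes h: "rprof h" and ap: "\<And>e. e > 0 \<Longrightarrow> \<exists>k. rprof k \<and> W0rad k \<and> Np (radM TYPE('n) R) p (\<lambda>r. h r - k r) \<le> ennreal e"
  shows "W0rad h"
  unfolding W0rad_def
proof (rule W0_approx)
  have [measurable]: "h \<in> borel_measurable borel" using h by (rule rprof_measurable)
  show "(\<lambda>x::real^'n. wint R h (norm x)) \<in> borel_measurable borel" "(\<lambda>x::real^'n. - h (norm x) *\<^sub>R sgn x) \<in> borel_measurable borel"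
    by measurable
  fix e :: real assume "e > 0"
  define C where "C = 2 powr p * R powr p + 1"
  have C: "C > 0" "C \<ge> 1" by (auto simp: C_def add_nonneg_pos)
  obtain k where k: "rprof k" "W0rad k" "Np (radM TYPE('n) R) p (\<lambda>r. h r - k r) \<le> ennreal (e / C)"
    using ap[of "e / C"] \<open>e > 0\<close> C by auto
  have [measurable]: "k \<in> borel_measurable borel" using k(1) by (rule rprof_measurable)
  have "Np bal p (\<lambda>x. wint R h (norm x) - wint R k (norm x)) = Np (radM TYPE('n) R) p (\<lambda>r. wint R h r - wint R k r)"
    by (rule Np_radial[where f = "\<lambda>r. wint R h r - wint R k r"]) simp
  also have "\<dots> \<le> ennreal (2 powr p * R powr p) * Np (radM TYPE('n) R) p (\<lambda>r. h r - k r)"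
    by (rule wint_diff_poincare) (use h k(1) p_ge R_pos in \<open>auto simp: rprof_def\<close>)
  also have "\<dots> \<le> ennreal C * ennreal (e / C)"
    using k(3) by (intro mult_mono ennreal_leI) (auto simp: C_def)
  also have "\<dots> = ennreal e"
    using C \<open>e > 0\<close> by (simp flip: ennreal_mult)
  finally have 1: "Np bal p (\<lambda>x. wint R h (norm x) - wint R k (norm x)) \<le> ennreal e" .
  have "Np bal p (\<lambda>x. - h (norm x) *\<^sub>R sgn x - - k (norm x) *\<^sub>R sgn x) = Np bal p (\<lambda>x. - (h (norm x) - k (norm x)) *\<^sub>R sgn x)"
    by (simp add: algebra_simps)
  also have "\<dots> \<le> Np (radM TYPE('n) R) p (\<lambda>r. h r - k r)"
    by (rule Np_gradient_radial_le) simp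
  also have "\<dots> \<le> ennreal (e / C)" by (rule k)
  also have "\<dots> \<le> ennreal e"
    using C \<open>e > 0\<close> by (intro ennreal_leI) (simp add: field_simps)
  finally show "\<exists>v g. W0 v g \<and> Np bal p (\<lambda>x. wint R h (norm x) - v x) \<le> ennreal e \<and> Np bal p (\<lambda>x. - h (norm x) *\<^sub>R sgn x - g x) \<le> ennreal e"
    using 1 k(2) unfolding W0rad_def by blast
qed

lemma W0rad_cong:
  assumes h: "rprof h" and k: "rprof k" "W0rad k" and eq: "\<And>r. 0 < r \<Longrightarrow> r < R \<Longrightarrow> h r = k r"
  shows "W0rad h"
proof (rule W0rad_approx[OF h])
  have "Np (radM TYPE('n) R) p (\<lambda>r. h r - k r) = 0"
    by (rule Np_zero_AE) (auto simp: AE_radM eq)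
  then show "\<exists>k. rprof k \<and> W0rad k \<and> Np (radM TYPE('n) R) p (\<lambda>r. h r - k r) \<le> ennreal e" for e
    using k by auto
qed

text \<open>This closure property carries the class from smooth profiles to all measurable ones: by
  domination, pointwise convergence becomes convergence in the weighted p-th power.\<close>

lemma W0rad_dominated:
  assumes k: "\<And>n. rprof (k n)" "\<And>n. W0rad (k n)"
    and h: "h \<in> borel_measurable borel" and w: "rprof w"
    and lim: "\<And>r. 0 < r \<Longrightarrow> r < R \<Longrightarrow> (\<lambda>n. k n r) \<longlonglongrightarrow> h r"
    and bd: "\<And>n r. 0 < r \<Longrightarrow> r < R \<Longrightarrow> \<bar>k n r\<bar> \<le> w r"
  shows "rprof h" "W0rad h"
proof -
  have [measurable]: "h \<in> borel_measurable borel" "k n \<in> borel_measurable borel" "w \<in> borel_measurable borel" for n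
    using h k(1) w by (auto simp: rprof_def)
  have hw: "\<bar>h r\<bar> \<le> w r" if "0 < r" "r < R" for r
    by (rule LIMSEQ_le_const2[OF tendsto_rabs[OF lim[OF that]]]) (use bd[OF that] in auto)
  have hw': "\<bar>h r\<bar> \<le> \<bar>w r\<bar>" if "0 < r" "r < R" for r
    using hw[OF that] by linarith
  have "Np (radM TYPE('n) R) p h \<le> Np (radM TYPE('n) R) p w"
    by (rule Np_mono_AE[OF p_ge(1)]) (simp add: AE_radM hw')
  then show h': "rprof h"
    using w by (auto simp: rprof_def intro: le_less_trans)
  have "(\<lambda>n. \<integral>\<^sup>+r. ennreal (\<bar>h r - k n r\<bar> powr p) \<partial>(radM TYPE('n) R)) \<longlonglongrightarrow> (\<integral>\<^sup>+r. 0 \<partial>(radM TYPE('n) R))"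
  proof (rule nn_integral_dominated_convergence[where w = "\<lambda>r. ennreal (2 powr p) * ennreal (\<bar>w r\<bar> powr p)"])
    show "(\<integral>\<^sup>+r. ennreal (2 powr p) * ennreal (\<bar>w r\<bar> powr p) \<partial>(radM TYPE('n) R)) < \<infinity>"
      using w by (subst nn_integral_cmult) (auto simp: rprof_def Np_def ennreal_mult_less_top)
    show "AE r in (radM TYPE('n) R). ennreal (\<bar>h r - k n r\<bar> powr p) \<le> ennreal (2 powr p) * ennreal (\<bar>w r\<bar> powr p)" for n
    proof -
      have "\<bar>h r - k n r\<bar> powr p \<le> 2 powr p * \<bar>w r\<bar> powr p" if "0 < r" "r < R" for r
      proof -
        have "\<bar>h r - k n r\<bar> \<le> 2 * \<bar>w r\<bar>" using hw[OF that] bd[OF that, of n] by linarith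
        then have "\<bar>h r - k n r\<bar> powr p \<le> (2 * \<bar>w r\<bar>) powr p" using p_ge by (intro powr_mono2) auto
        then show ?thesis by (simp add: powr_mult)
      qed
      then show ?thesis by (auto simp: AE_radM intro!: AE_I2 ennreal_leI simp flip: ennreal_mult)
    qed
    show "AE r in (radM TYPE('n) R). (\<lambda>n. ennreal (\<bar>h r - k n r\<bar> powr p)) \<longlonglongrightarrow> 0"
    proof -
      have "(\<lambda>n. ennreal (\<bar>h r - k n r\<bar> powr p)) \<longlonglongrightarrow> 0" if "0 < r" "r < R" for r
      proof -
        have "(\<lambda>n. \<bar>h r - k n r\<bar>) \<longlonglongrightarrow> \<bar>h r - h r\<bar>"
          by (intro tendsto_intros lim that)
        then have "(\<lambda>n. \<bar>h r - k n r\<bar> powr p) \<longlonglongrightarrow> 0"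
          using p_ge by (intro tendsto_zero_powrI[where b = p] tendsto_const) auto
        then show ?thesis using tendsto_ennrealI by fastforce
      qed
      then show ?thesis by (auto simp: AE_radM intro!: AE_I2)
    qed
  qed (use h k in auto)
  then have lim0: "(\<lambda>n. Np (radM TYPE('n) R) p (\<lambda>r. h r - k n r)) \<longlonglongrightarrow> 0"
    by (simp add: Np_def)
  show "W0rad h"
  proof (rule W0rad_approx[OF h'])
    fix e :: real assume "e > 0"
    then have "eventually (\<lambda>n. Np (radM TYPE('n) R) p (\<lambda>r. h r - k n r) < ennreal e) sequentially"
      using order_tendstoD(2)[OF lim0, of "ennreal e"] by simp
    then obtain n where "Np (radM TYPE('n) R) p (\<lambda>r. h r - k n r) < ennreal e"
      by (auto simp: eventually_sequentially)
    then show "\<exists>k. rprof k \<and> W0rad k \<and> Np (radM TYPE('n) R) p (\<lambda>r. h r - k r) \<le> ennreal e"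
      using k by (intro exI[of _ "k n"]) auto
  qed
qed

lemma rprof_lincomb: "rprof h \<Longrightarrow> rprof k \<Longrightarrow> rprof (\<lambda>r. a * h r + b * k r)"
proof -
  assume h: "rprof h" and k: "rprof k"
  then have [measurable]: "h \<in> borel_measurable borel" "k \<in> borel_measurable borel" by (auto simp: rprof_def)
  have sc: "Np (radM TYPE('n) R) p (\<lambda>x. t * f x) = ennreal (\<bar>t\<bar> powr p) * Np (radM TYPE('n) R) p f" if [measurable]: "f \<in> borel_measurable borel" for t and f :: "real \<Rightarrow> real"
    unfolding Np_def by (subst nn_integral_cmult[symmetric]) (auto simp: powr_mult abs_mult ennreal_mult)
  have "Np (radM TYPE('n) R) p (\<lambda>r. a * h r + b * k r) \<le> ennreal (2 powr p) * (ennreal (\<bar>a\<bar> powr p) * Np (radM TYPE('n) R) p h + ennreal (\<bar>b\<bar> powr p) * Np (radM TYPE('n) R) p k)"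
    using Np_add[OF p_ge(1), of "\<lambda>x. a * h x" "(radM TYPE('n) R)" "\<lambda>x. b * k x"] by (simp add: sc)
  also have "\<dots> < \<infinity>" using h k by (simp add: rprof_def ennreal_mult_less_top)
  finally show ?thesis by (simp add: rprof_def)
qed

lemma wint_lincomb:
  assumes "rprof h" "rprof k" "r > 0"
  shows "wint R (\<lambda>r. a * h r + b * k r) r = a * wint R h r + b * wint R k r"
proof -
  have 1: "set_integrable lborel {r<..<R} (\<lambda>s. a * h s)"
    using rprof_set_integrable[OF assms(1,3)] by simp
  have 2: "set_integrable lborel {r<..<R} (\<lambda>s. b * k s)"
    using rprof_set_integrable[OF assms(2,3)] by simp
  show ?thesis
    using set_integral_add(2)[OF 1 2] by (simp add: wint_def)
qed

lemma AE_bal_nonzero: "AE x in bal. x \<noteq> 0 \<and> norm x < R"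
proof -
  have "AE x in lborel. (x :: real^'n) \<noteq> 0" by (rule AE_lborel_singleton)
  then have "AE x in lborel. x \<in> ball 0 R \<longrightarrow> (x :: real^'n) \<noteq> 0 \<and> norm x < R"
    by eventually_elim auto
  then show ?thesis unfolding AE_ballM by (subst AE_lebesgue_on_iff) auto
qed

lemma W0rad_lincomb:
  assumes "rprof h" "W0rad h" "rprof k" "W0rad k"
  shows "W0rad (\<lambda>r. a * h r + b * k r)"
proof -
  have [measurable]: "h \<in> borel_measurable borel" "k \<in> borel_measurable borel" using assms by (auto simp: rprof_def)
  show ?thesis
    unfolding W0rad_def
  proof (rule W0_cong_AE[OF W0_lincomb[OF assms(2,4)[unfolded W0rad_def], of a b]])
    show "AE x in bal. wint R (\<lambda>r. a * h r + b * k r) (norm x) = a * wint R h (norm x) + b * wint R k (norm x)"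
      using AE_bal_nonzero by eventually_elim (simp add: wint_lincomb assms)
    show "AE x in bal. - (a * h (norm x) + b * k (norm x)) *\<^sub>R sgn x = a *\<^sub>R - h (norm x) *\<^sub>R sgn x + b *\<^sub>R - k (norm x) *\<^sub>R sgn x"
      by (intro AE_I2) (simp add: algebra_simps)
  qed measurable
qed

lemma rprof_bounded:
  assumes "h \<in> borel_measurable borel" "\<And>r. 0 < r \<Longrightarrow> r < R \<Longrightarrow> \<bar>h r\<bar> \<le> B"
  shows "rprof h"
proof -
  have "AE r in (radM TYPE('n) R). norm (h r) \<le> B" by (simp add: AE_radM assms)
  then show ?thesis
    using Np_bounded[OF finite_measure_radM, of h B] assms(1) by (simp add: rprof_def)
qed

text \<open>A smooth function of |x|^2 is smooth across the origin, and its radial derivative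
  carries the factor 2 r; this is why that factor accompanies all profiles up to
  \<open>W0rad_simple\<close>. The profile in question belongs to \<open>m (x \<bullet> x)\<close>,
  where \<open>m\<close> is the antiderivative of the negative bump that vanishes at
  \<open>b\<close>.\<close>

lemma W0rad_bump:
  assumes "b \<le> R\<^sup>2"
  shows "rprof (\<lambda>r. 2 * r * bump a b k (r\<^sup>2))" "W0rad (\<lambda>r. 2 * r * bump a b k (r\<^sup>2))"
proof -
  define \<eta> where "\<eta> = bump a b k"
  define h where "h r = 2 * r * \<eta> (r\<^sup>2)" for r
  have [measurable]: "\<eta> \<in> borel_measurable borel" unfolding \<eta>_def by measurable
  have hm[measurable]: "h \<in> borel_measurable borel" unfolding h_def[abs_def] by measurable
  have \<eta>c: "continuous_on UNIV \<eta>" using C1k_bump[of 0 a b k] by (simp add: \<eta>_def)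
  then have \<eta>i: "isCont \<eta> t" for t by (simp add: continuous_on_eq_continuous_at)
  obtain F where F: "\<And>t. (F has_vector_derivative \<eta> t) (at t)"
    using einterval_antiderivative[of "-\<infinity>" "\<infinity>" \<eta>] \<eta>i by auto
  define m where "m t = F b - F t" for t
  have m: "(m has_real_derivative - \<eta> t) (at t)" for t
    unfolding m_def using F[of t] by (auto intro!: derivative_eq_intros simp: has_real_derivative_iff_has_vector_derivative)
  have Cm: "C1k j m" for j
  proof (rule C1k_antideriv[OF m])
    have "C1k j (\<lambda>t. (-1) * \<eta> t)" unfolding \<eta>_def by (intro C1k_mult C1k_const C1k_bump)
    then show "C1k j (\<lambda>t. - \<eta> t)" by simp
  qed
  \<comment> \<open>The bump vanishes from \<open>b - 1 / k\<close> on, so \<open>m\<close> is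
    constant there and equal to \<open>m b = 0\<close>. For k = 0 the bump, and with it
    \<open>m\<close>, vanishes everywhere.\<close>
  have m0: "m t = 0" if "k = 0 \<or> t \<ge> b - 1 / k" for t
  proof -
    have e0: "\<eta> s = 0" if "s \<ge> min t b" for s
    proof (rule ccontr)
      assume "\<eta> s \<noteq> 0"
      then have "s < b - 1 / k \<and> k > 0" unfolding \<eta>_def using bump_support by blast
      moreover have "1 / real k \<ge> 0" by simp
      ultimately show False using that \<open>k = 0 \<or> t \<ge> b - 1 / k\<close> by linarith
    qed
    have "m (max t b) = m (min t b)"
    proof (cases "min t b < max t b")
      case True
      show ?thesis
      proof (rule DERIV_isconst2[OF True])
        show "continuous_on {min t b..max t b} m"
          using m by (intro continuous_at_imp_continuous_on ballI DERIV_isCont)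
        show "(m has_real_derivative 0) (at x)" if "min t b < x" "x < max t b" for x
          using m[of x] e0[of x] that by simp
      qed auto
    qed (auto simp: max_def min_def split: if_splits)
    moreover have "m b = 0" by (simp add: m_def)
    ultimately show ?thesis by (auto simp: max_def min_def split: if_splits)
  qed
  define \<phi> where "\<phi> x = m (x \<bullet> x)" for x :: "real^'n"
  have \<phi>t: "\<phi> \<in> tst"
  proof (cases "k = 0")
    case True
    then have "\<phi> = (\<lambda>x. 0)" using m0 by (simp add: \<phi>_def fun_eq_iff)
    then show ?thesis by (simp add: zero_test_function)
  next
    case False
    \<comment> \<open>As \<open>b\<close> is at most the square of \<open>R\<close>, the margin 1/k
      keeps the support in a compact subset of the open ball.\<close>
    show ?thesis
    proof (rule test_functionsI[of _ "{x. x \<bullet> x \<le> b - 1 / k}"])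
      show "Ck j \<phi>" for j
        unfolding \<phi>_def using Ck_compose[OF Cm Ck_inner_self_shift[of j 0]] by simp
      show "{x::real^'n. x \<bullet> x \<le> b - 1 / k} \<subseteq> ball 0 R"
      proof
        fix x :: "real^'n" assume "x \<in> {x. x \<bullet> x \<le> b - 1 / k}"
        then have "x \<bullet> x \<le> b - 1 / real k" by simp
        moreover have "1 / real k > 0" using False by simp
        ultimately have "x \<bullet> x < R\<^sup>2" using assms by linarith
        then have "norm x ^ 2 < R ^ 2" by (simp add: power2_norm_eq_inner)
        then show "x \<in> ball 0 R" using power_less_imp_less_base[of "norm x" 2 R] R_pos by simp
      qed
      then have "bounded {x::real^'n. x \<bullet> x \<le> b - 1 / k}" by (rule bounded_subset[OF bounded_ball])
      then show "compact {x::real^'n. x \<bullet> x \<le> b - 1 / k}"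
        by (auto simp: compact_eq_bounded_closed intro!: closed_Collect_le continuous_intros)
      show "x \<in> {x. x \<bullet> x \<le> b - 1 / k}" if "\<phi> x \<noteq> 0" for x
        using m0[of "x \<bullet> x"] that by (force simp: \<phi>_def)
    qed
  qed
  have g\<phi>: "grad \<phi> x = - h (norm x) *\<^sub>R sgn x" for x
  proof (rule grad_eqI)
    have "(\<phi> has_derivative (\<lambda>v. - \<eta> (x \<bullet> x) * (x \<bullet> v + v \<bullet> x))) (at x)"
      unfolding \<phi>_def using has_derivative_compose[OF has_derivative_inner[OF has_derivative_ident has_derivative_ident] m[unfolded has_field_derivative_def], of x UNIV]
      by (simp add: o_def)
    moreover have "- h (norm x) *\<^sub>R sgn x = - (2 * \<eta> (x \<bullet> x)) *\<^sub>R x"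
      by (cases "x = 0") (simp_all add: h_def sgn_div_norm power2_norm_eq_inner)
    ultimately show "(\<phi> has_derivative (\<bullet>) (- h (norm x) *\<^sub>R sgn x)) (at x)"
      by (auto simp: inner_commute algebra_simps elim!: has_derivative_eq_rhs)
  qed
  have hb: "\<bar>h r\<bar> \<le> 2 * R" if "0 < r" "r < R" for r
  proof -
    have "\<bar>h r\<bar> = 2 * r * \<eta> (r\<^sup>2)" using that bump_bounds[of a b k] by (simp add: h_def \<eta>_def abs_mult)
    also have "\<dots> \<le> 2 * r * 1" using that bump_bounds[of a b k] by (intro mult_left_mono) (auto simp: \<eta>_def)
    finally show ?thesis using that by simp
  qed
  have rh: "rprof h" by (rule rprof_bounded[OF hm hb])
  have wi: "wint R h r = m (r\<^sup>2)" if "0 \<le> r" "r < R" for r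
  proof -
    have "(LBINT x=ereal r..ereal R. h x) = - m (R\<^sup>2) - (- m (r\<^sup>2))"
    proof (rule interval_integral_FTC_finite)
      show "continuous_on {min r R..max r R} h"
        unfolding h_def using \<eta>c by (auto intro!: continuous_intros elim!: continuous_on_compose2)
      show "((\<lambda>x. - m (x\<^sup>2)) has_vector_derivative h x) (at x within {min r R..max r R})" for x
        unfolding h_def has_real_derivative_iff_has_vector_derivative[symmetric]
        by (rule has_field_derivative_at_within, rule derivative_eq_intros, rule DERIV_chain2[OF m], (rule derivative_eq_intros refl)+) simp
    qed
    moreover have "m (R\<^sup>2) = 0"
    proof -
      have "1 / real k \<ge> 0" by simp
      then have "R\<^sup>2 \<ge> b - 1 / real k" using assms by linarith
      then show ?thesis using m0 by blast
    qed
    moreover have "(LBINT x=ereal r..ereal R. h x) = (LBINT x:{r<..<R}. h x)"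
      using interval_integral_Ioo[of "ereal r" "ereal R" h] that by simp
    ultimately show ?thesis by (simp add: wint_def)
  qed
  have "W0rad h"
    unfolding W0rad_def
  proof (rule W0_cong_AE[OF W0_test[OF \<phi>t]])
    show "AE x in bal. wint R h (norm x) = \<phi> x"
      using AE_bal_nonzero by eventually_elim (simp add: wi \<phi>_def power2_norm_eq_inner)
    show "AE x in bal. - h (norm x) *\<^sub>R sgn x = grad \<phi> x"
      by (simp add: g\<phi>)
  qed measurable
  then show "rprof (\<lambda>r. 2 * r * bump a b k (r\<^sup>2))" "W0rad (\<lambda>r. 2 * r * bump a b k (r\<^sup>2))"
    using rh by (simp_all add: h_def[abs_def] \<eta>_def)
qed

text \<open>The sets whose weighted indicator is an admissible profile contain the open intervals,
  through bumps in the squared radius, and form a Dynkin system: complements come from linearity,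
  disjoint unions from dominated convergence.\<close>

lemma W0rad_indicator:
  assumes "A \<in> sets borel"
  shows "rprof (\<lambda>r. 2 * r * indicator A r)" "W0rad (\<lambda>r. 2 * r * indicator A r)"
proof -
  have rp: "rprof (\<lambda>r. 2 * r * indicator B r)" if [measurable]: "B \<in> sets borel" for B
    by (rule rprof_bounded[where B = "2 * R"]) (auto simp: indicator_def)
  show "rprof (\<lambda>r. 2 * r * indicator A r)" by (rule rp[OF assms])
  have int: "W0rad (\<lambda>r. 2 * r * indicator {a<..<b} r)" for a b
  proof -
    \<comment> \<open>Only radii in (0, R) matter. After this truncation both ends are nonnegative,
      so that squaring preserves the order, and the hypothesis of \<open>W0rad_bump\<close>
      holds.\<close>
    define a' where "a' = max a 0"
    define b' where "b' = max 0 (min b R)"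
    have b': "b'\<^sup>2 \<le> R\<^sup>2" unfolding b'_def using R_pos by (intro power_mono) auto
    show ?thesis
    proof (rule W0rad_dominated(2)[where k = "\<lambda>k r. 2 * r * bump (a'\<^sup>2) (b'\<^sup>2) k (r\<^sup>2)" and w = "\<lambda>r. 2 * R * indicator UNIV r"])
      show "rprof (\<lambda>r. 2 * R * indicator UNIV r)"
        by (rule rprof_bounded[where B = "2 * R"]) (use R_pos in auto)
      show "(\<lambda>n. 2 * r * bump (a'\<^sup>2) (b'\<^sup>2) n (r\<^sup>2)) \<longlonglongrightarrow> 2 * r * indicator {a<..<b} r" if r: "0 < r" "r < R" for r
      proof -
        have "r\<^sup>2 \<in> {a'\<^sup>2<..<b'\<^sup>2} \<longleftrightarrow> a' < r \<and> r < b'"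
        proof -
          have sq: "x\<^sup>2 < y\<^sup>2 \<longleftrightarrow> x < y" if "x \<ge> 0" "y \<ge> 0" for x y :: real
            using that power2_less_imp_less[of x y] power_strict_mono[of x y 2] by (metis zero_less_numeral)
          have "a' \<ge> 0" "b' \<ge> 0" by (auto simp: a'_def b'_def)
          then show ?thesis using r sq[of a' r] sq[of r b'] by simp
        qed
        also have "\<dots> \<longleftrightarrow> r \<in> {a<..<b}"
          using r by (auto simp: a'_def b'_def)
        finally have "indicator {a<..<b} r = (indicator {a'\<^sup>2<..<b'\<^sup>2} (r\<^sup>2) :: real)"
          by (simp add: indicator_def)
        then show ?thesis by (simp only:) (intro tendsto_intros bump_tendsto)
      qed
      show "\<bar>2 * r * bump (a'\<^sup>2) (b'\<^sup>2) n (r\<^sup>2)\<bar> \<le> 2 * R * indicator UNIV r" if "0 < r" "r < R" for n r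
        using that bump_bounds[of "a'\<^sup>2" "b'\<^sup>2" n "r\<^sup>2"] mult_mono[of r R "bump (a'\<^sup>2) (b'\<^sup>2) n (r\<^sup>2)" 1] by (simp add: abs_mult)
    qed (use W0rad_bump[OF b'] in auto)
  qed
  have E: "Int_stable (range (\<lambda>(a, b). {a<..<b :: real}))" "range (\<lambda>(a, b). {a<..<b :: real}) \<subseteq> Pow UNIV"
    by (auto simp: Int_stable_def)
  have E2: "sigma_sets UNIV (range (\<lambda>(a, b). {a<..<b :: real})) = sets borel"
  proof -
    have "(\<lambda>(a, b). {a<..<b :: real}) = (\<lambda>(a, b). box a b)" by (auto simp: fun_eq_iff)
    then show ?thesis by (simp only: borel_eq_box[where 'a = real] sets_measure_of subset_UNIV Pow_UNIV)
  qed
  from assms have "A \<in> sigma_sets UNIV (range (\<lambda>(a, b). {a<..<b :: real}))" by (simp add: E2)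
  from E this show "W0rad (\<lambda>r. 2 * r * indicator A r)"
  proof (induct rule: sigma_sets_induct_disjoint)
    case (basic A)
    then show ?case using int by auto
  next
    case empty
    then show ?case using int[of 0 0] by simp
  next
    case (compl A)
    then have [measurable]: "A \<in> sets borel" by (simp add: E2)
    \<comment> \<open>The interval (-1, R + 1) stands in for the whole line, with which it agrees at
      all radii that count.\<close>
    have w: "W0rad (\<lambda>r. 1 * (2 * r * indicator {-1<..<R + 1} r) + (-1) * (2 * r * indicator A r))"
      by (rule W0rad_lincomb) (use rp int compl in auto)
    have k: "rprof (\<lambda>r. 1 * (2 * r * indicator {-1<..<R + 1} r) + (-1) * (2 * r * indicator A r))"
      by (rule rprof_lincomb[OF rp rp]) auto
    show ?case
      by (rule W0rad_cong[OF rp[of "UNIV - A"] k w]) (simp_all add: indicator_def)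
  next
    case (union A)
    then have [measurable]: "A i \<in> sets borel" for i by (auto simp: E2)
    have fin: "W0rad (\<lambda>r. 2 * r * indicator (\<Union>i<n. A i) r)" for n
    proof (induct n)
      case 0
      then show ?case using int[of 0 0] by simp
    next
      case (Suc n)
      have "W0rad (\<lambda>r. 1 * (2 * r * indicator (\<Union>i<n. A i) r) + 1 * (2 * r * indicator (A n) r))"
        by (rule W0rad_lincomb) (use rp union Suc in auto)
      moreover have "(\<lambda>r. 1 * (2 * r * indicator (\<Union>i<n. A i) r) + 1 * (2 * r * indicator (A n) r)) = (\<lambda>r. 2 * r * indicator (\<Union>i<Suc n. A i) r)"
      proof
        fix r
        have "r \<in> A n \<Longrightarrow> i < n \<Longrightarrow> r \<notin> A i" for i
          using disjoint_family_onD[OF union(1), of i n] by auto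
        then show "1 * (2 * r * indicator (\<Union>i<n. A i) r) + 1 * (2 * r * indicator (A n) r) = 2 * r * indicator (\<Union>i<Suc n. A i) r"
          by (auto simp: indicator_def less_Suc_eq)
      qed
      ultimately show ?case by simp
    qed
    show ?case
    proof (rule W0rad_dominated(2)[where k = "\<lambda>n r. 2 * r * indicator (\<Union>i<n. A i) r" and w = "\<lambda>r. 2 * R * indicator UNIV r"])
      show "rprof (\<lambda>r. 2 * R * indicator UNIV r)"
        by (rule rprof_bounded[where B = "2 * R"]) (use R_pos in auto)
      show "(\<lambda>n. 2 * r * indicator (\<Union>i<n. A i) r) \<longlonglongrightarrow> 2 * r * indicator (\<Union> (range A)) r" for r
      proof -
        have "(\<Union>n. \<Union>i<n. A i) = (\<Union>i. A i)" by auto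
        moreover have "incseq (\<lambda>n. \<Union>i<n. A i)" by (force simp: incseq_def)
        ultimately have "(\<lambda>n. indicator (\<Union>i<n. A i) r :: real) \<longlonglongrightarrow> indicator (\<Union>i. A i) r"
          using LIMSEQ_indicator_incseq[of "\<lambda>n. \<Union>i<n. A i" r] by simp
        then show ?thesis by (intro tendsto_mult_left)
      qed
      show "\<bar>2 * r * indicator (\<Union>i<n. A i) r\<bar> \<le> 2 * R * indicator UNIV r" if "0 < r" "r < R" for n r
        using that by (auto simp: indicator_def)
    qed (use rp fin in auto)
  qed
qed

lemma W0rad_simple:
  assumes F: "simple_function borel F"
  shows "rprof (\<lambda>r. 2 * r * F r) \<and> W0rad (\<lambda>r. 2 * r * F r)"
proof -
  have fin: "finite (range F)" and m: "F -` {y} \<in> sets borel" for y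
    using F by (auto simp: simple_function_def) (metis simple_functionD(2) space_borel inf_top.right_neutral F)
  have "rprof (\<lambda>r. 2 * r * (\<Sum>y\<in>Y. y * indicator (F -` {y}) r)) \<and> W0rad (\<lambda>r. 2 * r * (\<Sum>y\<in>Y. y * indicator (F -` {y}) r))"
    if "finite Y" for Y
    using that
  proof induct
    case empty
    have "(\<lambda>r. 2 * r * indicator {} r) = (\<lambda>r::real. 0::real)" by auto
    then show ?case using W0rad_indicator[of "{}"] by simp
  next
    case (insert y Y)
    have "(\<lambda>r. 2 * r * (\<Sum>y\<in>insert y Y. y * indicator (F -` {y}) r)) = (\<lambda>r. y * (2 * r * indicator (F -` {y}) r) + 1 * (2 * r * (\<Sum>y\<in>Y. y * indicator (F -` {y}) r)))"
      by (simp only: sum.insert[OF insert.hyps(1,2)] distrib_left mult_1_left mult_ac)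
    then show ?case
      using rprof_lincomb[OF W0rad_indicator(1)[OF m] conjunct1[OF insert.hyps(3)], of y y 1]
        W0rad_lincomb[OF W0rad_indicator[OF m] conjunct1[OF insert.hyps(3)] conjunct2[OF insert.hyps(3)], of y y 1]
      by (simp only:)
  qed
  from this[OF fin] have "rprof (\<lambda>r. 2 * r * (\<Sum>y\<in>range F. y * indicator (F -` {y}) r)) \<and> W0rad (\<lambda>r. 2 * r * (\<Sum>y\<in>range F. y * indicator (F -` {y}) r))" .
  moreover have "(\<Sum>y\<in>range F. y * indicator (F -` {y}) r) = F r" for r
  proof -
    have "(\<Sum>y\<in>range F. y * indicator (F -` {y}) r) = (\<Sum>y\<in>{F r}. y * indicator (F -` {y}) r)"
      using fin by (intro sum.mono_neutral_right) auto
    then show ?thesis by simp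
  qed
  ultimately show ?thesis by simp
qed

text \<open>No continuity of \<open>h\<close> is asked for. Hence the profile found on almost any
  ray, and any measurable modification of it that keeps the p-th power integrable, yields a
  legitimate competitor.\<close>

lemma W0rad_rprof:
  assumes h: "rprof h"
  shows "W0rad h"
proof -
  have [measurable]: "h \<in> borel_measurable borel" using h by (rule rprof_measurable)
  \<comment> \<open>Dividing by 2 r matches the factor in \<open>W0rad_simple\<close>. The simple
    functions are at most twice the quotient in modulus, which gives the majorant 2 |h|.\<close>
  have "(\<lambda>r. h r / (2 * r)) \<in> borel_measurable borel" by measurable
  from borel_measurable_implies_sequence_metric[OF this, of 0]
  obtain F where F: "\<And>i. simple_function borel (F i)" "\<And>r. (\<lambda>i. F i r) \<longlonglongrightarrow> h r / (2 * r)" "\<And>i r. \<bar>F i r\<bar> \<le> 2 * \<bar>h r / (2 * r)\<bar>"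
    by (auto simp: dist_real_def)
  show ?thesis
  proof (rule W0rad_dominated(2)[where k = "\<lambda>i r. 2 * r * F i r" and w = "\<lambda>r. 2 * \<bar>h r\<bar>"])
    have "rprof (\<lambda>r. 2 * h r + 0 * h r)" using h h by (rule rprof_lincomb)
    moreover have "Np (radM TYPE('n) R) p (\<lambda>r. 2 * \<bar>h r\<bar>) = Np (radM TYPE('n) R) p (\<lambda>r. 2 * h r + 0 * h r)"
      by (simp add: Np_def abs_mult)
    ultimately show "rprof (\<lambda>r. 2 * \<bar>h r\<bar>)"
      by (simp add: rprof_def)
    show "(\<lambda>i. 2 * r * F i r) \<longlonglongrightarrow> h r" if "0 < r" "r < R" for r
      using tendsto_mult_left[OF F(2), of "2 * r" r] that by simp
    show "\<bar>2 * r * F i r\<bar> \<le> 2 * \<bar>h r\<bar>" if "0 < r" "r < R" for i r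
      using mult_left_mono[OF F(3)[of i r], of "2 * r"] that by (simp add: abs_mult)
  qed (use W0rad_simple[OF F(1)] in auto)
qed

section \<open>Restriction to rays\<close>

lemma test_function_ray:
  assumes \<phi>: "\<phi> \<in> tst" and \<theta>: "norm \<theta> = 1" and r: "0 \<le> r" "r < R"
  shows "\<phi> (r *\<^sub>R \<theta>) = wint R (\<lambda>s. - (grad \<phi> (s *\<^sub>R \<theta>) \<bullet> \<theta>)) r"
proof -
  have d: "((\<lambda>s. \<phi> (s *\<^sub>R \<theta>)) has_vector_derivative (grad \<phi> (s *\<^sub>R \<theta>) \<bullet> \<theta>)) (at s)" for s
    unfolding has_vector_derivative_def
    by (rule has_derivative_eq_rhs[OF has_derivative_compose[OF _ has_derivative_grad[OF test_functions_differentiable[OF \<phi>]]]])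
      (auto intro!: derivative_eq_intros)
  have "(LBINT s=ereal r..ereal R. - (grad \<phi> (s *\<^sub>R \<theta>) \<bullet> \<theta>)) = (- \<phi> (R *\<^sub>R \<theta>)) - (- \<phi> (r *\<^sub>R \<theta>))"
  proof (rule interval_integral_FTC_finite)
    show "continuous_on {min r R..max r R} (\<lambda>s. - (grad \<phi> (s *\<^sub>R \<theta>) \<bullet> \<theta>))"
      by (intro continuous_intros continuous_on_compose2[OF test_functions_continuous(2)[OF \<phi>]]) auto
    show "((\<lambda>s. - \<phi> (s *\<^sub>R \<theta>)) has_vector_derivative - (grad \<phi> (s *\<^sub>R \<theta>) \<bullet> \<theta>)) (at s within {min r R..max r R})" for s
      by (rule has_vector_derivative_at_within) (intro has_vector_derivative_minus d)
  qed
  moreover have "\<phi> (R *\<^sub>R \<theta>) = 0"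
  proof (rule ccontr)
    assume "\<phi> (R *\<^sub>R \<theta>) \<noteq> 0"
    then have "R *\<^sub>R \<theta> \<in> ball 0 R" using test_functions_support[OF \<phi>] by blast
    then show False using \<theta> R_pos by simp
  qed
  moreover have "(LBINT s=ereal r..ereal R. - (grad \<phi> (s *\<^sub>R \<theta>) \<bullet> \<theta>)) = (LBINT s:{r<..<R}. - (grad \<phi> (s *\<^sub>R \<theta>) \<bullet> \<theta>))"
    using interval_integral_Ioo[of "ereal r" "ereal R" "\<lambda>s. - (grad \<phi> (s *\<^sub>R \<theta>) \<bullet> \<theta>)"] r by simp
  ultimately show ?thesis by (simp add: wint_def)
qed

text \<open>Test functions satisfy the fundamental theorem of calculus along each ray. In polar
  coordinates the errors of an approximating sequence are integrals over the directions of errors on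
  rays; on almost every ray these tend to 0, and the Poincare inequality passes the representation
  by \<open>wint\<close> to the limit.\<close>

lemma W0_rays:
  assumes W: "W0 u g"
  shows "AE y in sph. rprof (\<lambda>r. - (g (r *\<^sub>R sgn y) \<bullet> sgn y)) \<and>
    (AE r in (radM TYPE('n) R). u (r *\<^sub>R sgn y) = wint R (\<lambda>r. - (g (r *\<^sub>R sgn y) \<bullet> sgn y)) r)"
proof -
  have [measurable]: "u \<in> borel_measurable borel" "g \<in> borel_measurable borel"
    using W0_measurable[OF W] by auto
  \<comment> \<open>A geometric rate makes the sum of all errors integrable over the directions, so
    the whole sequence converges on almost every ray and no subsequence has to be chosen ray by
    ray.\<close>
  have "\<forall>n::nat. \<exists>\<phi>. \<phi> \<in> tst \<and> Np bal p (\<lambda>x. u x - \<phi> x) \<le> ennreal ((1/2)^n) \<and> Np bal p (\<lambda>x. g x - grad \<phi> x) \<le> ennreal ((1/2)^n)"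
  proof
    fix n :: nat
    have "(0::real) < (1/2)^n" by simp
    then show "\<exists>\<phi>. \<phi> \<in> tst \<and> Np bal p (\<lambda>x. u x - \<phi> x) \<le> ennreal ((1/2)^n) \<and> Np bal p (\<lambda>x. g x - grad \<phi> x) \<le> ennreal ((1/2)^n)"
      using W unfolding W0_def by blast
  qed
  from choice[OF this] obtain \<phi> where \<phi>: "\<And>n. \<phi> n \<in> tst" "\<And>n. Np bal p (\<lambda>x. u x - \<phi> n x) \<le> ennreal ((1/2)^n)" "\<And>n. Np bal p (\<lambda>x. g x - grad (\<phi> n) x) \<le> ennreal ((1/2)^n)"
    by blast
  have [measurable]: "\<phi> n \<in> borel_measurable borel" "grad (\<phi> n) \<in> borel_measurable borel" for n
    using test_functions_measurable[OF \<phi>(1)] by auto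
  define A where "A n y = Np (radM TYPE('n) R) p (\<lambda>r. u (r *\<^sub>R sgn y) - \<phi> n (r *\<^sub>R sgn y))" for n and y :: "real^'n"
  define B where "B n y = Np (radM TYPE('n) R) p (\<lambda>r. g (r *\<^sub>R sgn y) - grad (\<phi> n) (r *\<^sub>R sgn y))" for n and y :: "real^'n"
  interpret pair_sigma_finite sph "(radM TYPE('n) R)" by (rule pair_sigma_finite_polar)
  have [measurable]: "A n \<in> borel_measurable borel" "B n \<in> borel_measurable borel" for n
    unfolding A_def[abs_def] B_def[abs_def] Np_def by measurable
  have "(\<integral>\<^sup>+y. (\<Sum>n. A n y + B n y) \<partial>sph) = (\<Sum>n. (\<integral>\<^sup>+y. A n y + B n y \<partial>sph))"
    by (rule nn_integral_suminf) simp
  also have "\<dots> \<le> (\<Sum>n. ennreal (2 * (1/2)^n))"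
  proof (rule suminf_le)
    fix n
    have "(\<integral>\<^sup>+y. A n y + B n y \<partial>sph) = (\<integral>\<^sup>+y. A n y \<partial>sph) + (\<integral>\<^sup>+y. B n y \<partial>sph)"
      by (rule nn_integral_add) auto
    also have "\<dots> \<le> ennreal ((1/2)^n) + ennreal ((1/2)^n)"
    proof (rule add_mono)
      show "(\<integral>\<^sup>+y. A n y \<partial>sph) \<le> ennreal ((1/2)^n)"
        using \<phi>(2)[of n] by (subst (asm) Np_polar) (auto simp: A_def)
      show "(\<integral>\<^sup>+y. B n y \<partial>sph) \<le> ennreal ((1/2)^n)"
        using \<phi>(3)[of n] by (subst (asm) Np_polar) (auto simp: B_def)
    qed
    also have "\<dots> = ennreal (2 * (1/2)^n)"
      by (subst ennreal_plus[symmetric]) auto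
    finally show "(\<integral>\<^sup>+y. A n y + B n y \<partial>sph) \<le> ennreal (2 * (1/2)^n)" .
  qed auto
  also have "\<dots> < \<infinity>"
  proof -
    have "summable (\<lambda>n. 2 * (1/2::real)^n)" by (intro summable_mult summable_geometric) auto
    then have "(\<Sum>n. ennreal (2 * (1/2)^n)) = ennreal (\<Sum>n. 2 * (1/2)^n)"
      by (intro suminf_ennreal2) auto
    then show ?thesis by simp
  qed
  finally have "AE y in sph. (\<Sum>n. A n y + B n y) \<noteq> \<infinity>"
    by (intro nn_integral_PInf_AE) auto
  then show ?thesis using AE_sphM_nonzero
  proof eventually_elim
    case (elim y)
    define \<theta> where "\<theta> = sgn y"
    have \<theta>: "norm \<theta> = 1" using elim by (simp add: \<theta>_def norm_sgn)
    define h where "h r = - (g (r *\<^sub>R \<theta>) \<bullet> \<theta>)" for r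
    define k where "k n r = - (grad (\<phi> n) (r *\<^sub>R \<theta>) \<bullet> \<theta>)" for n r
    have [measurable]: "h \<in> borel_measurable borel" "k n \<in> borel_measurable borel" for n
      unfolding h_def[abs_def] k_def[abs_def] by measurable
    have lim: "(\<lambda>n. A n y + B n y) \<longlonglongrightarrow> 0"
    proof -
      have fin: "A n y + B n y \<noteq> top" for n
        using elim(1) sum_le_suminf[of "\<lambda>n. A n y + B n y" "{n}"] by (auto simp: top_unique)
      define c where "c n = enn2real (A n y + B n y)" for n
      have c: "A n y + B n y = ennreal (c n)" "c n \<ge> 0" for n
        using fin[of n] by (simp_all add: c_def ennreal_enn2real_if)
      have "summable c"
        using elim(1) unfolding c by (intro summable_suminf_not_top c(2)) auto
      then have "c \<longlonglongrightarrow> 0" by (rule summable_LIMSEQ_zero)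
      then show ?thesis unfolding c using tendsto_ennrealI by fastforce
    qed
    have rk: "rprof (k n)" for n
    proof -
      obtain C where "\<And>x. norm (grad (\<phi> n) x) \<le> C" using test_functions_bounds[OF \<phi>(1)] by blast
      then have "\<bar>k n r\<bar> \<le> C" for r
        using Cauchy_Schwarz_ineq2[of "grad (\<phi> n) (r *\<^sub>R \<theta>)" \<theta>] \<theta> by (simp add: k_def) (meson order_trans)
      then show ?thesis by (intro rprof_bounded) auto
    qed
    have hk: "Np (radM TYPE('n) R) p (\<lambda>r. h r - k n r) \<le> B n y" for n
      unfolding B_def \<theta>_def[symmetric]
    proof (rule Np_mono_AE[OF p_ge(1)], rule AE_I2)
      fix r
      have "h r - k n r = - ((g (r *\<^sub>R \<theta>) - grad (\<phi> n) (r *\<^sub>R \<theta>)) \<bullet> \<theta>)"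
        by (simp add: h_def k_def inner_diff_left)
      then show "norm (h r - k n r) \<le> norm (g (r *\<^sub>R \<theta>) - grad (\<phi> n) (r *\<^sub>R \<theta>))"
        using Cauchy_Schwarz_ineq2[of "g (r *\<^sub>R \<theta>) - grad (\<phi> n) (r *\<^sub>R \<theta>)" \<theta>] \<theta> by simp
    qed
    \<comment> \<open>Finiteness for \<open>h\<close> is inherited from the bounded function
      \<open>k n\<close>, for a single n with finite error.\<close>
    have rh: "rprof h"
    proof -
      obtain n where "A n y + B n y < 1"
        using order_tendstoD(2)[OF lim, of 1] by (auto simp: eventually_sequentially)
      moreover have "B n y \<le> A n y + B n y"
        using add_right_mono[of 0 "A n y" "B n y"] by simp
      ultimately have "B n y < 1" by (rule le_less_trans[rotated])
      then have "B n y < \<infinity>" using less_trans[OF _ ennreal_one_less_top] by simp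
      then have "Np (radM TYPE('n) R) p (\<lambda>r. h r - k n r) < \<infinity>" using hk by (rule le_less_trans[rotated])
      then show ?thesis
        using rk[of n] Np_finite_diff[of h "(radM TYPE('n) R)" "k n"] by (simp add: rprof_def)
    qed
    define K where "K = 2 powr p * R powr p"
    have K: "K \<ge> 0" "ennreal (1 + K) = 1 + ennreal K"
      by (auto simp: K_def intro: ennreal_plus[OF zero_le_one, unfolded ennreal_1])
    \<comment> \<open>The detour goes through \<open>\<phi> n\<close>, which on the ray equals
      \<open>wint R (k n)\<close>; its distance from \<open>wint R h\<close> is bounded by the
      distance of the derivatives.\<close>
    have uw: "Np (radM TYPE('n) R) p (\<lambda>r. u (r *\<^sub>R \<theta>) - wint R h r) \<le> ennreal (2 powr p) * (ennreal (1 + K) * (A n y + B n y))" for n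
    proof -
      have "Np (radM TYPE('n) R) p (\<lambda>r. \<phi> n (r *\<^sub>R \<theta>) - wint R h r) = Np (radM TYPE('n) R) p (\<lambda>r. wint R h r - wint R (k n) r)"
        unfolding Np_def
      proof (rule nn_integral_cong_AE)
        have "\<phi> n (r *\<^sub>R \<theta>) = wint R (k n) r" if "0 < r" "r < R" for r
          using test_function_ray[OF \<phi>(1) \<theta>, of r n] that by (simp add: k_def[abs_def])
        then show "AE r in (radM TYPE('n) R). ennreal (norm (\<phi> n (r *\<^sub>R \<theta>) - wint R h r) powr p) = ennreal (norm (wint R h r - wint R (k n) r) powr p)"
          by (simp add: AE_radM abs_minus_commute)
      qed
      also have "\<dots> \<le> ennreal K * Np (radM TYPE('n) R) p (\<lambda>r. h r - k n r)"
        unfolding K_def by (rule wint_diff_poincare) (use rh rk[of n] p_ge R_pos in \<open>auto simp: rprof_def\<close>)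
      also have "\<dots> \<le> ennreal K * B n y"
        by (intro mult_left_mono hk) auto
      finally have T: "Np (radM TYPE('n) R) p (\<lambda>r. \<phi> n (r *\<^sub>R \<theta>) - wint R h r) \<le> ennreal K * B n y" .
      have "A n y + ennreal K * B n y \<le> (A n y + B n y) + ennreal K * (A n y + B n y)"
      proof (rule add_mono)
        show "A n y \<le> A n y + B n y" using add_left_mono[of 0 "B n y" "A n y"] by simp
        show "ennreal K * B n y \<le> ennreal K * (A n y + B n y)"
          using add_right_mono[of 0 "A n y" "B n y"] by (intro mult_left_mono) auto
      qed
      then have AB: "A n y + ennreal K * B n y \<le> ennreal (1 + K) * (A n y + B n y)"
        by (simp only: K(2) distrib_right mult_1_left)
      have "Np (radM TYPE('n) R) p (\<lambda>r. u (r *\<^sub>R \<theta>) - wint R h r) \<le> ennreal (2 powr p) * (Np (radM TYPE('n) R) p (\<lambda>r. u (r *\<^sub>R \<theta>) - \<phi> n (r *\<^sub>R \<theta>)) + Np (radM TYPE('n) R) p (\<lambda>r. \<phi> n (r *\<^sub>R \<theta>) - wint R h r))"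
        by (rule Np_triangle[OF p_ge(1)]) auto
      also have "\<dots> \<le> ennreal (2 powr p) * (A n y + ennreal K * B n y)"
        using T by (intro mult_left_mono add_mono) (auto simp: A_def \<theta>_def)
      also have "\<dots> \<le> ennreal (2 powr p) * (ennreal (1 + K) * (A n y + B n y))"
        by (intro mult_left_mono AB) auto
      finally show ?thesis .
    qed
    have "Np (radM TYPE('n) R) p (\<lambda>r. u (r *\<^sub>R \<theta>) - wint R h r) \<le> 0"
    proof (rule LIMSEQ_le_const)
      have "(\<lambda>n. (ennreal (2 powr p) * ennreal (1 + K)) * (A n y + B n y)) \<longlonglongrightarrow> (ennreal (2 powr p) * ennreal (1 + K)) * 0"
        by (intro ennreal_tendsto_cmult lim) (simp add: ennreal_mult_less_top)
      then show "(\<lambda>n. ennreal (2 powr p) * (ennreal (1 + K) * (A n y + B n y))) \<longlonglongrightarrow> 0"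
        by (simp only: mult.assoc mult_zero_right)
    qed (use uw in blast)
    then have "AE r in (radM TYPE('n) R). u (r *\<^sub>R \<theta>) - wint R h r = 0"
      by (intro Np_eq_0) auto
    then have "AE r in (radM TYPE('n) R). u (r *\<^sub>R \<theta>) = wint R h r" by eventually_elim simp
    from rh this show ?case unfolding \<theta>_def h_def[abs_def] by (rule conjI)
  qed
qed

section \<open>The Sobolev space with zero boundary values\<close>

abbreviation lebB :: "(real^'n) measure" where "lebB \<equiv> lebesgue_on (ball 0 R)"

lemma borel_imp_lebB: "f \<in> borel_measurable borel \<Longrightarrow> f \<in> borel_measurable lebB"
  by (intro measurable_restrict_space1 measurable_completion) simp

text \<open>Elements of the spaces are only Lebesgue measurable. Borel representatives can be
  composed with polar coordinates and restricted to rays.\<close>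

lemma lebB_borel_rep_real:
  fixes f :: "real^'n \<Rightarrow> real"
  assumes "f \<in> borel_measurable lebB"
  shows "\<exists>f'\<in>borel_measurable borel. AE x in bal. f x = f' x"
proof -
  have "(\<lambda>x. if x \<in> ball 0 R then f x else 0) \<in> borel_measurable lebesgue"
    using assms borel_measurable_if_lebesgue_on[of "ball 0 R" UNIV f] by (simp add: lebesgue_on_UNIV_eq)
  from completion_ex_borel_measurable_real[OF this] obtain f' where f': "f' \<in> borel_measurable borel"
    "AE x in lborel. (if x \<in> ball 0 R then f x else 0) = f' x" by auto
  have "AE x in lborel. x \<in> ball 0 R \<longrightarrow> f x = f' x"
    using f'(2) by eventually_elim (auto split: if_splits)
  then have "AE x in bal. f x = f' x"
    unfolding AE_ballM by (subst AE_lebesgue_on_iff) auto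
  with f'(1) show ?thesis by blast
qed

lemma lebB_borel_rep_vec:
  fixes f :: "real^'n \<Rightarrow> real^'n"
  assumes "f \<in> borel_measurable lebB"
  shows "\<exists>f'\<in>borel_measurable borel. AE x in bal. f x = f' x"
proof -
  have "\<forall>i. \<exists>k. k \<in> borel_measurable borel \<and> (AE x in bal. f x $ i = k x)"
  proof
    fix i
    have "(\<lambda>x. f x $ i) \<in> borel_measurable lebB"
      using assms by (rule measurable_compose) simp
    from lebB_borel_rep_real[OF this] show "\<exists>k. k \<in> borel_measurable borel \<and> (AE x in bal. f x $ i = k x)" by blast
  qed
  from choice[OF this] obtain k where k: "\<And>i. k i \<in> borel_measurable borel" "\<And>i. AE x in bal. f x $ i = k i x" by blast
  have "AE x in bal. \<forall>i\<in>UNIV. f x $ i = k i x"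
    using k(2) by (intro AE_finite_allI) auto
  then have "AE x in bal. f x = (\<chi> i. k i x)"
    by eventually_elim (simp add: vec_eq_iff)
  moreover have "(\<lambda>x. \<chi> i. k i x) \<in> borel_measurable borel"
  proof -
    have "(\<lambda>x. \<chi> i. k i x) = (\<lambda>x. \<Sum>i\<in>UNIV. k i x *\<^sub>R axis i 1)"
      using basis_expansion[of "\<chi> i. k i x" for x] by (simp add: fun_eq_iff scalar_mult_eq_scaleR)
    also have "\<dots> \<in> borel_measurable borel"
      by (intro borel_measurable_sum borel_measurable_scaleR k(1) borel_measurable_const)
    finally show ?thesis .
  qed
  ultimately show ?thesis by (rule bexI)
qed

lemma integrable_set_integrable:
  fixes f :: "real^'n \<Rightarrow> 'b::euclidean_space"
  assumes "integrable lebB f" "compact K" "K \<subseteq> ball 0 R"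
  shows "f absolutely_integrable_on K"
proof -
  have "integrable lebesgue (\<lambda>x. indicator (ball 0 R) x *\<^sub>R f x)"
    using assms(1) by (simp add: integrable_restrict_space)
  then have "integrable lebesgue (\<lambda>x. indicator K x *\<^sub>R (indicator (ball 0 R) x *\<^sub>R f x))"
    by (rule integrable_mult_indicator[rotated]) (use assms(2) in \<open>simp add: compact_imp_closed\<close>)
  also have "(\<lambda>x. indicator K x *\<^sub>R (indicator (ball 0 R) x *\<^sub>R f x)) = (\<lambda>x. indicator K x *\<^sub>R f x)"
    using assms(3) by (auto simp: fun_eq_iff indicator_def)
  finally show ?thesis by (simp add: set_integrable_def)
qed

lemma integrable_lebB_cong:
  fixes f :: "real^'n \<Rightarrow> 'b::euclidean_space"
  assumes "integrable bal f" "h \<in> borel_measurable lebB" "AE x in bal. h x = f x" "f \<in> borel_measurable borel"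
  shows "integrable lebB h" "(LINT x|lebB. h x) = (LINT x|bal. f x)"
proof -
  have f: "integrable lebB f" using assms by (simp add: integrable_ballM)
  have ae: "AE x in lebB. f x = h x" using assms(3) unfolding AE_ballM by eventually_elim simp
  show "integrable lebB h" using f assms(2) ae by (rule integrable_cong_AE_imp)
  have "(LINT x|lebB. h x) = (LINT x|lebB. f x)"
    using assms(2,3) borel_imp_lebB[OF assms(4)] unfolding AE_ballM by (intro integral_cong_AE) auto
  then show "(LINT x|lebB. h x) = (LINT x|bal. f x)" using assms(4) by (simp add: integral_ballM)
qed

text \<open>A weak gradient, in particular the one selected by \<open>wgrad\<close>, is by
  definition only locally integrable. The closed balls of radius R - 1/(n + 1) exhaust the open
  ball, and measurability passes to the limit.\<close>

lemma weak_gradient_measurable: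
  assumes "weak_gradient (ball 0 R) v h"
  shows "h \<in> borel_measurable lebB"
proof -
  have m: "(\<lambda>x. indicator (cball 0 (R - 1 / real (Suc n))) x *\<^sub>R h x) \<in> borel_measurable lebesgue" for n
  proof -
    have sub: "cball 0 (R - 1 / real (Suc n)) \<subseteq> (ball 0 R :: (real^'n) set)"
    proof
      fix x :: "real^'n" assume "x \<in> cball 0 (R - 1 / real (Suc n))"
      moreover have "1 / real (Suc n) > 0" by simp
      ultimately show "x \<in> ball 0 R" by (simp only: mem_cball mem_ball)
    qed
    note loc = assms[unfolded weak_gradient_def locally_integrable_on_def, THEN conjunct2, THEN conjunct1]
    have "h absolutely_integrable_on cball 0 (R - 1 / real (Suc n))"
      by (rule loc[rule_format, OF conjI[OF compact_cball sub]])
    then show ?thesis unfolding set_integrable_def by (rule borel_measurable_integrable)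
  qed
  have "(\<lambda>x. if x \<in> ball 0 R then h x else 0) \<in> borel_measurable lebesgue"
  proof (rule borel_measurable_LIMSEQ_metric[OF m])
    fix x :: "real^'n"
    show "(\<lambda>n. indicator (cball 0 (R - 1 / real (Suc n))) x *\<^sub>R h x) \<longlonglongrightarrow> (if x \<in> ball 0 R then h x else 0)"
    proof (cases "norm x < R")
      case True
      then have "0 < R - norm x" by simp
      then obtain k where k: "inverse (real (Suc k)) < R - norm x" by (rule reals_Archimedean[THEN exE])
      have "indicator (cball 0 (R - 1 / real (Suc n))) x *\<^sub>R h x = h x" if "n \<ge> k" for n
      proof -
        have "1 / real (Suc n) \<le> 1 / real (Suc k)" using that by (intro divide_left_mono) auto
        then have "norm x \<le> R - 1 / real (Suc n)" using k by (simp only: inverse_eq_divide)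
        then show ?thesis by simp
      qed
      then have "eventually (\<lambda>n. indicator (cball 0 (R - 1 / real (Suc n))) x *\<^sub>R h x = h x) sequentially"
        unfolding eventually_sequentially by blast
      then have "(\<lambda>n. indicator (cball 0 (R - 1 / real (Suc n))) x *\<^sub>R h x) \<longlonglongrightarrow> h x"
        by (rule tendsto_eventually)
      then show ?thesis using True by (simp only: mem_ball dist_0_norm if_True)
    next
      case False
      have "indicator (cball 0 (R - 1 / real (Suc n))) x *\<^sub>R h x = 0" for n
      proof -
        have "1 / real (Suc n) > 0" by simp
        then have "\<not> norm x \<le> R - 1 / real (Suc n)" using False by linarith
        then show ?thesis by simp
      qed
      then show ?thesis using False by (simp only: mem_ball dist_0_norm if_False tendsto_const)
    qed
  qed
  then show ?thesis using borel_measurable_if_lebesgue_on[of "ball 0 R" UNIV h] by (simp add: lebesgue_on_UNIV_eq)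
qed

lemma weak_gradientI:
  assumes [measurable]: "u \<in> borel_measurable borel" "g \<in> borel_measurable borel" and int: "integrable bal u" "integrable bal g"
    and eq: "\<And>\<psi> i. \<psi> \<in> tst \<Longrightarrow> (LINT x|bal. u x * partial_deriv i \<psi> x) = - (LINT x|bal. g x $ i * \<psi> x)"
    and v: "v \<in> borel_measurable lebB" "AE x in bal. v x = u x"
    and h: "h \<in> borel_measurable lebB" "AE x in bal. h x = g x"
  shows "weak_gradient (ball 0 R) v h"
  unfolding weak_gradient_def locally_integrable_on_def
proof (intro conjI allI impI ballI)
  show "v absolutely_integrable_on K" "h absolutely_integrable_on K" if "compact K \<and> K \<subseteq> ball 0 R" for K
    using that integrable_lebB_cong(1)[OF int(1) v] integrable_lebB_cong(1)[OF int(2) h] by (auto intro: integrable_set_integrable)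
  fix \<psi> :: "real^'n \<Rightarrow> real" and i :: 'n assume \<psi>: "\<psi> \<in> tst"
  obtain B where B: "\<And>x. \<bar>\<psi> x\<bar> \<le> B" "\<And>x. norm (grad \<psi> x) \<le> B"
    using test_functions_bounds[OF \<psi>] by blast
  have B': "\<bar>partial_deriv i \<psi> x\<bar> \<le> B" for x
    using component_le_norm_cart[of "grad \<psi> x" i] B(2)[of x] by simp
  note pm [measurable] = test_functions_measurable[OF \<psi>]
  have "integrable bal (\<lambda>x. u x * partial_deriv i \<psi> x)"
    by (rule integrable_mult_bounded[OF int(1) _ B']) simp
  then have 1: "(LINT x|lebB. v x * partial_deriv i \<psi> x) = (LINT x|bal. u x * partial_deriv i \<psi> x)"
    by (rule integrable_lebB_cong(2)) (use v borel_imp_lebB[OF pm(3)] in \<open>auto elim!: eventually_mono\<close>)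
  have "integrable bal (\<lambda>x. g x $ i * \<psi> x)"
    by (rule integrable_mult_bounded[OF integrable_bounded_linear[OF bounded_linear_vec_nth int(2)] _ B(1)]) simp
  moreover have "(\<lambda>x. h x $ i) \<in> borel_measurable lebB"
    using h(1) by (rule measurable_compose) simp
  ultimately have 2: "(LINT x|lebB. h x $ i * \<psi> x) = (LINT x|bal. g x $ i * \<psi> x)"
    using h(2) borel_imp_lebB[OF pm(1)] by (intro integrable_lebB_cong(2)) (auto elim!: eventually_mono)
  show "(LINT x|lebB. v x * partial_deriv i \<psi> x) = - (LINT x|lebB. h x $ i * \<psi> x)"
    unfolding 1 2 by (rule eq[OF \<psi>])
qed

text \<open>The weak gradient at hand shows that the choice in \<open>wgrad\<close> succeeds, and
  uniqueness identifies the result almost everywhere.\<close>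

lemma wgrad_eq:
  assumes um: "u \<in> borel_measurable borel" "g \<in> borel_measurable borel" and int: "integrable bal u" "integrable bal g"
    and eq: "\<And>\<psi> i. \<psi> \<in> tst \<Longrightarrow> (LINT x|bal. u x * partial_deriv i \<psi> x) = - (LINT x|bal. g x $ i * \<psi> x)"
    and v: "v \<in> borel_measurable lebB" "AE x in bal. v x = u x"
  shows "AE x in bal. wgrad (ball 0 R) v x = g x"
proof -
  have w: "weak_gradient (ball 0 R) v g"
    by (rule weak_gradientI[OF um int eq v borel_imp_lebB[OF um(2)]]) auto
  then have "weak_gradient (ball 0 R) v (wgrad (ball 0 R) v)"
    unfolding wgrad_def by (rule someI[of "weak_gradient (ball 0 R) v"])
  then show ?thesis
    unfolding AE_ballM by (rule weak_gradient_unique[OF open_ball _ w]) simp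
qed

lemma W0_tst_weak: "W0 u g \<Longrightarrow> \<psi> \<in> tst \<Longrightarrow> (LINT x|bal. u x * partial_deriv i \<psi> x) = - (LINT x|bal. g x $ i * \<psi> x)"
  using test_functions_mono[of "ball 0 R" UNIV] by (intro W0_weak) auto

lemma W0_wgrad:
  assumes W: "W0 u g" and v: "v \<in> borel_measurable lebB" "AE x in bal. v x = u x"
  shows "AE x in bal. wgrad (ball 0 R) v x = g x"
  by (rule wgrad_eq[OF W0_measurable[OF W] W0_integrable[OF W] W0_tst_weak[OF W] v])

lemma Np_eq_integral:
  fixes f :: "real^'n \<Rightarrow> 'b::euclidean_space"
  assumes f: "f \<in> borel_measurable borel" "Np bal p f < \<infinity>" and h: "AE x in bal. h x = f x" "h \<in> borel_measurable lebB"
  shows "integrable lebB (\<lambda>x. norm (h x) powr p)" "Np bal p f = ennreal (LINT x|lebB. norm (h x) powr p)"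
proof -
  have i: "integrable bal (\<lambda>x. norm (f x) powr p)"
    by (rule Np_integrable_powr) (use f in auto)
  have m: "(\<lambda>x. norm (h x) powr p) \<in> borel_measurable lebB"
    using h(2) by measurable
  have ae: "AE x in bal. norm (h x) powr p = norm (f x) powr p"
    using h(1) by eventually_elim simp
  have fm: "(\<lambda>x. norm (f x) powr p) \<in> borel_measurable borel" using f(1) by measurable
  show "integrable lebB (\<lambda>x. norm (h x) powr p)"
    by (rule integrable_lebB_cong(1)[OF i m ae fm])
  show "Np bal p f = ennreal (LINT x|lebB. norm (h x) powr p)"
    unfolding Np_def integrable_lebB_cong(2)[OF i m ae fm] by (rule nn_integral_eq_integral[OF i]) simp
qed

lemma W0_in_W1p_0:
  assumes W: "W0 u g" and v: "v \<in> borel_measurable lebB" "AE x in bal. v x = u x"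
  shows "v \<in> W1p_0 (ball 0 R) p"
proof -
  note um = W0_measurable[OF W]
  have gm: "g \<in> borel_measurable lebB" by (rule borel_imp_lebB[OF um(2)])
  have wg: "weak_gradient (ball 0 R) v g"
    by (rule weak_gradientI[OF um W0_integrable[OF W] W0_tst_weak[OF W] v gm]) auto
  have vL: "v \<in> Lp_space (ball 0 R) p"
    using v(1) Np_eq_integral(1)[OF um(1) W0_Np_finite(1)[OF W] v(2,1)] by (simp add: Lp_space_def)
  have gL: "g \<in> Lp_space (ball 0 R) p"
    using gm Np_eq_integral(1)[OF um(2) W0_Np_finite(2)[OF W] _ gm] by (simp add: Lp_space_def)
  have "\<exists>\<phi>\<in>tst. W1p_norm (ball 0 R) p (\<lambda>x. v x - \<phi> x) < \<epsilon>" if \<epsilon>: "\<epsilon> > 0" for \<epsilon>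
  proof -
    \<comment> \<open>Two terms of size at most \<open>d\<close> add up to at most
      \<open>(\<epsilon> / 2) powr p\<close>; the half makes the final inequality strict.\<close>
    define d where "d = (\<epsilon> / 2) powr p / 2"
    have d: "d > 0" using \<epsilon> by (simp add: d_def)
    obtain \<phi> where \<phi>: "\<phi> \<in> tst" "Np bal p (\<lambda>x. u x - \<phi> x) \<le> ennreal d" "Np bal p (\<lambda>x. g x - grad \<phi> x) \<le> ennreal d"
      using W d unfolding W0_def by meson
    note pm = test_functions_measurable[OF \<phi>(1)]
    have W': "W0 (\<lambda>x. u x - \<phi> x) (\<lambda>x. g x - grad \<phi> x)"
      using W0_lincomb[OF W W0_test[OF \<phi>(1)], of 1 "-1"] by simp
    have v': "(\<lambda>x. v x - \<phi> x) \<in> borel_measurable lebB" "AE x in bal. v x - \<phi> x = u x - \<phi> x"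
      using v borel_imp_lebB[OF pm(1)] by (auto elim: eventually_mono)
    have wae: "AE x in bal. wgrad (ball 0 R) (\<lambda>x. v x - \<phi> x) x = g x - grad \<phi> x"
      by (rule W0_wgrad[OF W' v'])
    have g'm: "(\<lambda>x. g x - grad \<phi> x) \<in> borel_measurable lebB"
      using gm borel_imp_lebB[OF pm(2)] by simp
    have "ennreal (LINT x|lebB. norm (v x - \<phi> x) powr p) \<le> ennreal d"
      using \<phi>(2) Np_eq_integral(2)[OF W0_measurable(1)[OF W'] W0_Np_finite(1)[OF W'] v'(2,1)] by simp
    then have 1: "(LINT x|lebB. norm (v x - \<phi> x) powr p) \<le> d" using d by simp
    have "ennreal (LINT x|lebB. norm (g x - grad \<phi> x) powr p) \<le> ennreal d"
      using \<phi>(3) Np_eq_integral(2)[OF W0_measurable(2)[OF W'] W0_Np_finite(2)[OF W'] _ g'm] by simp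
    then have 2: "(LINT x|lebB. norm (g x - grad \<phi> x) powr p) \<le> d" using d by simp
    \<comment> \<open>If the integrand is not integrable, its Bochner integral is 0 and the bound is
      trivial.\<close>
    have 3: "(LINT x|lebB. norm (wgrad (ball 0 R) (\<lambda>x. v x - \<phi> x) x) powr p) \<le> d"
    proof (cases "integrable lebB (\<lambda>x. norm (wgrad (ball 0 R) (\<lambda>x. v x - \<phi> x) x) powr p)")
      case True
      have "(LINT x|lebB. norm (wgrad (ball 0 R) (\<lambda>x. v x - \<phi> x) x) powr p) = (LINT x|lebB. norm (g x - grad \<phi> x) powr p)"
      proof (rule integral_cong_AE)
        show "AE x in lebB. norm (wgrad (ball 0 R) (\<lambda>x. v x - \<phi> x) x) powr p = norm (g x - grad \<phi> x) powr p"
          using wae unfolding AE_ballM by eventually_elim simp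
        show "(\<lambda>x. norm (g x - grad \<phi> x) powr p) \<in> borel_measurable lebB" using g'm by measurable
      qed (use True in \<open>rule borel_measurable_integrable\<close>)
      with 2 show ?thesis by simp
    qed (use d in \<open>simp add: not_integrable_integral_eq\<close>)
    have "W1p_norm (ball 0 R) p (\<lambda>x. v x - \<phi> x) \<le> (2 * d) powr (1 / p)"
      unfolding W1p_norm_def using 1 3 p_ge by (intro powr_mono2 add_nonneg_nonneg integral_nonneg) auto
    also have "\<dots> = \<epsilon> / 2"
      using \<epsilon> p_ge by (simp add: d_def powr_powr)
    also have "\<dots> < \<epsilon>" using \<epsilon> by simp
    finally show ?thesis using \<phi>(1) by blast
  qed
  then show ?thesis
    using vL gL wg by (auto simp: W1p_0_def W1p_def)
qed

lemma weak_gradient_balD: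
  assumes wg: "weak_gradient (ball 0 R) v \<gamma>" and \<psi>: "\<psi> \<in> tst"
    and u: "u \<in> borel_measurable borel" "integrable bal u" "AE x in bal. v x = u x" "v \<in> borel_measurable lebB"
    and g: "g \<in> borel_measurable borel" "integrable bal g" "AE x in bal. \<gamma> x = g x" "\<gamma> \<in> borel_measurable lebB"
  shows "(LINT x|bal. u x * partial_deriv i \<psi> x) = - (LINT x|bal. g x $ i * \<psi> x)"
proof -
  obtain B where B: "\<And>x. \<bar>\<psi> x\<bar> \<le> B" "\<And>x. norm (grad \<psi> x) \<le> B"
    using test_functions_bounds[OF \<psi>] by blast
  have B': "\<bar>partial_deriv i \<psi> x\<bar> \<le> B" for x
    using component_le_norm_cart[of "grad \<psi> x" i] B(2)[of x] by simp
  note [measurable] = u(1) g(1)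
  note pm [measurable] = test_functions_measurable[OF \<psi>]
  have "integrable bal (\<lambda>x. u x * partial_deriv i \<psi> x)"
    by (rule integrable_mult_bounded[OF u(2) _ B']) simp
  then have 1: "(LINT x|lebB. v x * partial_deriv i \<psi> x) = (LINT x|bal. u x * partial_deriv i \<psi> x)"
    by (rule integrable_lebB_cong(2)) (use u borel_imp_lebB[OF pm(3)] in \<open>auto elim!: eventually_mono\<close>)
  have "integrable bal (\<lambda>x. g x $ i * \<psi> x)"
    by (rule integrable_mult_bounded[OF integrable_bounded_linear[OF bounded_linear_vec_nth g(2)] _ B(1)]) simp
  moreover have "(\<lambda>x. \<gamma> x $ i) \<in> borel_measurable lebB"
    using g(4) by (rule measurable_compose) simp
  ultimately have 2: "(LINT x|lebB. \<gamma> x $ i * \<psi> x) = (LINT x|bal. g x $ i * \<psi> x)"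
    using g(3) borel_imp_lebB[OF pm(1)] by (intro integrable_lebB_cong(2)) (auto elim!: eventually_mono)
  show ?thesis
    using wg \<psi> unfolding 1[symmetric] 2[symmetric] by (simp only: weak_gradient_def)
qed

lemma Lp_space_Np:
  fixes v :: "real^'n \<Rightarrow> 'b::euclidean_space"
  assumes v: "v \<in> Lp_space (ball 0 R) p" and u: "u \<in> borel_measurable borel" "AE x in bal. v x = u x"
  shows "Np bal p u < \<infinity>"
proof -
  note [measurable] = u(1)
  have "Np bal p u = (\<integral>\<^sup>+x. ennreal (norm (u x) powr p) \<partial>lebB)"
    unfolding Np_def by (rule nn_integral_ballM) simp
  also have "\<dots> = (\<integral>\<^sup>+x. ennreal (norm (norm (v x) powr p)) \<partial>lebB)"
    using u(2) unfolding AE_ballM by (intro nn_integral_cong_AE) (auto elim!: eventually_mono)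
  also have "\<dots> < \<infinity>" using v unfolding Lp_space_def by (simp add: integrable_iff_bounded)
  finally show ?thesis .
qed

text \<open>One weak gradient of \<open>v\<close> serves for all error bounds: the selected gradient
  of \<open>v - \<phi>\<close> agrees almost everywhere with its difference from
  \<open>grad \<phi>\<close>, so a small \<open>W1p_norm\<close> means that both terms are
  small.\<close>

lemma W1p_0_imp_W0:
  assumes v: "v \<in> W1p_0 (ball 0 R) p"
  obtains u g where "W0 u g" "AE x in bal. v x = u x"
proof -
  have vL: "v \<in> Lp_space (ball 0 R) p" using v by (auto simp: W1p_0_def W1p_def)
  then have vm: "v \<in> borel_measurable lebB" by (simp add: Lp_space_def)
  obtain \<gamma> where \<gamma>: "\<gamma> \<in> Lp_space (ball 0 R) p" "weak_gradient (ball 0 R) v \<gamma>"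
    using v by (auto simp: W1p_0_def W1p_def)
  have \<gamma>m: "\<gamma> \<in> borel_measurable lebB" using \<gamma>(1) by (simp add: Lp_space_def)
  obtain u where u: "u \<in> borel_measurable borel" "AE x in bal. v x = u x"
    using lebB_borel_rep_real[OF vm] by blast
  obtain g where g: "g \<in> borel_measurable borel" "AE x in bal. \<gamma> x = g x"
    using lebB_borel_rep_vec[OF \<gamma>m] by blast
  have fin: "Np bal p u < \<infinity>" "Np bal p g < \<infinity>"
    using Lp_space_Np[OF vL u] Lp_space_Np[OF \<gamma>(1) g] by auto
  have int: "integrable bal u" "integrable bal g"
    using u g fin p_ge by (auto intro!: Np_integrable[where p = p] finite_measure_ballM)
  have weak: "(LINT x|bal. u x * partial_deriv i \<psi> x) = - (LINT x|bal. g x $ i * \<psi> x)" if "\<psi> \<in> tst" for \<psi> i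
    by (rule weak_gradient_balD[OF \<gamma>(2) that u(1) int(1) u(2) vm g(1) int(2) g(2) \<gamma>m])
  have "W0 u g"
    unfolding W0_def
  proof (intro conjI allI impI u g)
    fix e :: real assume "e > 0"
    then have "e powr (1 / p) > 0" by simp
    then obtain \<phi> where \<phi>: "\<phi> \<in> tst" "W1p_norm (ball 0 R) p (\<lambda>x. v x - \<phi> x) < e powr (1 / p)"
      using v unfolding W1p_0_def by (simp only: mem_Collect_eq) meson
    note pm = test_functions_measurable[OF \<phi>(1)]
    note \<phi>i = W0_integrable[OF W0_test[OF \<phi>(1)]]
    have um': "(\<lambda>x. u x - \<phi> x) \<in> borel_measurable borel" "(\<lambda>x. g x - grad \<phi> x) \<in> borel_measurable borel"
      using u(1) g(1) pm by auto
    have int': "integrable bal (\<lambda>x. u x - \<phi> x)" "integrable bal (\<lambda>x. g x - grad \<phi> x)"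
      using int \<phi>i by auto
    have fin': "Np bal p (\<lambda>x. u x - \<phi> x) < \<infinity>" "Np bal p (\<lambda>x. g x - grad \<phi> x) < \<infinity>"
    proof -
      have "Np bal p (\<lambda>x. u x - \<phi> x) \<le> ennreal (2 powr p) * (Np bal p u + Np bal p (\<lambda>x. - \<phi> x))"
        using Np_add[OF p_ge(1), of u bal "\<lambda>x. - \<phi> x"] u(1) pm by simp
      also have "\<dots> < \<infinity>" using fin test_Np_finite[OF \<phi>(1)] by (simp add: Np_uminus ennreal_mult_less_top)
      finally show "Np bal p (\<lambda>x. u x - \<phi> x) < \<infinity>" .
      have "Np bal p (\<lambda>x. g x - grad \<phi> x) \<le> ennreal (2 powr p) * (Np bal p g + Np bal p (\<lambda>x. - grad \<phi> x))"
        using Np_add[OF p_ge(1), of g bal "\<lambda>x. - grad \<phi> x"] g(1) pm by simp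
      also have "\<dots> < \<infinity>" using fin test_Np_finite[OF \<phi>(1)] by (simp add: Np_uminus ennreal_mult_less_top)
      finally show "Np bal p (\<lambda>x. g x - grad \<phi> x) < \<infinity>" .
    qed
    have v': "(\<lambda>x. v x - \<phi> x) \<in> borel_measurable lebB" "AE x in bal. v x - \<phi> x = u x - \<phi> x"
      using vm u(2) borel_imp_lebB[OF pm(1)] by (auto elim: eventually_mono)
    have eq: "(LINT x|bal. (u x - \<phi> x) * partial_deriv i \<psi> x) = - (LINT x|bal. (g x - grad \<phi> x) $ i * \<psi> x)" if \<psi>: "\<psi> \<in> tst" for \<psi> i
    proof -
      obtain B where B: "\<And>x. \<bar>\<psi> x\<bar> \<le> B" "\<And>x. norm (grad \<psi> x) \<le> B"
        using test_functions_bounds[OF \<psi>] by blast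
      have B': "\<bar>partial_deriv i \<psi> x\<bar> \<le> B" for x
        using component_le_norm_cart[of "grad \<psi> x" i] B(2)[of x] by simp
      have m: "partial_deriv i \<psi> \<in> borel_measurable bal" "\<psi> \<in> borel_measurable bal"
        using test_functions_measurable[OF \<psi>] by auto
      have gi: "integrable bal (\<lambda>x. f x $ i)" if "integrable bal f" for f :: "real^'n \<Rightarrow> real^'n"
        using integrable_bounded_linear[OF bounded_linear_vec_nth that] .
      have J: "integrable bal (\<lambda>x. u x * partial_deriv i \<psi> x)" "integrable bal (\<lambda>x. \<phi> x * partial_deriv i \<psi> x)"
        "integrable bal (\<lambda>x. g x $ i * \<psi> x)" "integrable bal (\<lambda>x. grad \<phi> x $ i * \<psi> x)"
        by (rule integrable_mult_bounded[OF int(1) m(1) B'] integrable_mult_bounded[OF \<phi>i(1) m(1) B']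
          integrable_mult_bounded[OF gi[OF int(2)] m(2) B(1)] integrable_mult_bounded[OF gi[OF \<phi>i(2)] m(2) B(1)])+
      show ?thesis
        using J weak[OF \<psi>, of i] W0_tst_weak[OF W0_test[OF \<phi>(1)] \<psi>, of i] by (simp add: left_diff_distrib)
    qed
    have wae: "AE x in bal. wgrad (ball 0 R) (\<lambda>x. v x - \<phi> x) x = g x - grad \<phi> x"
      by (rule wgrad_eq[OF um' int' eq v'])
    have g'm: "(\<lambda>x. g x - grad \<phi> x) \<in> borel_measurable lebB"
      by (rule borel_imp_lebB[OF um'(2)])
    define a where "a = (LINT x|lebB. norm (v x - \<phi> x) powr p)"
    define b where "b = (LINT x|lebB. norm (g x - grad \<phi> x) powr p)"
    \<comment> \<open>In this direction the default value 0 would do harm: a non-measurable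
      \<open>wgrad\<close> would make \<open>W1p_norm\<close> deceptively small. Measurability
      ensures that the integral in the norm is the intended one.\<close>
    have wm: "wgrad (ball 0 R) (\<lambda>x. v x - \<phi> x) \<in> borel_measurable lebB"
    proof -
      have "weak_gradient (ball 0 R) (\<lambda>x. v x - \<phi> x) (\<lambda>x. g x - grad \<phi> x)"
        by (rule weak_gradientI[OF um' int' eq v' g'm]) auto
      then have "weak_gradient (ball 0 R) (\<lambda>x. v x - \<phi> x) (wgrad (ball 0 R) (\<lambda>x. v x - \<phi> x))"
        unfolding wgrad_def by (rule someI[of "weak_gradient (ball 0 R) (\<lambda>x. v x - \<phi> x)"])
      then show ?thesis by (rule weak_gradient_measurable)
    qed
    have b: "b = (LINT x|lebB. norm (wgrad (ball 0 R) (\<lambda>x. v x - \<phi> x) x) powr p)"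
      unfolding b_def
    proof (rule integral_cong_AE)
      show "AE x in lebB. norm (g x - grad \<phi> x) powr p = norm (wgrad (ball 0 R) (\<lambda>x. v x - \<phi> x) x) powr p"
        using wae unfolding AE_ballM by eventually_elim simp
    qed (use g'm wm in measurable)
    have ab: "a \<ge> 0" "b \<ge> 0" by (auto simp: a_def b_def)
    have "(a + b) powr (1 / p) < e powr (1 / p)"
      using \<phi>(2) by (simp add: W1p_norm_def a_def b)
    note * = this
    have "a + b < e"
    proof -
      show ?thesis
      proof (rule ccontr)
        assume "\<not> a + b < e"
        then have "e powr (1 / p) \<le> (a + b) powr (1 / p)" using \<open>e > 0\<close> p_ge by (intro powr_mono2) auto
        with * show False by simp
      qed
    qed
    then have "a \<le> e" "b \<le> e" using ab by auto
    moreover have "Np bal p (\<lambda>x. u x - \<phi> x) = ennreal a" unfolding a_def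
      by (rule Np_eq_integral(2)[OF um'(1) fin'(1) v'(2,1)])
    moreover have "Np bal p (\<lambda>x. g x - grad \<phi> x) = ennreal b" unfolding b_def
      by (rule Np_eq_integral(2)[OF um'(2) fin'(2) _ g'm]) simp
    ultimately show "\<exists>\<phi>\<in>tst. Np bal p (\<lambda>x. u x - \<phi> x) \<le> ennreal e \<and> Np bal p (\<lambda>x. g x - grad \<phi> x) \<le> ennreal e"
      using \<phi>(1) by (auto intro!: bexI[of _ \<phi>] ennreal_leI)
  qed
  then show ?thesis using that u(2) by blast
qed

end

section \<open>The energy\<close>

text \<open>The source of all rigidity statements: each comparison below is a pointwise inequality
  whose two integrals are forced to agree.\<close>

lemma integral_mono_eq_imp_AE:
  fixes f g :: "'a \<Rightarrow> real"
  assumes "integrable M f" "integrable M g" "integral\<^sup>L M f = integral\<^sup>L M g" "AE x in M. f x \<le> g x"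
  shows "AE x in M. f x = g x"
proof -
  have "(LINT x|M. g x - f x) = 0" using assms by simp
  then have "AE x in M. g x - f x = 0"
    by (subst (asm) integral_nonneg_eq_0_iff_AE) (use assms in auto)
  then show ?thesis by eventually_elim simp
qed

lemma ext_integral_eq:
  assumes "integrable M f"
  shows "ext_integral M f = ereal (LINT x|M. f x)"
proof -
  have fin: "(\<integral>\<^sup>+x. ennreal (f x) \<partial>M) < \<infinity>" "(\<integral>\<^sup>+x. ennreal (- f x) \<partial>M) < \<infinity>"
    using assms by (auto simp: real_integrable_def less_top)
  obtain a where a: "a \<ge> 0" "(\<integral>\<^sup>+x. ennreal (f x) \<partial>M) = ennreal a"
    using fin(1) by (metis ennreal_cases infinity_ennreal_def less_irrefl)
  obtain b where b: "b \<ge> 0" "(\<integral>\<^sup>+x. ennreal (- f x) \<partial>M) = ennreal b"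
    using fin(2) by (metis ennreal_cases infinity_ennreal_def less_irrefl)
  show ?thesis
    unfolding ext_integral_def real_lebesgue_integral_def[OF assms] a(2) b(2) using a(1) b(1)
    by (simp add: enn2ereal_ennreal)
qed

lemma ext_integral_finite_imp_integrable:
  assumes "f \<in> borel_measurable M" "(\<integral>\<^sup>+x. ennreal (- f x) \<partial>M) < \<infinity>" "ext_integral M f < \<infinity>"
  shows "integrable M f"
proof -
  obtain b where b: "b \<ge> 0" "(\<integral>\<^sup>+x. ennreal (- f x) \<partial>M) = ennreal b"
    using assms(2) by (metis ennreal_cases infinity_ennreal_def less_irrefl)
  have "(\<integral>\<^sup>+x. ennreal (f x) \<partial>M) \<noteq> top"
  proof
    assume "(\<integral>\<^sup>+x. ennreal (f x) \<partial>M) = top"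
    then have "ext_integral M f = \<infinity>"
      unfolding ext_integral_def b(2) using b(1) by (simp add: enn2ereal_ennreal)
    with assms(3) show False by simp
  qed
  then show ?thesis using assms(1,2) by (simp add: real_integrable_def less_top)
qed

locale radial_problem = ball_sobolev N R p for N :: "'n::finite itself" and R p :: real +
  fixes W :: "real^'n \<Rightarrow> real" and Wt G :: "real \<Rightarrow> real"
  assumes cW: "condition_W p W Wt" and cG: "condition_G CARD('n) p G" and Wt_mono: "mono_on {0..} Wt"
begin

lemma W_continuous: "continuous_on UNIV W" and Wt_continuous: "continuous_on UNIV Wt"
  and W_eq: "W \<xi> = Wt (norm \<xi>)" and G_continuous: "continuous_on UNIV G"
  using cW cG unfolding condition_W_def condition_G_def by blast+

lemma W_measurable [measurable]: "W \<in> borel_measurable borel" "Wt \<in> borel_measurable borel" "G \<in> borel_measurable borel"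
  by (auto intro!: borel_measurable_continuous_onI W_continuous Wt_continuous G_continuous)

lemma Wt_lower: "\<exists>\<nu> C. \<nu> > 0 \<and> C > 0 \<and> (\<forall>t\<ge>0. Wt t \<ge> \<nu> * t powr p - C)"
proof -
  obtain \<nu> C where *: "\<nu> > 0" "C > 0" "\<forall>\<xi>. W \<xi> \<ge> \<nu> * norm \<xi> powr p - C"
    using cW unfolding condition_W_def by blast
  have "Wt t \<ge> \<nu> * t powr p - C" if "t \<ge> 0" for t
  proof -
    have "norm (t *\<^sub>R axis (undefined::'n) (1::real)) = t" using that by (simp add: norm_axis_1)
    then show ?thesis using *(3)[rule_format, of "t *\<^sub>R axis (undefined::'n) 1"] by (simp add: W_eq)
  qed
  then show ?thesis using * by blast
qed

definition nu :: real where "nu = (SOME \<nu>. \<exists>C. \<nu> > 0 \<and> C > 0 \<and> (\<forall>t\<ge>0. Wt t \<ge> \<nu> * t powr p - C))"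
definition CW :: real where "CW = (SOME C. nu > 0 \<and> C > 0 \<and> (\<forall>t\<ge>0. Wt t \<ge> nu * t powr p - C))"

lemma nu_CW: "nu > 0" "CW > 0" "t \<ge> 0 \<Longrightarrow> Wt t \<ge> nu * t powr p - CW"
proof -
  have "\<exists>C. nu > 0 \<and> C > 0 \<and> (\<forall>t\<ge>0. Wt t \<ge> nu * t powr p - C)"
    unfolding nu_def using Wt_lower by (rule someI_ex)
  then have "nu > 0 \<and> CW > 0 \<and> (\<forall>t\<ge>0. Wt t \<ge> nu * t powr p - CW)"
    unfolding CW_def by (rule someI_ex)
  then show "nu > 0" "CW > 0" "t \<ge> 0 \<Longrightarrow> Wt t \<ge> nu * t powr p - CW" by auto
qed

lemma Wt_ge: "t \<ge> 0 \<Longrightarrow> Wt t \<ge> - CW"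
  using nu_CW(3)[of t] nu_CW(1) by (smt (verit) mult_nonneg_nonneg powr_ge_zero)

text \<open>The exponent p - \<rho> lies in [0, p), so its power is at most
  \<open>1 + \<bar>\<mu>\<bar> powr p\<close>. Thus \<open>G (u x)\<close> has an integrable
  minorant as soon as the p-th power of \<open>u\<close> is integrable over a finite
  measure.\<close>

lemma G_lower: "\<exists>K\<ge>0. \<forall>\<mu>. G \<mu> \<ge> - K * (1 + \<bar>\<mu>\<bar> powr p)"
proof -
  obtain C \<nu>3 \<rho> where *: "C \<ge> 0" "\<nu>3 \<ge> 0" "0 < \<rho>" "\<rho> \<le> p" "\<forall>\<mu>. G \<mu> \<ge> - \<nu>3 * \<bar>\<mu>\<bar> powr (p - \<rho>) - C"
    using cG unfolding condition_G_def by blast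
  have "G \<mu> \<ge> - (\<nu>3 + C) * (1 + \<bar>\<mu>\<bar> powr p)" for \<mu>
  proof -
    have 1: "\<bar>\<mu>\<bar> powr (p - \<rho>) \<le> 1 + \<bar>\<mu>\<bar> powr p"
    proof (cases "\<bar>\<mu>\<bar> \<le> 1")
      case True
      then have "\<bar>\<mu>\<bar> powr (p - \<rho>) \<le> 1" using * by (intro powr_le1) auto
      then show ?thesis by (simp add: add_increasing2)
    next
      case False
      then have "\<bar>\<mu>\<bar> powr (p - \<rho>) \<le> \<bar>\<mu>\<bar> powr p" using * by (intro powr_mono) auto
      then show ?thesis by simp
    qed
    have "\<nu>3 * \<bar>\<mu>\<bar> powr (p - \<rho>) \<le> \<nu>3 * (1 + \<bar>\<mu>\<bar> powr p)" using 1 *(2) by (rule mult_left_mono)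
    moreover have "C * 1 \<le> C * (1 + \<bar>\<mu>\<bar> powr p)" using *(1) by (intro mult_left_mono) auto
    ultimately show ?thesis using *(5)[rule_format, of \<mu>] by (simp add: algebra_simps)
  qed
  then show ?thesis using * by (intro exI[of _ "\<nu>3 + C"]) auto
qed

definition KG :: real where "KG = (SOME K. K \<ge> 0 \<and> (\<forall>\<mu>. G \<mu> \<ge> - K * (1 + \<bar>\<mu>\<bar> powr p)))"

lemma KG: "KG \<ge> 0" "G \<mu> \<ge> - KG * (1 + \<bar>\<mu>\<bar> powr p)"
proof -
  have "KG \<ge> 0 \<and> (\<forall>\<mu>. G \<mu> \<ge> - KG * (1 + \<bar>\<mu>\<bar> powr p))"
    unfolding KG_def using G_lower by (rule someI_ex)
  then show "KG \<ge> 0" "G \<mu> \<ge> - KG * (1 + \<bar>\<mu>\<bar> powr p)" by auto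
qed

lemma low_integrable:
  fixes u :: "'a \<Rightarrow> real"
  assumes "finite_measure M" "u \<in> borel_measurable M" "Np M p u < \<infinity>"
  shows "integrable M (\<lambda>x. KG * (1 + \<bar>u x\<bar> powr p))"
proof -
  interpret finite_measure M by (rule assms)
  show ?thesis using Np_integrable_powr[OF assms(2,3)] by simp
qed

lemma integrable_sandwich:
  fixes f :: "'a \<Rightarrow> real"
  assumes "f \<in> borel_measurable M" "integrable M l" "integrable M h" "AE x in M. l x \<le> f x" "AE x in M. f x \<le> h x"
  shows "integrable M f"
proof (rule Bochner_Integration.integrable_bound[of _ "\<lambda>x. \<bar>l x\<bar> + \<bar>h x\<bar>"])
  show "AE x in M. norm (f x) \<le> norm (\<bar>l x\<bar> + \<bar>h x\<bar>)"
    using assms(4,5) by eventually_elim auto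
qed (use assms in auto)

text \<open>Both summands have integrable minorants, so neither can compensate an infinite
  contribution of the other. This is what allows the two terms of a finite energy to be averaged and
  compared separately.\<close>

lemma integrable_sum_split:
  fixes u a :: "'a \<Rightarrow> real"
  assumes "finite_measure M" and u: "u \<in> borel_measurable M" "Np M p u < \<infinity>" and a: "a \<in> borel_measurable M" "\<And>x. a x \<ge> - CW"
    and int: "integrable M (\<lambda>x. a x + G (u x))"
  shows "integrable M a" "integrable M (\<lambda>x. G (u x))"
proof -
  interpret finite_measure M by (rule assms)
  note li = low_integrable[OF assms(1) u]
  have g: "G (u x) \<ge> - (KG * (1 + \<bar>u x\<bar> powr p))" for x using KG(2)[of "u x"] by simp
  have Gm: "(\<lambda>x. G (u x)) \<in> borel_measurable M" using u(1) by measurable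
  have 1: "a x \<le> (a x + G (u x)) + KG * (1 + \<bar>u x\<bar> powr p)" and 2: "G (u x) \<le> (a x + G (u x)) + CW" for x
    using g[of x] a(2)[of x] by linarith+
  show "integrable M a"
    by (rule integrable_sandwich[OF a(1) _ Bochner_Integration.integrable_add[OF int li], of "\<lambda>x. - CW"])
      (use a(2) 1 in simp_all)
  have l: "integrable M (\<lambda>x. - (KG * (1 + \<bar>u x\<bar> powr p)))" using li by (rule Bochner_Integration.integrable_minus)
  have h: "integrable M (\<lambda>x. (a x + G (u x)) + CW)" using int by simp
  show "integrable M (\<lambda>x. G (u x))"
    by (rule integrable_sandwich[OF Gm l h]) (simp_all only: AE_I2 g 2)
qed

lemma energy_eq:
  assumes W0: "W0 u g" and v: "v \<in> borel_measurable lebB" "AE x in bal. v x = u x"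
  shows "energy R W G v = ext_integral bal (\<lambda>x. W (g x) + G (u x))"
proof -
  note [measurable] = W0_measurable[OF W0]
  have ae: "AE x in lebB. W (wgrad (ball 0 R) v x) + G (v x) = W (g x) + G (u x)"
    using W0_wgrad[OF W0 v] v(2) unfolding AE_ballM by eventually_elim simp
  have "(\<integral>\<^sup>+x. ennreal (W (wgrad (ball 0 R) v x) + G (v x)) \<partial>lebB) = (\<integral>\<^sup>+x. ennreal (W (g x) + G (u x)) \<partial>bal)"
    by (subst nn_integral_ballM) (use ae in \<open>auto intro!: nn_integral_cong_AE elim!: eventually_mono\<close>)
  moreover have "(\<integral>\<^sup>+x. ennreal (- (W (wgrad (ball 0 R) v x) + G (v x))) \<partial>lebB) = (\<integral>\<^sup>+x. ennreal (- (W (g x) + G (u x))) \<partial>bal)"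
  proof (subst nn_integral_ballM)
    have "AE x in lebB. ennreal (- (W (wgrad (ball 0 R) v x) + G (v x))) = ennreal (- (W (g x) + G (u x)))"
      using ae by eventually_elim (simp only:)
    then show "(\<integral>\<^sup>+x. ennreal (- (W (wgrad (ball 0 R) v x) + G (v x))) \<partial>lebB) = (\<integral>\<^sup>+x. ennreal (- (W (g x) + G (u x))) \<partial>lebB)"
      by (rule nn_integral_cong_AE)
  qed simp
  ultimately show ?thesis unfolding energy_def ext_integral_def by simp
qed

lemma energy_integrable:
  assumes W0: "W0 u g" and v: "v \<in> borel_measurable lebB" "AE x in bal. v x = u x" and fin: "energy R W G v < \<infinity>"
  shows "integrable bal (\<lambda>x. W (g x))" "integrable bal (\<lambda>x. G (u x))"
    "energy R W G v = ereal ((LINT x|bal. W (g x)) + (LINT x|bal. G (u x)))"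
proof -
  note um [measurable] = W0_measurable[OF W0]
  interpret finite_measure bal by (rule finite_measure_ballM)
  note Np = W0_Np_finite[OF W0]
  have um': "u \<in> borel_measurable bal" by simp
  have li: "integrable bal (\<lambda>x. CW + KG * (1 + \<bar>u x\<bar> powr p))"
    using low_integrable[OF finite_measure_ballM um' Np(1)] by simp
  have "(\<integral>\<^sup>+x. ennreal (- (W (g x) + G (u x))) \<partial>bal) \<le> (\<integral>\<^sup>+x. ennreal (norm (CW + KG * (1 + \<bar>u x\<bar> powr p))) \<partial>bal)"
  proof (intro nn_integral_mono ennreal_leI)
    fix x
    have "W (g x) \<ge> - CW" unfolding W_eq by (rule Wt_ge) simp
    then show "- (W (g x) + G (u x)) \<le> norm (CW + KG * (1 + \<bar>u x\<bar> powr p))"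
      using KG(2)[of "u x"] by simp
  qed
  also have "\<dots> < \<infinity>" using li by (simp add: integrable_iff_bounded)
  finally have neg: "(\<integral>\<^sup>+x. ennreal (- (W (g x) + G (u x))) \<partial>bal) < \<infinity>" .
  have int: "integrable bal (\<lambda>x. W (g x) + G (u x))"
    by (rule ext_integral_finite_imp_integrable[OF _ neg]) (use fin energy_eq[OF W0 v] in auto)
  have Wge: "W (g x) \<ge> - CW" for x unfolding W_eq by (rule Wt_ge) simp
  show i: "integrable bal (\<lambda>x. W (g x))" "integrable bal (\<lambda>x. G (u x))"
    by (rule integrable_sum_split[OF finite_measure_ballM um' Np(1) _ Wge int]; simp)+
  show "energy R W G v = ereal ((LINT x|bal. W (g x)) + (LINT x|bal. G (u x)))"
    unfolding energy_eq[OF W0 v] ext_integral_eq[OF int] using i by simp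
qed

section \<open>Energies of radial functions\<close>

definition adm :: "(real \<Rightarrow> real) \<Rightarrow> bool" where
  "adm h \<longleftrightarrow> rprof h \<and> integrable (radM TYPE('n) R) (\<lambda>r. Wt \<bar>h r\<bar>) \<and> integrable (radM TYPE('n) R) (\<lambda>r. G (wint R h r))"

definition J :: "(real \<Rightarrow> real) \<Rightarrow> real" where
  "J h = (LINT r|(radM TYPE('n) R). Wt \<bar>h r\<bar>) + (LINT r|(radM TYPE('n) R). G (wint R h r))"

lemma radial_in_W1p_0:
  assumes "rprof h" "v \<in> borel_measurable lebB" "AE x in bal. v x = wint R h (norm x)"
  shows "v \<in> W1p_0 (ball 0 R) p" "AE x in bal. wgrad (ball 0 R) v x = - h (norm x) *\<^sub>R sgn x"
  using W0_in_W1p_0[OF W0rad_rprof[OF assms(1), unfolded W0rad_def] assms(2,3)]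
    W0_wgrad[OF W0rad_rprof[OF assms(1), unfolded W0rad_def] assms(2,3)] by simp_all

lemma energy_radial:
  assumes adm: "adm h" and v: "v \<in> borel_measurable lebB" "AE x in bal. v x = wint R h (norm x)"
  shows "energy R W G v = ereal (J h)"
proof -
  have h: "rprof h" and i: "integrable (radM TYPE('n) R) (\<lambda>r. Wt \<bar>h r\<bar>)" "integrable (radM TYPE('n) R) (\<lambda>r. G (wint R h r))"
    using adm by (auto simp: adm_def)
  have hm [measurable]: "h \<in> borel_measurable borel" using h by (rule rprof_measurable)
  have m: "(\<lambda>r. Wt \<bar>h r\<bar>) \<in> borel_measurable borel" "(\<lambda>r. G (wint R h r)) \<in> borel_measurable borel" by auto
  have W0: "W0 (\<lambda>x. wint R h (norm x)) (\<lambda>x. - h (norm x) *\<^sub>R sgn x)"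
    using W0rad_rprof[OF h] by (simp add: W0rad_def)
  have i1: "integrable bal (\<lambda>x. Wt \<bar>h (norm x)\<bar>)"
    using i(1) by (subst integrable_radial[where f = "\<lambda>r. Wt \<bar>h r\<bar>"]) auto
  have i2: "integrable bal (\<lambda>x. G (wint R h (norm x)))"
    using i(2) by (subst integrable_radial[where f = "\<lambda>r. G (wint R h r)"]) auto
  have ae: "AE x in bal. W (- h (norm x) *\<^sub>R sgn x) = Wt \<bar>h (norm x)\<bar>"
    using AE_bal_nonzero by eventually_elim (simp add: W_eq norm_sgn)
  have wm: "(\<lambda>x::real^'n. W (- h (norm x) *\<^sub>R sgn x)) \<in> borel_measurable bal" by measurable
  have i1': "integrable bal (\<lambda>x. W (- h (norm x) *\<^sub>R sgn x))"
    by (rule integrable_cong_AE_imp[OF i1 wm]) (use ae in \<open>auto elim: eventually_mono\<close>)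
  have i12: "integrable bal (\<lambda>x. W (- h (norm x) *\<^sub>R sgn x) + G (wint R h (norm x)))"
    using i1' i2 by simp
  have "(LINT x|bal. W (- h (norm x) *\<^sub>R sgn x)) = (LINT x|bal. Wt \<bar>h (norm x)\<bar>)"
    by (rule integral_cong_AE[OF wm _ ae]) simp
  also have "\<dots> = (LINT r|(radM TYPE('n) R). Wt \<bar>h r\<bar>)"
    by (rule integral_radial) simp
  finally have e1: "(LINT x|bal. W (- h (norm x) *\<^sub>R sgn x)) = (LINT r|(radM TYPE('n) R). Wt \<bar>h r\<bar>)" .
  have e2: "(LINT x|bal. G (wint R h (norm x))) = (LINT r|(radM TYPE('n) R). G (wint R h r))"
    by (rule integral_radial) simp
  show ?thesis
    unfolding energy_eq[OF W0 v] ext_integral_eq[OF i12] J_def using i1' i2 e1 e2 by simp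
qed

text \<open>Comparison with the zero function, whose energy is finite because the ball has finite
  volume.\<close>

lemma minimizer_energy_finite:
  assumes "minimizer R p W G v"
  shows "energy R W G v < \<infinity>"
proof -
  interpret finite_measure bal by (rule finite_measure_ballM)
  have z: "W0 (\<lambda>x. 0) (\<lambda>x. 0)"
    using W0_lincomb[OF W0_test[OF zero_test_function] W0_test[OF zero_test_function], of 0 0] by simp
  have "(\<lambda>x::real^'n. 0) \<in> W1p_0 (ball 0 R) p" by (rule W0_in_W1p_0[OF z]) auto
  then have "energy R W G v \<le> energy R W G (\<lambda>x. 0)"
    using assms by (simp add: minimizer_def)
  also have "\<dots> = ereal (LINT x|bal. W 0 + G 0)"
  proof -
    have "energy R W G (\<lambda>x::real^'n. 0) = ext_integral bal (\<lambda>x. W 0 + G 0)"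
      by (rule energy_eq[OF z]) auto
    also have "\<dots> = ereal (LINT x|bal. W 0 + G 0)"
      by (rule ext_integral_eq) simp
    finally show ?thesis .
  qed
  finally show ?thesis by (auto intro: le_less_trans)
qed

lemma radial_le_imp_minimizer:
  assumes "minimizer R p W G v" "energy R W G v = ereal e" "adm h" "J h \<le> e"
    and w: "w \<in> borel_measurable lebB" "AE x in bal. w x = wint R h (norm x)"
  shows "minimizer R p W G w" "J h = e"
proof -
  have h: "rprof h" using assms(3) by (simp add: adm_def)
  have wW: "w \<in> W1p_0 (ball 0 R) p" by (rule radial_in_W1p_0(1)[OF h w])
  have "ereal e \<le> ereal (J h)"
    using assms(1) wW unfolding minimizer_def assms(2)[symmetric] energy_radial[OF assms(3) w, symmetric] by blast
  then show *: "J h = e" using assms(4) by simp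
  show "minimizer R p W G w"
    using assms(1) wW unfolding minimizer_def assms(2) energy_radial[OF assms(3) w] * by blast
qed

lemma minimizer_le_J:
  assumes "minimizer R p W G v" "energy R W G v = ereal e" "adm h"
  shows "e \<le> J h"
proof -
  have h: "rprof h" and [measurable]: "h \<in> borel_measurable borel"
    using assms(3) by (auto simp: adm_def rprof_def)
  have m: "(\<lambda>x::real^'n. wint R h (norm x)) \<in> borel_measurable lebB"
    by (rule borel_imp_lebB) simp
  have "ereal e \<le> ereal (J h)"
    using assms(1) radial_in_W1p_0(1)[OF h m]
    unfolding minimizer_def assms(2)[symmetric] energy_radial[OF assms(3) m AE_I2[OF refl], symmetric] by simp
  then show ?thesis by simp
qed

text \<open>Both conclusions come from one chain: \<open>e\<close> is at most the mean of
  \<open>J\<close> over the directions, and this mean is at most \<open>e\<close>. The first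
  inequality is minimality on almost every ray, the second is monotonicity of \<open>Wt\<close> at
  almost every point, and coincidence of the ends makes both sharp.\<close>

lemma minimizer_profiles:
  assumes min: "minimizer R p W G v" and e: "energy R W G v = ereal e" and W0: "W0 u g" and vu: "AE x in bal. v x = u x"
  shows "AE y in sph. adm (\<lambda>r. - (g (r *\<^sub>R sgn y) \<bullet> sgn y)) \<and> J (\<lambda>r. - (g (r *\<^sub>R sgn y) \<bullet> sgn y)) = e \<and>
      (AE r in (radM TYPE('n) R). u (r *\<^sub>R sgn y) = wint R (\<lambda>r. - (g (r *\<^sub>R sgn y) \<bullet> sgn y)) r)"
    and "AE x in bal. Wt \<bar>g x \<bullet> sgn x\<bar> = Wt (norm (g x))"
proof -
  interpret S: finite_measure sph by (rule finite_measure_sphM)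
  interpret B: finite_measure bal by (rule finite_measure_ballM)
  have vm: "v \<in> borel_measurable lebB"
    using min by (auto simp: minimizer_def W1p_0_def W1p_def Lp_space_def)
  note um [measurable] = W0_measurable[OF W0]
  note int = energy_integrable[OF W0 vm vu minimizer_energy_finite[OF min]]
  have ee: "e = (LINT x|bal. W (g x)) + (LINT x|bal. G (u x))"
    using int(3) e by simp
  have le: "\<bar>g x \<bullet> sgn x\<bar> \<le> norm (g x)" for x
  proof -
    have "\<bar>g x \<bullet> sgn x\<bar> \<le> norm (g x) * norm (sgn x)" by (rule Cauchy_Schwarz_ineq2)
    also have "\<dots> \<le> norm (g x) * 1" by (intro mult_left_mono) (auto simp: norm_sgn)
    finally show ?thesis by simp
  qed
  have Wle: "Wt \<bar>g x \<bullet> sgn x\<bar> \<le> W (g x)" for x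
    unfolding W_eq using le[of x] by (intro mono_onD[OF Wt_mono]) auto
  have f1: "integrable bal (\<lambda>x. Wt \<bar>g x \<bullet> sgn x\<bar>)"
    by (rule integrable_sandwich[where l = "\<lambda>x. - CW" and h = "\<lambda>x. W (g x)"]) (use int Wle Wt_ge in auto)
  \<comment> \<open>For r > 0 the point \<open>r *\<^sub>R sgn y\<close> has direction
    \<open>sgn y\<close>, so \<open>j1 y + j2 y\<close> is \<open>J\<close> of the profile on that
    ray.\<close>
  define j1 where "j1 y = (LINT r|(radM TYPE('n) R). Wt \<bar>g (r *\<^sub>R sgn y) \<bullet> sgn (r *\<^sub>R sgn y)\<bar>)" for y :: "real^'n"
  define j2 where "j2 y = (LINT r|(radM TYPE('n) R). G (u (r *\<^sub>R sgn y)))" for y :: "real^'n"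
  note P1 = integrable_polar[where f = "\<lambda>x. Wt \<bar>g x \<bullet> sgn x\<bar>", OF _ f1]
  note P2 = integrable_polar[where f = "\<lambda>x. G (u x)", OF _ int(2)]
  have j1: "integrable sph j1" "(LINT y|sph. j1 y) = (LINT x|bal. Wt \<bar>g x \<bullet> sgn x\<bar>)"
    unfolding j1_def[abs_def] using P1(2,3) by simp_all
  have j2: "integrable sph j2" "(LINT y|sph. j2 y) = (LINT x|bal. G (u x))"
    unfolding j2_def[abs_def] using P2(2,3) by simp_all
  have prof: "AE y in sph. adm (\<lambda>r. - (g (r *\<^sub>R sgn y) \<bullet> sgn y)) \<and> J (\<lambda>r. - (g (r *\<^sub>R sgn y) \<bullet> sgn y)) = j1 y + j2 y \<and>
      (AE r in (radM TYPE('n) R). u (r *\<^sub>R sgn y) = wint R (\<lambda>r. - (g (r *\<^sub>R sgn y) \<bullet> sgn y)) r)"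
  proof -
    have a1: "AE y in sph. integrable (radM TYPE('n) R) (\<lambda>r. Wt \<bar>g (r *\<^sub>R sgn y) \<bullet> sgn (r *\<^sub>R sgn y)\<bar>)"
      using P1(1) by simp
    have a2: "AE y in sph. integrable (radM TYPE('n) R) (\<lambda>r. G (u (r *\<^sub>R sgn y)))"
      using P2(1) by simp
    show ?thesis using a1 a2 W0_rays[OF W0] AE_sphM_nonzero
    proof eventually_elim
      case (elim y)
      define \<theta> where "\<theta> = sgn y"
      define h where "h = (\<lambda>r. - (g (r *\<^sub>R \<theta>) \<bullet> \<theta>))"
      have [measurable]: "h \<in> borel_measurable borel" unfolding h_def by measurable
      have rh: "rprof h" and uw: "AE r in (radM TYPE('n) R). u (r *\<^sub>R \<theta>) = wint R h r"
        using elim(3) by (simp_all only: h_def \<theta>_def)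
      have \<theta>: "sgn (r *\<^sub>R \<theta>) = \<theta>" if "0 < r" for r
      proof -
        have "norm (sgn y) = 1" using elim(4) by (simp add: norm_sgn)
        then have "sgn (sgn y) = sgn y" using sgn_div_norm[of "sgn y"] by simp
        then show ?thesis using that by (simp add: \<theta>_def sgn_scaleR)
      qed
      have e1: "AE r in (radM TYPE('n) R). Wt \<bar>g (r *\<^sub>R \<theta>) \<bullet> sgn (r *\<^sub>R \<theta>)\<bar> = Wt \<bar>h r\<bar>"
        by (auto simp: AE_radM \<theta> h_def)
      have e2: "AE r in (radM TYPE('n) R). G (u (r *\<^sub>R \<theta>)) = G (wint R h r)"
        using uw by eventually_elim simp
      have i1: "integrable (radM TYPE('n) R) (\<lambda>r. Wt \<bar>h r\<bar>)"
        by (rule integrable_cong_AE_imp[OF elim(1)]) (use e1 in \<open>auto simp: \<theta>_def elim: eventually_mono\<close>)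
      have i2: "integrable (radM TYPE('n) R) (\<lambda>r. G (wint R h r))"
        by (rule integrable_cong_AE_imp[OF elim(2)]) (use e2 in \<open>auto simp: \<theta>_def elim: eventually_mono\<close>)
      have "adm h" using rh i1 i2 by (simp add: adm_def)
      moreover have "j1 y = (LINT r|(radM TYPE('n) R). Wt \<bar>h r\<bar>)"
        unfolding j1_def \<theta>_def[symmetric] by (rule integral_cong_AE[OF _ _ e1]) auto
      moreover have "j2 y = (LINT r|(radM TYPE('n) R). G (wint R h r))"
        unfolding j2_def \<theta>_def[symmetric] by (rule integral_cong_AE[OF _ _ e2]) auto
      ultimately have "adm h \<and> J h = j1 y + j2 y \<and> (AE r in (radM TYPE('n) R). u (r *\<^sub>R \<theta>) = wint R h r)"
        using uw by (simp add: J_def)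
      then show ?case by (simp only: h_def \<theta>_def)
    qed
  qed
  have ge: "AE y in sph. e \<le> j1 y + j2 y"
    using prof
  proof eventually_elim
    case (elim y)
    show ?case
      using minimizer_le_J[OF min e conjunct1[OF elim]] conjunct1[OF conjunct2[OF elim]] by (simp only:)
  qed
  \<comment> \<open>Total mass 1 lets the constant \<open>e\<close> keep its value under
    averaging.\<close>
  have m1: "measure sph (space sph) = 1" by (simp add: measure_def emeasure_sphM)
  have i12: "integrable sph (\<lambda>y. j1 y + j2 y)" using j1 j2 by simp
  have tot: "(LINT y|sph. j1 y + j2 y) = (LINT x|bal. Wt \<bar>g x \<bullet> sgn x\<bar>) + (LINT x|bal. G (u x))"
    using j1 j2 by simp
  have ce: "(LINT y|sph. e) = e" using m1 by simp
  have "(LINT y|sph. e) \<le> (LINT y|sph. j1 y + j2 y)"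
    by (rule integral_mono_AE) (use i12 ge in simp_all)
  then have "e \<le> (LINT y|sph. j1 y + j2 y)" by (simp only: ce)
  moreover have Wi: "(LINT x|bal. Wt \<bar>g x \<bullet> sgn x\<bar>) \<le> (LINT x|bal. W (g x))"
    by (rule integral_mono) (use f1 int Wle in auto)
  ultimately have eq: "(LINT y|sph. j1 y + j2 y) = e" "(LINT x|bal. Wt \<bar>g x \<bullet> sgn x\<bar>) = (LINT x|bal. W (g x))"
    using tot ee by linarith+
  have "AE y in sph. e = j1 y + j2 y"
    by (rule integral_mono_eq_imp_AE) (use i12 ge eq ce in auto)
  then show "AE y in sph. adm (\<lambda>r. - (g (r *\<^sub>R sgn y) \<bullet> sgn y)) \<and> J (\<lambda>r. - (g (r *\<^sub>R sgn y) \<bullet> sgn y)) = e \<and>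
      (AE r in (radM TYPE('n) R). u (r *\<^sub>R sgn y) = wint R (\<lambda>r. - (g (r *\<^sub>R sgn y) \<bullet> sgn y)) r)"
    using prof by eventually_elim (simp only: simp_thms)
  have "AE x in bal. Wt \<bar>g x \<bullet> sgn x\<bar> = W (g x)"
    by (rule integral_mono_eq_imp_AE) (use f1 int Wle eq in auto)
  then show "AE x in bal. Wt \<bar>g x \<bullet> sgn x\<bar> = Wt (norm (g x))"
    by (simp only: W_eq)
qed

section \<open>Steepening a radial profile\<close>

text \<open>The supremum is finite because \<open>Wt\<close> is coercive.\<close>

definition bet :: "real \<Rightarrow> real" where
  "bet t = Sup {s. t \<le> s \<and> Wt s = Wt t}"

lemma Wt_power_bound: "s \<ge> 0 \<Longrightarrow> s powr p \<le> (Wt s + CW) / nu"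
  using nu_CW(3)[of s] nu_CW(1) by (simp add: pos_le_divide_eq mult.commute)

text \<open>The set in the definition is closed, so the supremum is attained and still lies on the
  plateau.\<close>

lemma bet_props:
  assumes "t \<ge> 0"
  shows "t \<le> bet t" "Wt (bet t) = Wt t" "\<And>s. t \<le> s \<Longrightarrow> Wt s = Wt t \<Longrightarrow> s \<le> bet t"
proof -
  let ?S = "{s. t \<le> s \<and> Wt s = Wt t}"
  have bd: "bdd_above ?S"
  proof (rule bdd_aboveI)
    fix s assume s: "s \<in> ?S"
    then have "s powr p \<le> (Wt t + CW) / nu" using Wt_power_bound[of s] assms by simp
    then have "(s powr p) powr (1 / p) \<le> ((Wt t + CW) / nu) powr (1 / p)"
      using p_ge by (intro powr_mono2) auto
    then show "s \<le> ((Wt t + CW) / nu) powr (1 / p)"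
      using s assms p_ge by (simp add: powr_powr)
  qed
  have "closed ?S"
    by (intro closed_Collect_conj closed_Collect_le closed_Collect_eq continuous_intros
        continuous_on_compose2[OF Wt_continuous]) auto
  then have "bet t \<in> ?S"
    unfolding bet_def using bd by (intro closed_contains_Sup) auto
  then show "t \<le> bet t" "Wt (bet t) = Wt t" by auto
  show "s \<le> bet t" if "t \<le> s" "Wt s = Wt t" for s
    unfolding bet_def by (rule cSup_upper[OF _ bd]) (use that in simp)
qed

text \<open>If \<open>bet t\<close> exceeds t', then t' lies on the plateau from t to
  \<open>bet t\<close>, and \<open>bet t\<close> belongs to the set that defines
  \<open>bet t'\<close>. As \<open>bet\<close> may jump, monotonicity is also the source of its
  measurability.\<close>

lemma bet_mono:
  assumes "0 \<le> t" "t \<le> t'"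
  shows "bet t \<le> bet t'"
proof (cases "bet t \<le> t'")
  case True
  then show ?thesis using bet_props(1)[of t'] assms by linarith
next
  case False
  have "Wt t \<le> Wt t'" using assms by (intro mono_onD[OF Wt_mono]) auto
  moreover have "Wt t' \<le> Wt (bet t)" using assms False by (intro mono_onD[OF Wt_mono]) auto
  ultimately have "Wt (bet t) = Wt t'" using bet_props(2)[OF assms(1)] by linarith
  then show ?thesis using bet_props(3)[of t' "bet t"] assms False by simp
qed

text \<open>The strict inequality is the conclusion of \<open>condition_star\<close>, so proving
  that condition amounts to showing that the modulus of the radial derivative is a fixed point of
  \<open>bet\<close>.\<close>

lemma bet_strict: "t \<ge> 0 \<Longrightarrow> bet t = t \<Longrightarrow> s > t \<Longrightarrow> Wt s > Wt t"
proof -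
  assume t: "t \<ge> 0" "bet t = t" "s > t"
  have "Wt t \<le> Wt s" using t by (intro mono_onD[OF Wt_mono]) auto
  moreover have "Wt s \<noteq> Wt t" using bet_props(3)[of t s] t by auto
  ultimately show ?thesis by simp
qed

text \<open>A value on the plateau around 0 is carried at least to its right end, and larger values
  do not decrease. This is the origin of the slope bound by \<open>M0\<close>.\<close>

lemma bet_ge_plateau:
  assumes "t \<ge> 0" "M0 \<ge> 0" "Wt constant_on {- M0..M0}"
  shows "M0 \<le> bet t"
proof (cases "t \<le> M0")
  case True
  obtain c where "\<forall>x\<in>{- M0..M0}. Wt x = c" using assms(3) by (auto simp: constant_on_def)
  then have "Wt M0 = Wt t" using assms True by simp
  then show ?thesis using bet_props(3)[OF assms(1) True] by simp
next
  case False
  then show ?thesis using bet_props(1)[OF assms(1)] by linarith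
qed

definition steep :: "(real \<Rightarrow> real) \<Rightarrow> real \<Rightarrow> real" where
  "steep h r = bet \<bar>h r\<bar>"

lemma bet_abs_measurable [measurable]: "(\<lambda>t. bet \<bar>t\<bar>) \<in> borel_measurable borel"
proof -
  have "mono (\<lambda>t. bet (max 0 t))"
    by (rule monoI, rule bet_mono) auto
  then have "(\<lambda>t. bet (max 0 t)) \<in> borel_measurable borel" by (rule borel_measurable_mono)
  then have "(\<lambda>t. bet (max 0 \<bar>t\<bar>)) \<in> borel_measurable borel" by (rule measurable_compose[rotated]) simp
  then show ?thesis by simp
qed

lemma steep_measurable [measurable]: "h \<in> borel_measurable borel \<Longrightarrow> steep h \<in> borel_measurable borel"
  unfolding steep_def[abs_def] by (rule measurable_compose[OF _ bet_abs_measurable])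

lemma steep_ge: "\<bar>h r\<bar> \<le> steep h r" "0 \<le> steep h r" "h r \<le> steep h r" "- h r \<le> steep h r"
  using bet_props(1)[of "\<bar>h r\<bar>"] by (auto simp: steep_def)

lemma Wt_steep: "Wt (steep h r) = Wt \<bar>h r\<bar>" "Wt \<bar>steep h r\<bar> = Wt \<bar>h r\<bar>"
  using bet_props(2)[of "\<bar>h r\<bar>"] steep_ge(2)[of h r] by (auto simp: steep_def)

text \<open>By coercivity the p-th power of \<open>steep h\<close> is at most an affine function of
  \<open>Wt (steep h)\<close>, which equals \<open>Wt \<bar>h r\<bar>\<close> at radius r and is
  integrable. The estimate goes through \<open>Wt\<close> and not through \<open>h\<close>, because
  plateaus may be long.\<close>

lemma rprof_steep:
  assumes "adm h"
  shows "rprof (steep h)"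
proof -
  interpret finite_measure "(radM TYPE('n) R)" by (rule finite_measure_radM)
  have [measurable]: "h \<in> borel_measurable borel" and i: "integrable (radM TYPE('n) R) (\<lambda>r. Wt \<bar>h r\<bar>)"
    using assms by (auto simp: adm_def rprof_def)
  have "Np (radM TYPE('n) R) p (steep h) \<le> (\<integral>\<^sup>+r. ennreal (norm ((Wt \<bar>h r\<bar> + CW) / nu)) \<partial>(radM TYPE('n) R))"
    unfolding Np_def
  proof (intro nn_integral_mono ennreal_leI)
    fix r
    have "\<bar>steep h r\<bar> powr p \<le> (Wt \<bar>h r\<bar> + CW) / nu"
      using Wt_power_bound[OF steep_ge(2), of h r] steep_ge(2)[of h r] by (simp add: Wt_steep)
    also have "\<dots> \<le> \<bar>(Wt \<bar>h r\<bar> + CW) / nu\<bar>" by (rule abs_ge_self)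
    finally show "norm (steep h r) powr p \<le> norm ((Wt \<bar>h r\<bar> + CW) / nu)"
      by (simp only: real_norm_def)
  qed
  also have "\<dots> < \<infinity>"
  proof -
    have "integrable (radM TYPE('n) R) (\<lambda>r. (Wt \<bar>h r\<bar> + CW) / nu)" using i by simp
    then show ?thesis by (simp add: integrable_iff_bounded)
  qed
  finally show ?thesis by (simp add: rprof_def)
qed

lemma wint_mono:
  assumes "rprof h" "rprof k" "r > 0" "\<And>s. h s \<le> k s"
  shows "wint R h r \<le> wint R k r"
  unfolding wint_def
  by (rule set_integral_mono[OF rprof_set_integrable[OF assms(1,3)] rprof_set_integrable[OF assms(2,3)]]) (rule assms(4))

lemma wint_uminus: "wint R (\<lambda>s. - h s) r = - wint R h r"
  unfolding wint_def set_lebesgue_integral_def by simp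

lemma rprof_uminus: "rprof h \<Longrightarrow> rprof (\<lambda>r. - h r)"
  using rprof_lincomb[of h h "-1" 0] by simp

lemma wint_cong_AE:
  assumes "AE r in (radM TYPE('n) R). h r = k r" "h \<in> borel_measurable borel" "k \<in> borel_measurable borel" "0 < r"
  shows "wint R h r = wint R k r"
  unfolding wint_def set_lebesgue_integral_def
proof (rule integral_cong_AE)
  show "AE s in lborel. indicator {r<..<R} s *\<^sub>R h s = indicator {r<..<R} s *\<^sub>R k s"
    using assms(1) unfolding AE_radM by eventually_elim (use assms(4) in \<open>auto simp: indicator_def\<close>)
qed (use assms in simp_all)

lemma wint_eq_imp_AE:
  assumes "rprof h" "rprof k" "r > 0" "\<And>s. h s \<le> k s" "wint R h r = wint R k r"
  shows "AE s in lborel. r < s \<and> s < R \<longrightarrow> h s = k s"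
proof -
  note i = rprof_set_integrable[OF assms(1,3)] rprof_set_integrable[OF assms(2,3)]
  have "AE s in lborel. indicator {r<..<R} s *\<^sub>R h s = indicator {r<..<R} s *\<^sub>R k s"
    by (rule integral_mono_eq_imp_AE)
      (use i assms(4,5) in \<open>auto simp: set_integrable_def wint_def set_lebesgue_integral_def indicator_def\<close>)
  then show ?thesis by eventually_elim (auto simp: indicator_def)
qed

lemma wint_steep_ge:
  assumes "rprof h" "rprof (steep h)" "r > 0"
  shows "\<bar>wint R h r\<bar> \<le> wint R (steep h) r"
proof -
  have "wint R h r \<le> wint R (steep h) r"
    by (rule wint_mono[OF assms]) (rule steep_ge)
  moreover have "wint R (\<lambda>s. - h s) r \<le> wint R (steep h) r"
    by (rule wint_mono[OF rprof_uminus[OF assms(1)] assms(2,3)]) (rule steep_ge)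
  ultimately show ?thesis by (simp add: wint_uminus abs_le_iff)
qed

lemma G_abs_le:
  assumes "\<forall>\<mu>>0. G \<mu> \<le> G (- \<mu>)"
  shows "G \<bar>\<mu>\<bar> \<le> G \<mu>"
  using assms[rule_format, of "- \<mu>"] by (cases "\<mu> \<ge> 0") auto

text \<open>The gradient terms agree by construction. Integrated from the boundary, the new profile
  dominates the old one in modulus, and the two conditions on \<open>G\<close> turn this into an
  ordering of the second terms. The new second term is integrable because it lies between the growth
  bound of \<open>G\<close> and the old one.\<close>

lemma steep_improves:
  assumes h: "adm h" and G: "antimono_on {0..} G" "\<forall>\<mu>>0. G \<mu> \<le> G (- \<mu>)"
  shows "adm (steep h)" "J (steep h) \<le> J h"
    "J (steep h) = J h \<Longrightarrow> AE r in (radM TYPE('n) R). G (wint R (steep h) r) = G (wint R h r)"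
proof -
  interpret finite_measure "(radM TYPE('n) R)" by (rule finite_measure_radM)
  have rh: "rprof h" and [measurable]: "h \<in> borel_measurable borel" and i: "integrable (radM TYPE('n) R) (\<lambda>r. Wt \<bar>h r\<bar>)" "integrable (radM TYPE('n) R) (\<lambda>r. G (wint R h r))"
    using h by (auto simp: adm_def rprof_def)
  have rs: "rprof (steep h)" by (rule rprof_steep[OF h])
  have le: "G (wint R (steep h) r) \<le> G (wint R h r)" if "r > 0" for r
  proof -
    have "G (wint R (steep h) r) \<le> G \<bar>wint R h r\<bar>"
      using wint_steep_ge[OF rh rs that] by (intro monotone_onD[OF G(1)]) auto
    then show ?thesis using G_abs_le[OF G(2), of "wint R h r"] by linarith
  qed
  have ae: "AE r in (radM TYPE('n) R). G (wint R (steep h) r) \<le> G (wint R h r)"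
    using le by (simp add: AE_radM)
  have Np: "Np (radM TYPE('n) R) p (wint R (steep h)) < \<infinity>"
  proof -
    have "Np (radM TYPE('n) R) p (wint R (steep h)) \<le> ennreal (2 powr p * R powr p) * Np (radM TYPE('n) R) p (steep h)"
      by (rule wint_poincare) (use p_ge R_pos in auto)
    also have "\<dots> < \<infinity>" using rs by (simp add: rprof_def ennreal_mult_less_top)
    finally show ?thesis .
  qed
  have i2: "integrable (radM TYPE('n) R) (\<lambda>r. G (wint R (steep h) r))"
  proof (rule integrable_sandwich)
    show "integrable (radM TYPE('n) R) (\<lambda>r. - (KG * (1 + \<bar>wint R (steep h) r\<bar> powr p)))"
      using low_integrable[OF finite_measure_radM _ Np] by (intro Bochner_Integration.integrable_minus) simp
    show "AE r in (radM TYPE('n) R). - (KG * (1 + \<bar>wint R (steep h) r\<bar> powr p)) \<le> G (wint R (steep h) r)"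
      using KG(2) by (intro AE_I2) simp
  qed (use i ae in auto)
  show adm: "adm (steep h)"
    unfolding adm_def Wt_steep using rs i i2 by blast
  have m: "(LINT r|(radM TYPE('n) R). G (wint R (steep h) r)) \<le> (LINT r|(radM TYPE('n) R). G (wint R h r))"
    by (rule integral_mono_AE[OF i2 i(2) ae])
  then show "J (steep h) \<le> J h" by (simp add: J_def Wt_steep)
  show "AE r in (radM TYPE('n) R). G (wint R (steep h) r) = G (wint R h r)" if "J (steep h) = J h"
    by (rule integral_mono_eq_imp_AE[OF i2 i(2) _ ae]) (use that in \<open>simp add: J_def Wt_steep\<close>)
qed

lemma AE_radM_arbitrarily_small:
  assumes "AE r in (radM TYPE('n) R). P r" "\<epsilon> > 0"
  shows "\<exists>r. 0 < r \<and> r < \<epsilon> \<and> r < R \<and> P r"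
proof (rule ccontr)
  assume "\<not> ?thesis"
  then have *: "\<not> (0 < r \<and> r < min \<epsilon> R \<and> P r)" for r by auto
  have "AE r in lborel. r \<notin> {0<..<min \<epsilon> R}"
    using assms(1) unfolding AE_radM by eventually_elim (use * in auto)
  then have "{0<..<min \<epsilon> R} \<in> null_sets lborel"
    by (subst AE_iff_null_sets) auto
  then have "emeasure lborel {0<..<min \<epsilon> R} = 0" by auto
  then show False using assms(2) R_pos by (auto simp: min_def split: if_splits)
qed

text \<open>Good radii need only accumulate at 0: each interval (1/(n + 1), R) is covered by one of
  them, and countably many exceptional sets are still null. \<open>AE_radM_arbitrarily_small\<close>
  provides such radii from an almost-everywhere statement.\<close>

lemma AE_radM_exhaust:
  assumes "\<And>\<epsilon>. \<epsilon> > 0 \<Longrightarrow> \<exists>r. 0 < r \<and> r < \<epsilon> \<and> (AE s in lborel. r < s \<and> s < R \<longrightarrow> P s)"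
  shows "AE s in (radM TYPE('n) R). P s"
proof -
  have "AE s in lborel. \<forall>n. 1 / real (Suc n) < s \<and> s < R \<longrightarrow> P s"
  proof (subst AE_all_countable, intro allI)
    fix n
    obtain r where r: "0 < r" "r < 1 / real (Suc n)" "AE s in lborel. r < s \<and> s < R \<longrightarrow> P s"
      using assms[of "1 / real (Suc n)"] by auto
    show "AE s in lborel. 1 / real (Suc n) < s \<and> s < R \<longrightarrow> P s"
      using r(3) by eventually_elim (use r(2) in auto)
  qed
  then show ?thesis unfolding AE_radM
  proof eventually_elim
    case (elim s)
    show ?case
    proof
      assume s: "0 < s \<and> s < R"
      then obtain n where "inverse (real (Suc n)) < s" using reals_Archimedean by blast
      then show "P s" using elim[rule_format, of n] s by (simp only: inverse_eq_divide simp_thms)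
    qed
  qed
qed

lemma strict_antimono_imp_antimono: "strict_antimono_on A f \<Longrightarrow> antimono_on A f"
  for f :: "real \<Rightarrow> real"
  by (rule monotone_onI) (metis monotone_onD less_eq_real_def)

text \<open>Strict monotonicity of \<open>G\<close> forces
  \<open>wint R (steep h) r = \<bar>wint R h r\<bar>\<close> for almost every r. Since
  \<open>steep h\<close> dominates both \<open>h\<close> and \<open>- h\<close>, equal integrals
  over (r, R) make it coincide with one of them on that interval, according to the sign of
  \<open>wint R h r\<close>.\<close>

lemma minimal_profile_sign:
  assumes h: "adm h" and G: "strict_antimono_on {0..} G" "\<forall>\<mu>>0. G \<mu> \<le> G (- \<mu>)" and J: "J (steep h) = J h"
  shows "(AE r in (radM TYPE('n) R). steep h r = h r) \<or> (AE r in (radM TYPE('n) R). steep h r = - h r)"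
    "AE r in (radM TYPE('n) R). wint R (steep h) r = \<bar>wint R h r\<bar>"
    "AE r in (radM TYPE('n) R). G (wint R h r) = G \<bar>wint R h r\<bar>"
proof -
  have rh: "rprof h" using h by (simp add: adm_def)
  have rs: "rprof (steep h)" by (rule rprof_steep[OF h])
  note Ga = strict_antimono_imp_antimono[OF G(1)]
  have "AE r in (radM TYPE('n) R). 0 < r" by (simp add: AE_radM)
  then have *: "AE r in (radM TYPE('n) R). wint R (steep h) r = \<bar>wint R h r\<bar> \<and> G (wint R h r) = G \<bar>wint R h r\<bar>"
    using steep_improves(3)[OF h Ga G(2) J]
  proof eventually_elim
    case (elim r)
    note ge = wint_steep_ge[OF rh rs elim(1)]
    have 1: "G \<bar>wint R h r\<bar> \<le> G (wint R (steep h) r)" using G_abs_le[OF G(2), of "wint R h r"] elim(2) by simp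
    have eq: "wint R (steep h) r = \<bar>wint R h r\<bar>"
    proof (rule ccontr)
      assume "wint R (steep h) r \<noteq> \<bar>wint R h r\<bar>"
      then have "G (wint R (steep h) r) < G \<bar>wint R h r\<bar>"
        using ge by (intro monotone_onD[OF G(1)]) auto
      with 1 show False by simp
    qed
    with elim(2) show ?case by simp
  qed
  then show "AE r in (radM TYPE('n) R). wint R (steep h) r = \<bar>wint R h r\<bar>" "AE r in (radM TYPE('n) R). G (wint R h r) = G \<bar>wint R h r\<bar>"
    by (auto elim: eventually_mono)
  define Pp where "Pp r \<longleftrightarrow> (AE s in lborel. r < s \<and> s < R \<longrightarrow> steep h s = h s)" for r
  define Pm where "Pm r \<longleftrightarrow> (AE s in lborel. r < s \<and> s < R \<longrightarrow> steep h s = - h s)" for r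
  have ex: "\<exists>r. 0 < r \<and> r < \<epsilon> \<and> (Pp r \<or> Pm r)" if \<epsilon>: "\<epsilon> > 0" for \<epsilon>
  proof -
    obtain r where r: "0 < r" "r < \<epsilon>" "wint R (steep h) r = \<bar>wint R h r\<bar>"
      using AE_radM_arbitrarily_small[OF * \<epsilon>] by blast
    have "Pp r \<or> Pm r"
    proof (cases "wint R h r \<ge> 0")
      case True
      have "AE s in lborel. r < s \<and> s < R \<longrightarrow> h s = steep h s"
        by (rule wint_eq_imp_AE[OF rh rs r(1) steep_ge(3)]) (use r True in simp)
      then have "Pp r" unfolding Pp_def by eventually_elim auto
      then show ?thesis ..
    next
      case False
      have "AE s in lborel. r < s \<and> s < R \<longrightarrow> - h s = steep h s"
        by (rule wint_eq_imp_AE[OF rprof_uminus[OF rh] rs r(1) steep_ge(4)]) (use r False in \<open>simp add: wint_uminus\<close>)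
      then have "Pm r" unfolding Pm_def by eventually_elim auto
      then show ?thesis ..
    qed
    with r show ?thesis by blast
  qed
  \<comment> \<open>A priori the sign depends on r. One of the two occurs for radii arbitrarily
    close to 0 and therefore governs all of (0, R).\<close>
  show "(AE r in (radM TYPE('n) R). steep h r = h r) \<or> (AE r in (radM TYPE('n) R). steep h r = - h r)"
  proof (cases "\<forall>\<epsilon>>0. \<exists>r. 0 < r \<and> r < \<epsilon> \<and> Pp r")
    case True
    then have "AE r in (radM TYPE('n) R). steep h r = h r"
      unfolding Pp_def by (intro AE_radM_exhaust) blast
    then show ?thesis ..
  next
    case False
    then obtain d where d: "d > 0" "\<And>r. 0 < r \<Longrightarrow> r < d \<Longrightarrow> \<not> Pp r" by blast
    have "\<exists>r. 0 < r \<and> r < \<epsilon> \<and> Pm r" if "\<epsilon> > 0" for \<epsilon>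
    proof -
      have "min \<epsilon> d > 0" using that d(1) by simp
      from ex[OF this] obtain r where "0 < r" "r < min \<epsilon> d" "Pp r \<or> Pm r" by blast
      then show ?thesis using d(2)[of r] by auto
    qed
    then have "AE r in (radM TYPE('n) R). steep h r = - h r"
      unfolding Pm_def by (intro AE_radM_exhaust) blast
    then show ?thesis ..
  qed
qed

lemma wint_nonneg: "\<lbrakk>\<And>s. k s \<ge> 0\<rbrakk> \<Longrightarrow> wint R k r \<ge> 0"
  unfolding wint_def set_lebesgue_integral_def by (intro Bochner_Integration.integral_nonneg) auto

text \<open>This settles the ambiguous sign: when a nonnegative profile produces a nonpositive
  function, the profile vanishes and both signs are right.\<close>

lemma nonneg_wint_zero:
  assumes k: "rprof k" "\<And>s. k s \<ge> 0" and le: "AE r in (radM TYPE('n) R). wint R k r \<le> 0"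
  shows "AE r in (radM TYPE('n) R). k r = 0"
proof (rule AE_radM_exhaust)
  fix \<epsilon> :: real assume "\<epsilon> > 0"
  then obtain r where r: "0 < r" "r < \<epsilon>" "wint R k r \<le> 0"
    using AE_radM_arbitrarily_small[OF le] by blast
  have z: "rprof (\<lambda>s. 0)" using rprof_lincomb[OF k(1) k(1), of 0 0] by simp
  have "wint R k r = 0" by (intro antisym wint_nonneg r(3) k(2))
  moreover have "wint R (\<lambda>s. 0) r = 0" by (simp add: wint_def set_lebesgue_integral_def)
  ultimately have "wint R (\<lambda>s. 0) r = wint R k r" by simp
  from wint_eq_imp_AE[OF z k(1) r(1) k(2) this]
  have "AE s in lborel. r < s \<and> s < R \<longrightarrow> k s = 0" by eventually_elim auto
  with r show "\<exists>r. 0 < r \<and> r < \<epsilon> \<and> (AE s in lborel. r < s \<and> s < R \<longrightarrow> k s = 0)" by blast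
qed

lemma wint_antimono:
  assumes k: "rprof k" "\<And>s. k s \<ge> 0"
  shows "antimono_on {0<..<R} (wint R k)"
proof (rule monotone_onI)
  fix r t assume r: "r \<in> {0<..<R}" "t \<in> {0<..<R}" "r \<le> t"
  show "wint R k t \<le> wint R k r"
    unfolding wint_def set_lebesgue_integral_def
    using rprof_set_integrable[OF k(1), of r] rprof_set_integrable[OF k(1), of t] r k(2)
    by (intro integral_mono) (auto simp: set_integrable_def indicator_def)
qed

end

section \<open>Functions with radial gradient\<close>

lemma Ck_inner_left: "Ck k (\<lambda>y. a \<bullet> y)"
proof -
  have "Ck k (\<lambda>y. \<Sum>i\<in>UNIV. a $ i * y $ i)"
    by (intro Ck_sum Ck_mult Ck_const Ck_component) auto
  then show ?thesis by (simp add: inner_vec_def)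
qed

text \<open>\<open>flat_exp 2\<close> is the derivative of \<open>flat_exp 0\<close>; its bound
  provides the majorant for differentiating mollifications under the integral.\<close>

lemma flat_exp_2_bounds: "0 \<le> flat_exp 2 t" "flat_exp 2 t \<le> 2"
proof -
  show "0 \<le> flat_exp 2 t" by (auto simp: flat_exp_def)
  show "flat_exp 2 t \<le> 2"
  proof (cases "t > 0")
    case True
    define q where "q = 1 / t"
    have q: "q > 0" using True by (simp add: q_def)
    have "1 + q + q\<^sup>2 / 2 \<le> exp q" using q by (intro exp_lower_Taylor_quadratic) simp
    then have "q\<^sup>2 \<le> 2 * exp q" using q by linarith
    then have "q\<^sup>2 * exp (- q) \<le> 2 * exp q * exp (- q)" by (intro mult_right_mono) auto
    also have "\<dots> = 2" by (simp add: exp_minus)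
    finally show ?thesis using True by (simp add: flat_exp_def q_def)
  qed (simp add: flat_exp_def)
qed

lemma flat_exp_measurable [measurable]: "flat_exp n \<in> borel_measurable borel"
  using C1k_flat_exp[of 0 n] by (auto intro: borel_measurable_continuous_onI)

lemma flat_exp_0_deriv: "(flat_exp 0 has_real_derivative flat_exp 2 t) (at t)"
  using flat_exp_deriv[of 0 t] by (simp add: numeral_2_eq_2)

text \<open>\<open>\<epsilon>\<close> is the square of the radius of the support, so that the kernel
  is a smooth function of the squared distance. It is not normalised; its mass is divided out at the
  end, which leaves the derivative formulas free of constants.\<close>

definition moll :: "real \<Rightarrow> 'a::euclidean_space \<Rightarrow> 'a \<Rightarrow> real" where
  "moll \<epsilon> x y = flat_exp 0 (\<epsilon> - (y - x) \<bullet> (y - x))"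

lemma moll_bounds: "0 \<le> moll \<epsilon> x y" "moll \<epsilon> x y \<le> 1"
  using flat_exp_0_bounds by (auto simp: moll_def)

lemma moll_commute: "moll \<epsilon> x y = moll \<epsilon> y x"
  by (simp add: moll_def norm_minus_commute flip: power2_norm_eq_inner)

lemma moll_support: "moll \<epsilon> x y \<noteq> 0 \<Longrightarrow> norm (y - x) < sqrt \<epsilon>"
proof -
  assume "moll \<epsilon> x y \<noteq> 0"
  then have "(y - x) \<bullet> (y - x) < \<epsilon>" by (auto simp: moll_def flat_exp_def split: if_splits)
  then show ?thesis unfolding norm_eq_sqrt_inner by (rule real_sqrt_less_mono)
qed

lemma moll_measurable [measurable (raw)]:
  fixes f g :: "'a \<Rightarrow> 'b::euclidean_space"
  assumes [measurable]: "f \<in> borel_measurable M" "g \<in> borel_measurable M"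
  shows "(\<lambda>z. moll \<epsilon> (f z) (g z)) \<in> borel_measurable M"
  unfolding moll_def by measurable

context ball_sobolev
begin

text \<open>The vector field \<open>moll \<epsilon> x y *\<^sub>R J y\<close>, where \<open>J\<close> generates the rotations in the plane spanned by
  \<open>a\<close> and \<open>b\<close>, has divergence \<open>\<nabla> (moll \<epsilon> x) y \<bullet> J x\<close>, and it is orthogonal to every radial field.\<close>

lemma mollified_tangential_zero:
  assumes W: "W0 u g" and rad: "AE x in bal. g x = (g x \<bullet> sgn x) *\<^sub>R sgn x"
  shows "(LINT y|bal. u y * (flat_exp 2 (\<epsilon> - (y - x) \<bullet> (y - x)) * ((y - x) \<bullet> ((a \<bullet> x) *\<^sub>R b - (b \<bullet> x) *\<^sub>R a)))) = 0"
proof -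
  define J where "J y = (a \<bullet> y) *\<^sub>R b - (b \<bullet> y) *\<^sub>R a" for y
  define k where "k y = flat_exp 2 (\<epsilon> - (y - x) \<bullet> (y - x))" for y
  define \<psi> where "\<psi> i y = moll \<epsilon> x y * (J y $ i)" for i y
  have um: "u \<in> borel_measurable borel" "g \<in> borel_measurable borel" using W0_measurable[OF W] by auto
  have CJ: "Ck m (\<lambda>y. J y $ i)" for m i
  proof -
    have "Ck m (\<lambda>y. (a \<bullet> y) * (b $ i) + (- 1) * ((b \<bullet> y) * (a $ i)))"
      by (intro Ck_add Ck_mult Ck_inner_left Ck_const)
    then show ?thesis by (simp add: J_def)
  qed
  have CK: "Ck m (\<lambda>y. moll \<epsilon> x y)" for m
    using Ck_compose[OF C1k_affine[OF C1k_flat_exp[of m 0], of "-1" \<epsilon>] Ck_inner_self_shift[of m x]]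
    by (simp add: moll_def)
  have tst: "\<psi> i \<in> test_functions UNIV" for i
  proof (rule test_functionsI[of _ "cball x (sqrt \<epsilon>)"])
    show "Ck m (\<psi> i)" for m unfolding \<psi>_def by (intro Ck_mult CK CJ)
    show "y \<in> cball x (sqrt \<epsilon>)" if "\<psi> i y \<noteq> 0" for y
      using that moll_support[of \<epsilon> x y] by (simp add: \<psi>_def dist_norm norm_minus_commute)
  qed auto
  \<comment> \<open>The diagonal entries of the rotation generator contribute
    \<open>a $ i * b $ i - b $ i * a $ i = 0\<close>, so only the kernel is differentiated.\<close>
  have pd: "partial_deriv i (\<psi> i) y = - 2 * k y * ((y - x) $ i) * (J y $ i)" for i y
  proof -
    have dJ: "((\<lambda>y. J y $ i) has_derivative (\<lambda>v. (a \<bullet> v) * (b $ i) - (b \<bullet> v) * (a $ i))) (at y)"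
      unfolding J_def by (auto intro!: derivative_eq_intros)
    have dq: "((\<lambda>y. \<epsilon> - (y - x) \<bullet> (y - x)) has_derivative (\<lambda>v. - (2 * ((y - x) \<bullet> v)))) (at y)"
      by (auto intro!: derivative_eq_intros simp: inner_commute)
    have dK: "((\<lambda>y. moll \<epsilon> x y) has_derivative (\<lambda>v. k y * (- (2 * ((y - x) \<bullet> v))))) (at y)"
      unfolding moll_def k_def
      by (rule has_derivative_compose[OF dq flat_exp_0_deriv[unfolded has_field_derivative_def], THEN has_derivative_eq_rhs]) simp
    have "(\<psi> i has_derivative (\<lambda>v. moll \<epsilon> x y * ((a \<bullet> v) * (b $ i) - (b \<bullet> v) * (a $ i)) + k y * (- (2 * ((y - x) \<bullet> v))) * (J y $ i))) (at y)"
      unfolding \<psi>_def by (rule has_derivative_mult[OF dK dJ])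
    from partial_deriv_eq[OF this, of i] show ?thesis
      by (simp add: inner_axis algebra_simps)
  qed
  have sumJ: "(\<Sum>i\<in>UNIV. partial_deriv i (\<psi> i) y) = - 2 * (k y * ((y - x) \<bullet> J x))" for y
  proof -
    have "(\<Sum>i\<in>UNIV. partial_deriv i (\<psi> i) y) = - 2 * k y * ((y - x) \<bullet> J y)"
      by (simp add: pd inner_vec_def sum_distrib_left mult.assoc)
    \<comment> \<open>The generator is linear and antisymmetric, hence
      \<open>(y - x) \<bullet> J (y - x) = 0\<close>. The direction thus becomes \<open>J x\<close>,
      independent of y, and can later be read as a direction of motion of x.\<close>
    moreover have "(y - x) \<bullet> J y = (y - x) \<bullet> J x"
      by (simp add: J_def inner_diff_left inner_diff_right inner_commute algebra_simps)
    ultimately show ?thesis by simp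
  qed
  have gi: "integrable bal (\<lambda>x. g x $ i)" for i
    using integrable_bounded_linear[OF bounded_linear_vec_nth W0_integrable(2)[OF W]] .
  have I1: "integrable bal (\<lambda>y. u y * partial_deriv i (\<psi> i) y)" and I2: "integrable bal (\<lambda>y. g y $ i * \<psi> i y)" for i
  proof -
    obtain B where B: "\<And>x. \<bar>\<psi> i x\<bar> \<le> B" "\<And>x. norm (grad (\<psi> i) x) \<le> B"
      using test_functions_bounds[OF tst[of i]] by blast
    have B': "\<bar>partial_deriv i (\<psi> i) x\<bar> \<le> B" for x
      using component_le_norm_cart[of "grad (\<psi> i) x" i] B(2)[of x] by simp
    have m: "partial_deriv i (\<psi> i) \<in> borel_measurable bal" "\<psi> i \<in> borel_measurable bal"
      using test_functions_measurable[OF tst[of i]] by auto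
    show "integrable bal (\<lambda>y. u y * partial_deriv i (\<psi> i) y)"
      by (rule integrable_mult_bounded[OF W0_integrable(1)[OF W] m(1) B'])
    show "integrable bal (\<lambda>y. g y $ i * \<psi> i y)"
      by (rule integrable_mult_bounded[OF gi m(2) B(1)])
  qed
  have "(LINT y|bal. u y * (- 2 * (k y * ((y - x) \<bullet> J x)))) = (LINT y|bal. (\<Sum>i\<in>UNIV. u y * partial_deriv i (\<psi> i) y))"
    by (simp only: sumJ sum_distrib_left[symmetric])
  also have "\<dots> = (\<Sum>i\<in>UNIV. (LINT y|bal. u y * partial_deriv i (\<psi> i) y))"
    by (rule Bochner_Integration.integral_sum) (rule I1)
  also have "\<dots> = (\<Sum>i\<in>UNIV. - (LINT y|bal. g y $ i * \<psi> i y))"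
    by (intro sum.cong refl W0_weak[OF W tst])
  also have "\<dots> = - (LINT y|bal. (\<Sum>i\<in>UNIV. g y $ i * \<psi> i y))"
    by (simp add: sum_negf Bochner_Integration.integral_sum[OF I2])
  also have "(LINT y|bal. (\<Sum>i\<in>UNIV. g y $ i * \<psi> i y)) = 0"
  proof (rule integral_eq_zero_AE)
    show "AE y in bal. (\<Sum>i\<in>UNIV. g y $ i * \<psi> i y) = 0"
      using rad
    proof eventually_elim
      case (elim y)
      have "(\<Sum>i\<in>UNIV. g y $ i * \<psi> i y) = moll \<epsilon> x y * (g y \<bullet> J y)"
        by (simp add: \<psi>_def inner_vec_def sum_distrib_left algebra_simps)
      also have "g y \<bullet> J y = (g y \<bullet> sgn y) * (sgn y \<bullet> J y)"
        by (subst elim) simp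
      also have "sgn y \<bullet> J y = 0"
        by (simp add: sgn_div_norm J_def inner_diff_right inner_commute algebra_simps)
      finally show ?case by simp
    qed
  qed
  finally have "(LINT y|bal. (- 2) * (u y * (k y * ((y - x) \<bullet> J x)))) = 0"
    by (simp only: mult.left_commute minus_zero)
  then have "(LINT y|bal. u y * (k y * ((y - x) \<bullet> J x))) = 0"
    by simp
  then show ?thesis by (simp only: k_def J_def)
qed

text \<open>Integrating over the ball amounts to extending \<open>u\<close> by 0, so x may be any
  point, including those close to the boundary.\<close>

definition mollified :: "real \<Rightarrow> (real^'n \<Rightarrow> real) \<Rightarrow> real^'n \<Rightarrow> real" where
  "mollified \<epsilon> u x = (LINT y|bal. u y * moll \<epsilon> x y)"

lemma mollified_integrable:
  assumes "W0 u g"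
  shows "integrable bal (\<lambda>y. u y * moll \<epsilon> x y)"
proof (rule integrable_mult_bounded[OF W0_integrable(1)[OF assms]])
  show "\<bar>moll \<epsilon> x y\<bar> \<le> 1" for y using moll_bounds[of \<epsilon> x y] by linarith
qed measurable

text \<open>Along the circle spanned by \<open>a\<close> and \<open>b\<close> the rotation generator
  at the current point is \<rho>^2 times the velocity. Differentiating under the integral therefore
  gives a multiple of the integral in \<open>mollified_tangential_zero\<close>, so the mollification
  is constant on the circle.\<close>

lemma mollified_circle:
  assumes W: "W0 u g" and rad: "AE x in bal. g x = (g x \<bullet> sgn x) *\<^sub>R sgn x"
    and ab: "norm a = \<rho>" "norm b = \<rho>" "a \<bullet> b = 0" "\<rho> > 0"
  shows "mollified \<epsilon> u (cos t *\<^sub>R a + sin t *\<^sub>R b) = mollified \<epsilon> u a"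
proof -
  define \<gamma> where "\<gamma> t = cos t *\<^sub>R a + sin t *\<^sub>R b" for t
  define \<gamma>' where "\<gamma>' t = cos t *\<^sub>R b - sin t *\<^sub>R a" for t
  define k where "k t y = flat_exp 2 (\<epsilon> - (y - \<gamma> t) \<bullet> (y - \<gamma> t)) * (2 * ((y - \<gamma> t) \<bullet> \<gamma>' t))" for t y
  have um [measurable]: "u \<in> borel_measurable borel" using W0_measurable[OF W] by auto
  have aa: "a \<bullet> a = \<rho>\<^sup>2" "b \<bullet> b = \<rho>\<^sup>2" using ab by (simp_all add: power2_norm_eq_inner[symmetric])
  have n\<gamma>: "norm (\<gamma> t) \<le> 2 * \<rho>" "norm (\<gamma>' t) \<le> 2 * \<rho>" for t
  proof -
    have "\<bar>cos t\<bar> * \<rho> \<le> 1 * \<rho>" "\<bar>sin t\<bar> * \<rho> \<le> 1 * \<rho>" using ab(4) by (intro mult_right_mono; simp)+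
    moreover have "norm (\<gamma> t) \<le> \<bar>cos t\<bar> * \<rho> + \<bar>sin t\<bar> * \<rho>"
      using norm_triangle_ineq[of "cos t *\<^sub>R a" "sin t *\<^sub>R b"] by (simp add: \<gamma>_def ab)
    moreover have "norm (\<gamma>' t) \<le> \<bar>cos t\<bar> * \<rho> + \<bar>sin t\<bar> * \<rho>"
      using norm_triangle_ineq4[of "cos t *\<^sub>R b" "sin t *\<^sub>R a"] by (simp add: \<gamma>'_def ab)
    ultimately show "norm (\<gamma> t) \<le> 2 * \<rho>" "norm (\<gamma>' t) \<le> 2 * \<rho>" by linarith+
  qed
  have d\<gamma>: "(\<gamma> has_vector_derivative \<gamma>' t) (at t)" for t
    unfolding \<gamma>_def[abs_def] \<gamma>'_def by (auto intro!: derivative_eq_intros simp: algebra_simps)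
  have dk: "((\<lambda>t. moll \<epsilon> (\<gamma> t) y) has_real_derivative k t y) (at t)" for t y
  proof -
    have "((\<lambda>t. \<epsilon> - (y - \<gamma> t) \<bullet> (y - \<gamma> t)) has_derivative (\<lambda>s. s * (2 * ((y - \<gamma> t) \<bullet> \<gamma>' t)))) (at t)"
      by (rule derivative_eq_intros d\<gamma>[unfolded has_vector_derivative_def] refl)+ (auto simp: inner_commute algebra_simps)
    then have "((\<lambda>t. \<epsilon> - (y - \<gamma> t) \<bullet> (y - \<gamma> t)) has_real_derivative (2 * ((y - \<gamma> t) \<bullet> \<gamma>' t))) (at t)"
      unfolding has_field_derivative_def by (rule has_derivative_eq_rhs) (simp add: fun_eq_iff)
    from DERIV_chain2[OF flat_exp_0_deriv this] show ?thesis
      by (simp add: moll_def k_def)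
  qed
  \<comment> \<open>The factors are the bound 2 for \<open>flat_exp 2\<close>, the 2 from
    differentiating the square, and Cauchy-Schwarz with the crude bound 2 \<rho> for the curve and
    its velocity.\<close>
  define B where "B = 2 * (2 * ((R + 2 * \<rho>) * (2 * \<rho>)))"
  have kb: "\<bar>k t y\<bar> \<le> B" if "norm y < R" for t y
  proof -
    have "\<bar>(y - \<gamma> t) \<bullet> \<gamma>' t\<bar> \<le> norm (y - \<gamma> t) * norm (\<gamma>' t)" by (rule Cauchy_Schwarz_ineq2)
    also have "\<dots> \<le> (R + 2 * \<rho>) * (2 * \<rho>)"
      using norm_triangle_ineq4[of y "\<gamma> t"] that n\<gamma>[of t] ab(4) R_pos by (intro mult_mono) auto
    finally have 1: "\<bar>(y - \<gamma> t) \<bullet> \<gamma>' t\<bar> \<le> (R + 2 * \<rho>) * (2 * \<rho>)" .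
    have "\<bar>k t y\<bar> = flat_exp 2 (\<epsilon> - (y - \<gamma> t) \<bullet> (y - \<gamma> t)) * (2 * \<bar>(y - \<gamma> t) \<bullet> \<gamma>' t\<bar>)"
      using flat_exp_2_bounds by (simp add: k_def abs_mult)
    also have "\<dots> \<le> 2 * (2 * ((R + 2 * \<rho>) * (2 * \<rho>)))"
      using flat_exp_2_bounds 1 by (intro mult_mono) auto
    finally show ?thesis by (simp add: B_def)
  qed
  have intm: "integrable bal (\<lambda>y. u y * moll \<epsilon> x y)" for x
    by (rule mollified_integrable[OF W])
  have zero: "(LINT y|bal. u y * k t y) = 0" for t
  proof -
    have J: "(a \<bullet> \<gamma> t) *\<^sub>R b - (b \<bullet> \<gamma> t) *\<^sub>R a = \<rho>\<^sup>2 *\<^sub>R \<gamma>' t"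
      using ab(3) by (simp add: \<gamma>_def \<gamma>'_def inner_add_right aa inner_commute[of b a] algebra_simps)
    have "(LINT y|bal. u y * (flat_exp 2 (\<epsilon> - (y - \<gamma> t) \<bullet> (y - \<gamma> t)) * ((y - \<gamma> t) \<bullet> (\<rho>\<^sup>2 *\<^sub>R \<gamma>' t)))) = 0"
      using mollified_tangential_zero[OF W rad, of \<epsilon> "\<gamma> t" a b] unfolding J .
    then have "(LINT y|bal. (\<rho>\<^sup>2 / 2) * (u y * k t y)) = 0"
      by (simp add: k_def mult_ac)
    then show ?thesis using ab(4) by simp
  qed
  have "((\<lambda>t. mollified \<epsilon> u (\<gamma> t)) has_real_derivative 0) (at t)" for t
    unfolding DERIV_def tendsto_at_iff_sequentially
  proof (intro allI impI)
    fix X :: "nat \<Rightarrow> real" assume X: "\<forall>i. X i \<in> UNIV - {0}" "X \<longlonglongrightarrow> 0"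
    have "(\<lambda>n. LINT y|bal. u y * ((moll \<epsilon> (\<gamma> (t + X n)) y - moll \<epsilon> (\<gamma> t) y) / X n)) \<longlonglongrightarrow> (LINT y|bal. u y * k t y)"
    proof (rule integral_dominated_convergence[where w = "\<lambda>y. \<bar>u y\<bar> * B"])
      show "(\<lambda>y. u y * k t y) \<in> borel_measurable bal" unfolding k_def by measurable
      show "integrable bal (\<lambda>y. \<bar>u y\<bar> * B)" using W0_integrable(1)[OF W] by simp
      show "AE y in bal. (\<lambda>n. u y * ((moll \<epsilon> (\<gamma> (t + X n)) y - moll \<epsilon> (\<gamma> t) y) / X n)) \<longlonglongrightarrow> u y * k t y"
      proof (intro AE_I2 tendsto_mult_left)
        fix y
        have "((\<lambda>s. (moll \<epsilon> (\<gamma> (t + s)) y - moll \<epsilon> (\<gamma> t) y) / s) \<longlongrightarrow> k t y) (at 0)"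
          using dk[of y t] by (simp add: DERIV_def)
        then show "(\<lambda>n. (moll \<epsilon> (\<gamma> (t + X n)) y - moll \<epsilon> (\<gamma> t) y) / X n) \<longlonglongrightarrow> k t y"
          using X unfolding tendsto_at_iff_sequentially by (simp add: o_def)
      qed
      show "AE y in bal. norm (u y * ((moll \<epsilon> (\<gamma> (t + X n)) y - moll \<epsilon> (\<gamma> t) y) / X n)) \<le> \<bar>u y\<bar> * B" for n
        using AE_bal_nonzero
      proof eventually_elim
        case (elim y)
        have "norm (moll \<epsilon> (\<gamma> (t + X n)) y - moll \<epsilon> (\<gamma> t) y) \<le> B * norm (t + X n - t)"
          by (rule field_differentiable_bound[of UNIV "\<lambda>t. moll \<epsilon> (\<gamma> t) y" "\<lambda>t. k t y"]) (use dk kb elim in auto)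
        moreover have "X n \<noteq> 0" using X by auto
        ultimately have "\<bar>(moll \<epsilon> (\<gamma> (t + X n)) y - moll \<epsilon> (\<gamma> t) y) / X n\<bar> \<le> B"
          by (simp add: abs_divide pos_divide_le_eq)
        then show ?case unfolding real_norm_def abs_mult by (rule mult_left_mono) simp
      qed
    qed (simp_all)
    moreover have "(LINT y|bal. u y * ((moll \<epsilon> (\<gamma> (t + X n)) y - moll \<epsilon> (\<gamma> t) y) / X n)) = (mollified \<epsilon> u (\<gamma> (t + X n)) - mollified \<epsilon> u (\<gamma> t)) / X n" for n
    proof -
      have "(LINT y|bal. u y * ((moll \<epsilon> (\<gamma> (t + X n)) y - moll \<epsilon> (\<gamma> t) y) / X n)) = (LINT y|bal. (u y * moll \<epsilon> (\<gamma> (t + X n)) y - u y * moll \<epsilon> (\<gamma> t) y) / X n)"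
        by (simp only: right_diff_distrib times_divide_eq_right)
      also have "\<dots> = (LINT y|bal. u y * moll \<epsilon> (\<gamma> (t + X n)) y - u y * moll \<epsilon> (\<gamma> t) y) / X n"
        by (rule integral_divide_zero)
      finally show ?thesis
        unfolding mollified_def Bochner_Integration.integral_diff[OF intm intm] .
    qed
    ultimately show "((\<lambda>h. (mollified \<epsilon> u (\<gamma> (t + h)) - mollified \<epsilon> u (\<gamma> t)) / h) \<circ> X) \<longlonglongrightarrow> 0"
      by (simp only: o_def zero)
  qed
  then have "\<forall>t. ((\<lambda>t. mollified \<epsilon> u (\<gamma> t)) has_real_derivative 0) (at t)" by blast
  then have "mollified \<epsilon> u (\<gamma> t) = mollified \<epsilon> u (\<gamma> 0)"
    by (rule DERIV_isconst_all)
  then show ?thesis by (simp add: \<gamma>_def)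
qed

text \<open>Two points of equal norm lie on a common circle about the origin, found by splitting x'
  into its part along x and the orthogonal rest \<open>w\<close>. If \<open>w = 0\<close> the second
  axis of the circle has to come from elsewhere, and it exists because the dimension is at least
  2.\<close>

lemma mollified_radial:
  assumes W: "W0 u g" and rad: "AE x in bal. g x = (g x \<bullet> sgn x) *\<^sub>R sgn x"
    and N2: "CARD('n) \<ge> 2" and eq: "norm x = norm x'"
  shows "mollified \<epsilon> u x = mollified \<epsilon> u x'"
proof (cases "x = (0 :: real^'n)")
  case True
  then show ?thesis using eq by simp
next
  case False
  define \<rho> where "\<rho> = norm x"
  have \<rho>: "\<rho> > 0" using False by (simp add: \<rho>_def)
  have xx: "x \<bullet> x = \<rho>\<^sup>2" "x' \<bullet> x' = \<rho>\<^sup>2" using eq by (simp_all add: \<rho>_def power2_norm_eq_inner[symmetric])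
  define c where "c = (x \<bullet> x') / \<rho>\<^sup>2"
  define w where "w = x' - c *\<^sub>R x"
  have wx: "x \<bullet> w = 0" using \<rho> by (simp add: w_def c_def inner_diff_right xx)
  have x': "x' = c *\<^sub>R x + w" by (simp add: w_def)
  have ww: "\<rho>\<^sup>2 = c\<^sup>2 * \<rho>\<^sup>2 + w \<bullet> w"
  proof -
    have "\<rho>\<^sup>2 = (c *\<^sub>R x + w) \<bullet> (c *\<^sub>R x + w)" using xx(2) x' by simp
    then show ?thesis using wx xx(1) by (simp add: inner_add_left inner_add_right inner_commute[of w x] power2_eq_square)
  qed
  obtain b s where b: "norm b = \<rho>" "x \<bullet> b = 0" "w = s *\<^sub>R b"
  proof (cases "w = 0")
    case True
    obtain z where z: "z \<noteq> 0" "orthogonal x z"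
      using orthogonal_to_vector_exists[of x] N2 by auto
    show ?thesis
      by (rule that[of "(\<rho> / norm z) *\<^sub>R z" 0]) (use z \<rho> True in \<open>auto simp: orthogonal_def\<close>)
  next
    case False
    show ?thesis
      by (rule that[of "(\<rho> / norm w) *\<^sub>R w" "norm w / \<rho>"]) (use False \<rho> wx in auto)
  qed
  have "c\<^sup>2 + s\<^sup>2 = 1"
  proof -
    have "w \<bullet> w = s\<^sup>2 * \<rho>\<^sup>2" using b by (simp add: power2_norm_eq_inner[symmetric] power_mult_distrib)
    then have "\<rho>\<^sup>2 * (c\<^sup>2 + s\<^sup>2) = \<rho>\<^sup>2 * 1" using ww by (simp add: algebra_simps)
    then show ?thesis using \<rho> by simp
  qed
  then obtain t where t: "c = cos t" "s = sin t" using sincos_total_2pi by metis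
  have "mollified \<epsilon> u (cos t *\<^sub>R x + sin t *\<^sub>R b) = mollified \<epsilon> u x"
    by (rule mollified_circle[OF W rad _ b(1) b(2) \<rho>]) (simp add: \<rho>_def)
  then show ?thesis using x' b(3) t by simp
qed

section \<open>Convergence of the mollifications\<close>

definition moll_mass :: "real \<Rightarrow> real" where
  "moll_mass \<epsilon> = (LINT z|(lborel :: (real^'n) measure). moll \<epsilon> 0 z)"

lemma moll_continuous: "continuous_on UNIV (moll \<epsilon> (x :: real^'n))"
proof -
  have "isCont (flat_exp 0) t" for t by (rule DERIV_isCont[OF flat_exp_0_deriv])
  then have "continuous_on UNIV (flat_exp 0)" by (simp add: continuous_at_imp_continuous_on)
  then show ?thesis unfolding moll_def[abs_def]
    by (rule continuous_on_compose2) (auto intro!: continuous_intros)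
qed

lemma moll_integrable: "integrable lborel (moll \<epsilon> (x :: real^'n))"
proof (rule Ck_integrable[OF moll_continuous])
  show "compact (cball x (sqrt \<epsilon>))" by simp
  show "moll \<epsilon> x y = 0" if "y \<notin> cball x (sqrt \<epsilon>)" for y
    using that moll_support[of \<epsilon> x y] by (force simp: dist_norm norm_minus_commute)
qed

lemma moll_integral: "(LINT y|lborel. moll \<epsilon> (x :: real^'n) y) = moll_mass \<epsilon>"
proof -
  have "(LINT y|lborel. moll \<epsilon> x y) = (LINT y|distr lborel borel ((+) x). moll \<epsilon> x y)"
    by (simp add: lborel_distr_plus)
  also have "\<dots> = (LINT z|lborel. moll \<epsilon> x (x + z))"
    by (rule integral_distr) auto
  also have "\<dots> = moll_mass \<epsilon>" by (simp add: moll_mass_def moll_def)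
  finally show ?thesis .
qed

lemma moll_mass_pos: "\<epsilon> > 0 \<Longrightarrow> moll_mass \<epsilon> > 0"
proof -
  assume \<epsilon>: "\<epsilon> > 0"
  have "moll_mass \<epsilon> \<ge> 0" unfolding moll_mass_def by (simp add: moll_bounds)
  moreover have "moll_mass \<epsilon> \<noteq> 0"
  proof
    assume "moll_mass \<epsilon> = 0"
    then have "AE z in lborel. moll \<epsilon> (0 :: real^'n) z = 0"
      unfolding moll_mass_def by (subst (asm) integral_nonneg_eq_0_iff_AE[OF moll_integrable]) (auto simp: moll_bounds)
    then have "AE z in lborel. (z :: real^'n) \<notin> ball 0 (sqrt \<epsilon>)"
    proof eventually_elim
      case (elim z)
      show ?case
      proof
        assume "z \<in> ball 0 (sqrt \<epsilon>)"
        then have "norm z < sqrt \<epsilon>" by simp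
        then have "z \<bullet> z < \<epsilon>" by (simp add: norm_eq_sqrt_inner)
        then have "moll \<epsilon> 0 z > 0" by (simp add: moll_def flat_exp_def)
        with elim show False by simp
      qed
    qed
    then have "(ball 0 (sqrt \<epsilon>) :: (real^'n) set) \<in> null_sets lborel"
      by (subst AE_iff_null_sets) auto
    then have "measure lborel (ball 0 (sqrt \<epsilon>) :: (real^'n) set) = 0"
      by (simp add: null_sets_def measure_def)
    moreover have "measure lborel (ball 0 (sqrt \<epsilon>) :: (real^'n) set) > 0"
      using \<epsilon> by (intro content_ball_pos) simp
    ultimately show False by simp
  qed
  ultimately show ?thesis by simp
qed

lemma nn_integral_moll: "(\<integral>\<^sup>+x. ennreal (moll \<epsilon> x (y :: real^'n)) \<partial>lborel) = ennreal (moll_mass \<epsilon>)"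
  unfolding moll_commute[of \<epsilon> _ y] moll_integral[of \<epsilon> y, symmetric]
  by (rule nn_integral_eq_integral[OF moll_integrable]) (simp add: moll_bounds)

lemma test_lipschitz:
  assumes \<phi>: "\<phi> \<in> tst" and B: "\<And>x. norm (grad \<phi> x) \<le> B"
  shows "\<bar>\<phi> y - \<phi> x\<bar> \<le> B * norm (y - x)"
proof -
  have "norm (\<phi> y - \<phi> x) \<le> B * norm (y - x)"
  proof (rule differentiable_bound[of UNIV \<phi> "\<lambda>x v. grad \<phi> x \<bullet> v"])
    show "(\<phi> has_derivative (\<bullet>) (grad \<phi> x)) (at x within UNIV)" for x
      using has_derivative_grad[OF test_functions_differentiable[OF \<phi>]] by simp
    show "onorm ((\<bullet>) (grad \<phi> x)) \<le> B" for x
    proof (rule onorm_le)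
      fix v
      have "\<bar>grad \<phi> x \<bullet> v\<bar> \<le> norm (grad \<phi> x) * norm v" by (rule Cauchy_Schwarz_ineq2)
      also have "\<dots> \<le> B * norm v" by (intro mult_right_mono B) simp
      finally show "norm (grad \<phi> x \<bullet> v) \<le> B * norm v" by simp
    qed
  qed auto
  then show ?thesis by simp
qed

text \<open>Approximate \<open>u\<close> in L1 by a test function. By Fubini, normalised
  mollification does not increase the L1 norm, and it moves the test function by at most its
  Lipschitz constant times the radius of the kernel. As the test function vanishes outside the ball,
  cutting the convolution off there does not change its mollification.\<close>

lemma mollified_L1:
  assumes W: "W0 u g" and \<delta>: "\<delta> > 0"
  shows "\<exists>\<epsilon>>0. (\<integral>\<^sup>+x. ennreal \<bar>mollified \<epsilon> u x / moll_mass \<epsilon> - u x\<bar> \<partial>bal) \<le> ennreal \<delta>"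
proof -
  define V where "V = measure bal UNIV"
  have V: "V \<ge> 0" "emeasure bal UNIV = ennreal V"
    using finite_measure.emeasure_eq_measure[OF finite_measure_ballM] by (auto simp: V_def)
  \<comment> \<open>The final error is a sum of three parts: \<eta> for the mollified approximation
    error, \<eta> V for the displacement of the test function over the ball of volume V, and \<eta>
    for the approximation error itself.\<close>
  define \<eta> where "\<eta> = \<delta> / (V + 2)"
  have "\<eta> * (V + 2) = \<delta>" using V(1) by (simp add: \<eta>_def)
  then have "\<eta> + \<eta> * V + \<eta> = \<delta>" by (simp add: algebra_simps)
  moreover have "\<eta> > 0" using \<delta> V(1) by (simp add: \<eta>_def)
  ultimately have \<eta>: "\<eta> > 0" "\<eta> + \<eta> * V + \<eta> = \<delta>" by simp_all
  obtain \<phi> where \<phi>: "\<phi> \<in> tst" "(\<integral>\<^sup>+x. ennreal (norm (u x - \<phi> x)) \<partial>bal) \<le> ennreal \<eta>"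
    by (rule W0_L1[OF W \<eta>(1)])
  obtain B where B: "B > 0" "\<And>x. norm (grad \<phi> x) \<le> B"
    using test_functions_bounds[OF \<phi>(1)] by blast
  \<comment> \<open>The kernel then has radius \<eta> / B, over which a function with Lipschitz
    constant B varies by at most \<eta>.\<close>
  define \<epsilon> where "\<epsilon> = (\<eta> / B)\<^sup>2"
  have \<epsilon>: "\<epsilon> > 0" "sqrt \<epsilon> = \<eta> / B" using \<eta> B by (auto simp: \<epsilon>_def)
  define c where "c = moll_mass \<epsilon>"
  have c: "c > 0" unfolding c_def by (rule moll_mass_pos[OF \<epsilon>(1)])
  have um [measurable]: "u \<in> borel_measurable borel" using W0_measurable[OF W] by auto
  have \<phi>m [measurable]: "\<phi> \<in> borel_measurable borel" using test_functions_measurable[OF \<phi>(1)] by auto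
  have W\<phi>: "W0 (\<lambda>x. u x - \<phi> x) (\<lambda>x. g x - grad \<phi> x)"
    using W0_lincomb[OF W W0_test[OF \<phi>(1)], of 1 "-1"] by simp
  define D where "D x = (\<integral>\<^sup>+y. ennreal (\<bar>u y - \<phi> y\<bar> * moll \<epsilon> x y) \<partial>bal)" for x
  interpret finite_measure bal by (rule finite_measure_ballM)
  have Dm [measurable]: "D \<in> borel_measurable borel" unfolding D_def[abs_def] by measurable
  have pw: "ennreal \<bar>mollified \<epsilon> u x / c - u x\<bar> \<le> ennreal (1 / c) * D x + ennreal \<eta> + ennreal \<bar>u x - \<phi> x\<bar>" for x
  proof -
    define m1 where "m1 = (LINT y|bal. (u y - \<phi> y) * moll \<epsilon> x y)"
    have i1: "integrable bal (\<lambda>y. (u y - \<phi> y) * moll \<epsilon> x y)" by (rule mollified_integrable[OF W\<phi>])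
    have e1: "mollified \<epsilon> u x = m1 + mollified \<epsilon> \<phi> x"
      unfolding mollified_def m1_def
      by (subst Bochner_Integration.integral_add[OF i1 mollified_integrable[OF W0_test[OF \<phi>(1)]], symmetric]) (simp add: algebra_simps)
    have "\<phi> y = 0" if "y \<notin> ball 0 R" for y
      using test_functions_support[OF \<phi>(1)] that by blast
    then have e2: "mollified \<epsilon> \<phi> x = (LINT y|lborel. \<phi> y * moll \<epsilon> x y)"
      unfolding mollified_def by (subst integral_ballM_lborel) (auto intro!: Bochner_Integration.integral_cong simp: indicator_def)
    have e3: "c * \<phi> x = (LINT y|lborel. \<phi> x * moll \<epsilon> x y)"
      by (simp add: moll_integral c_def)
    obtain B1 where B1: "\<And>x. \<bar>\<phi> x\<bar> \<le> B1" using test_functions_bounds[OF \<phi>(1)] by blast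
    have i2: "integrable lborel (\<lambda>y. \<phi> y * moll \<epsilon> x y)"
      using integrable_mult_bounded[OF moll_integrable, of \<phi> B1] B1 by (simp add: mult.commute)
    have i3: "integrable lborel (\<lambda>y. \<phi> x * moll \<epsilon> x y)" using moll_integrable by simp
    have "\<bar>mollified \<epsilon> \<phi> x - c * \<phi> x\<bar> = \<bar>LINT y|lborel. \<phi> y * moll \<epsilon> x y - \<phi> x * moll \<epsilon> x y\<bar>"
      unfolding e2 e3 using i2 i3 by simp
    also have "\<dots> \<le> (LINT y|lborel. \<eta> * moll \<epsilon> x y)"
    proof (rule integral_abs_bound_integral)
      show "integrable lborel (\<lambda>y. \<phi> y * moll \<epsilon> x y - \<phi> x * moll \<epsilon> x y)" using i2 i3 by simp
      show "integrable lborel (\<lambda>y. \<eta> * moll \<epsilon> x y)" using moll_integrable by simp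
      fix y
      show "\<bar>\<phi> y * moll \<epsilon> x y - \<phi> x * moll \<epsilon> x y\<bar> \<le> \<eta> * moll \<epsilon> x y"
      proof (cases "moll \<epsilon> x y = 0")
        case False
        then have "norm (y - x) < \<eta> / B" using moll_support[of \<epsilon> x y] \<epsilon> by simp
        then have "B * norm (y - x) \<le> \<eta>" using B(1) by (simp add: pos_less_divide_eq mult.commute)
        then have "\<bar>\<phi> y - \<phi> x\<bar> \<le> \<eta>" using test_lipschitz[OF \<phi>(1) B(2), of y x] by linarith
        then have "\<bar>\<phi> y - \<phi> x\<bar> * moll \<epsilon> x y \<le> \<eta> * moll \<epsilon> x y" by (intro mult_right_mono moll_bounds)
        then show ?thesis using moll_bounds[of \<epsilon> x y] by (simp add: abs_mult flip: left_diff_distrib)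
      qed simp
    qed
    also have "\<dots> = \<eta> * c" by (simp add: moll_integral c_def)
    finally have 2: "\<bar>mollified \<epsilon> \<phi> x - c * \<phi> x\<bar> \<le> \<eta> * c" .
    have "mollified \<epsilon> u x / c - u x = m1 / c + (mollified \<epsilon> \<phi> x - c * \<phi> x) / c + (\<phi> x - u x)"
      using c by (simp add: e1 field_simps)
    then have "\<bar>mollified \<epsilon> u x / c - u x\<bar> \<le> \<bar>m1 / c\<bar> + \<bar>(mollified \<epsilon> \<phi> x - c * \<phi> x) / c\<bar> + \<bar>\<phi> x - u x\<bar>"
      by linarith
    also have "\<bar>(mollified \<epsilon> \<phi> x - c * \<phi> x) / c\<bar> \<le> \<eta>"
      using 2 c by (simp add: abs_divide pos_divide_le_eq)
    finally have "\<bar>mollified \<epsilon> u x / c - u x\<bar> \<le> 1 / c * \<bar>m1\<bar> + \<eta> + \<bar>u x - \<phi> x\<bar>"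
      using c by (simp add: abs_divide abs_minus_commute)
    then have "ennreal \<bar>mollified \<epsilon> u x / c - u x\<bar> \<le> ennreal (1 / c * \<bar>m1\<bar> + \<eta> + \<bar>u x - \<phi> x\<bar>)"
      by (rule ennreal_leI)
    also have "\<dots> = ennreal (1 / c) * ennreal \<bar>m1\<bar> + ennreal \<eta> + ennreal \<bar>u x - \<phi> x\<bar>"
      using c \<eta>(1) by (subst ennreal_mult[symmetric], simp, simp, subst ennreal_plus[symmetric], simp, simp, subst ennreal_plus[symmetric]) auto
    also have "\<dots> \<le> ennreal (1 / c) * D x + ennreal \<eta> + ennreal \<bar>u x - \<phi> x\<bar>"
    proof (intro add_right_mono mult_left_mono)
      have "ennreal \<bar>m1\<bar> \<le> (\<integral>\<^sup>+y. ennreal (norm ((u y - \<phi> y) * moll \<epsilon> x y)) \<partial>bal)"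
        using integral_norm_bound_ennreal[OF i1] by (simp add: m1_def)
      then show "ennreal \<bar>m1\<bar> \<le> D x" by (simp add: D_def abs_mult moll_bounds)
    qed simp
    finally show ?thesis .
  qed
  have "(\<integral>\<^sup>+x. ennreal \<bar>mollified \<epsilon> u x / c - u x\<bar> \<partial>bal) \<le> (\<integral>\<^sup>+x. ennreal (1 / c) * D x + ennreal \<eta> + ennreal \<bar>u x - \<phi> x\<bar> \<partial>bal)"
    by (intro nn_integral_mono pw)
  also have "\<dots> = ennreal (1 / c) * (\<integral>\<^sup>+x. D x \<partial>bal) + ennreal \<eta> * emeasure bal UNIV + (\<integral>\<^sup>+x. ennreal \<bar>u x - \<phi> x\<bar> \<partial>bal)"
    by (simp add: nn_integral_add nn_integral_cmult)
  also have "\<dots> \<le> ennreal \<eta> + ennreal \<eta> * ennreal V + ennreal \<eta>"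
  proof (intro add_mono)
    interpret P: pair_sigma_finite bal bal
      by (intro pair_sigma_finite.intro sigma_finite_measure_axioms)
    have "(\<integral>\<^sup>+x. D x \<partial>bal) = (\<integral>\<^sup>+y. (\<integral>\<^sup>+x. ennreal (\<bar>u y - \<phi> y\<bar> * moll \<epsilon> x y) \<partial>bal) \<partial>bal)"
      unfolding D_def by (rule P.Fubini'[symmetric]) measurable
    also have "\<dots> \<le> (\<integral>\<^sup>+y. ennreal c * ennreal \<bar>u y - \<phi> y\<bar> \<partial>bal)"
    proof (rule nn_integral_mono)
      fix y
      have 1: "(\<integral>\<^sup>+x. ennreal (\<bar>u y - \<phi> y\<bar> * moll \<epsilon> x y) \<partial>bal) = ennreal \<bar>u y - \<phi> y\<bar> * (\<integral>\<^sup>+x. ennreal (moll \<epsilon> x y) \<partial>bal)"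
        by (subst nn_integral_cmult[symmetric]) (auto simp: ennreal_mult moll_bounds)
      have 2: "(\<integral>\<^sup>+x. ennreal (moll \<epsilon> x y) \<partial>bal) \<le> ennreal c"
        unfolding c_def nn_integral_moll[of \<epsilon> y, symmetric]
        by (subst nn_integral_ballM_lborel) (auto intro!: nn_integral_mono simp: indicator_def)
      show "(\<integral>\<^sup>+x. ennreal (\<bar>u y - \<phi> y\<bar> * moll \<epsilon> x y) \<partial>bal) \<le> ennreal c * ennreal \<bar>u y - \<phi> y\<bar>"
        unfolding 1 using mult_left_mono[OF 2, of "ennreal \<bar>u y - \<phi> y\<bar>"] by (simp only: mult.commute zero_le)
    qed
    also have "\<dots> = ennreal c * (\<integral>\<^sup>+y. ennreal \<bar>u y - \<phi> y\<bar> \<partial>bal)"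
      by (rule nn_integral_cmult) simp
    also have "\<dots> \<le> ennreal c * ennreal \<eta>"
      using \<phi>(2) by (intro mult_left_mono) auto
    finally have "ennreal (1 / c) * (\<integral>\<^sup>+x. D x \<partial>bal) \<le> ennreal (1 / c) * (ennreal c * ennreal \<eta>)"
      by (intro mult_left_mono) auto
    also have "\<dots> = ennreal \<eta>"
      using c \<eta>(1) by (simp flip: ennreal_mult)
    finally show "ennreal (1 / c) * (\<integral>\<^sup>+x. D x \<partial>bal) \<le> ennreal \<eta>" .
    show "ennreal \<eta> * emeasure bal UNIV \<le> ennreal \<eta> * ennreal V" by (simp add: V)
    show "(\<integral>\<^sup>+x. ennreal \<bar>u x - \<phi> x\<bar> \<partial>bal) \<le> ennreal \<eta>" using \<phi>(2) by simp
  qed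
  also have "\<dots> = ennreal \<delta>"
    using \<eta> V(1) by (simp flip: ennreal_mult ennreal_plus)
  finally show ?thesis using \<epsilon>(1) unfolding c_def by blast
qed

text \<open>L1 convergence at a geometric rate gives convergence almost everywhere without passing
  to a subsequence, and a limit of functions of the norm is a function of the norm.\<close>

lemma W0_radial_gradient:
  assumes W: "W0 u g" and rad: "AE x in bal. g x = (g x \<bullet> sgn x) *\<^sub>R sgn x" and N2: "CARD('n) \<ge> 2"
  shows "\<exists>f. AE x in bal. u x = f (norm x)"
proof -
  have um [measurable]: "u \<in> borel_measurable borel" using W0_measurable[OF W] by auto
  have "\<forall>n::nat. \<exists>\<epsilon>. \<epsilon> > 0 \<and> (\<integral>\<^sup>+x. ennreal \<bar>mollified \<epsilon> u x / moll_mass \<epsilon> - u x\<bar> \<partial>bal) \<le> ennreal ((1/2)^n)"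
  proof
    fix n :: nat
    have "(0::real) < (1/2)^n" by simp
    from mollified_L1[OF W this] show "\<exists>\<epsilon>. \<epsilon> > 0 \<and> (\<integral>\<^sup>+x. ennreal \<bar>mollified \<epsilon> u x / moll_mass \<epsilon> - u x\<bar> \<partial>bal) \<le> ennreal ((1/2)^n)"
      by blast
  qed
  from choice[OF this] obtain \<epsilon> where \<epsilon>: "\<And>n. (\<integral>\<^sup>+x. ennreal \<bar>mollified (\<epsilon> n) u x / moll_mass (\<epsilon> n) - u x\<bar> \<partial>bal) \<le> ennreal ((1/2)^n)"
    by blast
  define U where "U n x = mollified (\<epsilon> n) u x / moll_mass (\<epsilon> n)" for n x
  interpret finite_measure bal by (rule finite_measure_ballM)
  have [measurable]: "U n \<in> borel_measurable borel" for n
    unfolding U_def[abs_def] mollified_def by measurable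
  have "(\<integral>\<^sup>+x. (\<Sum>n. ennreal \<bar>U n x - u x\<bar>) \<partial>bal) = (\<Sum>n. (\<integral>\<^sup>+x. ennreal \<bar>U n x - u x\<bar> \<partial>bal))"
    by (rule nn_integral_suminf) simp
  also have "\<dots> \<le> (\<Sum>n. ennreal ((1/2)^n))"
    using \<epsilon> by (intro suminf_le) (auto simp: U_def)
  also have "\<dots> < \<infinity>"
  proof -
    have "summable (\<lambda>n. (1/2::real)^n)" by (intro summable_geometric) auto
    then have "(\<Sum>n. ennreal ((1/2)^n)) = ennreal (\<Sum>n. (1/2)^n)"
      by (intro suminf_ennreal2) auto
    then show ?thesis by simp
  qed
  finally have "AE x in bal. (\<Sum>n. ennreal \<bar>U n x - u x\<bar>) \<noteq> \<infinity>"
    by (intro nn_integral_PInf_AE) auto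
  then have conv: "AE x in bal. (\<lambda>n. U n x) \<longlonglongrightarrow> u x"
  proof eventually_elim
    case (elim x)
    then have "summable (\<lambda>n. \<bar>U n x - u x\<bar>)" by (intro summable_suminf_not_top) auto
    then have "(\<lambda>n. \<bar>U n x - u x\<bar>) \<longlonglongrightarrow> 0" by (rule summable_LIMSEQ_zero)
    then show ?case by (simp add: tendsto_rabs_zero_iff LIM_zero_iff)
  qed
  define e where "e = (axis undefined 1 :: real^'n)"
  \<comment> \<open>Reading the limit off a single half-line is legitimate although it may be a null
    set: the approximants are defined everywhere and constant on spheres, so convergence at one
    point of a sphere is convergence on all of it.\<close>
  define f where "f r = lim (\<lambda>n. U n (r *\<^sub>R e))" for r
  have Ur: "U n x = U n (norm x *\<^sub>R e)" for n x
    unfolding U_def using mollified_radial[OF W rad N2, of x "norm x *\<^sub>R e"] by (simp add: e_def norm_axis_1)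
  have "AE x in bal. u x = f (norm x)"
    using conv
  proof eventually_elim
    case (elim x)
    then have "lim (\<lambda>n. U n x) = u x" by (rule limI)
    then show ?case unfolding f_def Ur[of _ x] by simp
  qed
  then show ?thesis by blast
qed

end

section \<open>Minimizers\<close>

context radial_problem
begin

text \<open>A minimizer comes as an arbitrary Lebesgue measurable representative with a selected
  gradient. It is traded here for a pair in \<open>W0\<close>, in terms of which its radial
  derivative and its finite energy are expressed.\<close>

lemma minimizer_dataE:
  assumes "minimizer R p W G v"
  obtains u g e where "W0 u g" "AE x in bal. v x = u x" "v \<in> borel_measurable lebB"
    "energy R W G v = ereal e" "AE x in bal. radial_deriv (ball 0 R) v x = g x \<bullet> sgn x"
proof -
  have vW: "v \<in> W1p_0 (ball 0 R) p" using assms by (simp add: minimizer_def)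
  then have vm: "v \<in> borel_measurable lebB" by (simp add: W1p_0_def W1p_def Lp_space_def)
  obtain u g where W: "W0 u g" "AE x in bal. v x = u x" by (rule W1p_0_imp_W0[OF vW])
  have rd: "AE x in bal. radial_deriv (ball 0 R) v x = g x \<bullet> sgn x"
    using W0_wgrad[OF W(1) vm W(2)] by eventually_elim (simp add: radial_deriv_def sgn_div_norm)
  show ?thesis
    by (rule that[OF W vm energy_integrable(3)[OF W(1) vm W(2) minimizer_energy_finite[OF assms]] rd])
qed

lemma radial_deriv_radial:
  assumes "rprof h" "v \<in> borel_measurable lebB" "AE x in bal. v x = wint R h (norm x)"
  shows "AE x in bal. radial_deriv (ball 0 R) v x = - h (norm x)"
  using radial_in_W1p_0(2)[OF assms] AE_bal_nonzero
proof eventually_elim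
  case (elim x)
  have "sgn x \<bullet> sgn x = 1" using elim by (simp add: norm_sgn power2_norm_eq_inner[symmetric])
  then show ?case using elim(1) by (simp add: radial_deriv_def sgn_div_norm[symmetric])
qed

lemma radially_symmetric_onI: "AE x in bal. v x = f (norm x) \<Longrightarrow> radially_symmetric_on (ball 0 R) v"
  unfolding radially_symmetric_on_def AE_ballM by (rule exI)

lemma minimizing_profile:
  assumes "minimizer R p W G v"
  obtains h e where "adm h" "J h = e" "energy R W G v = ereal e"
proof -
  obtain u g e where W: "W0 u g" "AE x in bal. v x = u x" and vm: "v \<in> borel_measurable lebB"
    and e: "energy R W G v = ereal e" and rd: "AE x in bal. radial_deriv (ball 0 R) v x = g x \<bullet> sgn x"
    by (rule minimizer_dataE[OF assms])
  have "AE y in sph. adm (\<lambda>r. - (g (r *\<^sub>R sgn y) \<bullet> sgn y)) \<and> J (\<lambda>r. - (g (r *\<^sub>R sgn y) \<bullet> sgn y)) = e"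
    using minimizer_profiles(1)[OF assms e W] by eventually_elim (simp only: simp_thms)
  then obtain y :: "real^'n" where "y \<noteq> 0" and y: "adm (\<lambda>r. - (g (r *\<^sub>R sgn y) \<bullet> sgn y)) \<and> J (\<lambda>r. - (g (r *\<^sub>R sgn y) \<bullet> sgn y)) = e"
    by (rule AE_sphM_ex)
  show ?thesis by (rule that[OF conjunct1[OF y] conjunct2[OF y] e])
qed

lemma ex_radial_minimizer:
  assumes "minimizer R p W G v"
  shows "\<exists>u. minimizer R p W G u \<and> radially_symmetric_on (ball 0 R) u"
proof -
  obtain h e where h: "adm h" "J h = e" "energy R W G v = ereal e" by (rule minimizing_profile[OF assms])
  have [measurable]: "h \<in> borel_measurable borel" using h(1) by (simp add: adm_def rprof_def)
  have m: "(\<lambda>x::real^'n. wint R h (norm x)) \<in> borel_measurable lebB"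
    by (rule borel_imp_lebB) simp
  have "minimizer R p W G (\<lambda>x. wint R h (norm x))"
    by (rule radial_le_imp_minimizer(1)[OF assms h(3,1) _ m]) (use h(2) in auto)
  moreover have "radially_symmetric_on (ball 0 R) (\<lambda>x::real^'n. wint R h (norm x))"
    by (rule radially_symmetric_onI[of _ "wint R h"]) simp
  ultimately show ?thesis by (intro exI[of _ "\<lambda>x. wint R h (norm x)"] conjI)
qed

lemma ex_decreasing_radial_minimizer:
  assumes min: "minimizer R p W G v" and G: "antimono_on {0..} G" "\<forall>\<mu>>0. G \<mu> \<le> G (- \<mu>)"
    and M0: "M0 \<ge> 0" "Wt constant_on {- M0..M0}"
  shows "\<exists>u. minimizer R p W G u \<and> radially_symmetric_on (ball 0 R) u \<and>
      (AE x in lebB. u x \<ge> 0) \<and> (AE x in lebB. radial_deriv (ball 0 R) u x \<le> - M0)"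
proof -
  obtain h e where h: "adm h" "J h = e" "energy R W G v = ereal e" by (rule minimizing_profile[OF min])
  have [measurable]: "h \<in> borel_measurable borel" using h(1) by (simp add: adm_def rprof_def)
  define u where "u x = wint R (steep h) (norm x)" for x :: "real^'n"
  have m: "u \<in> borel_measurable lebB"
    unfolding u_def by (rule borel_imp_lebB) simp
  have u: "AE x in bal. u x = wint R (steep h) (norm x)" by (simp add: u_def)
  have "minimizer R p W G u"
    by (rule radial_le_imp_minimizer(1)[OF min h(3) steep_improves(1)[OF h(1) G] _ m u])
      (use steep_improves(2)[OF h(1) G] h(2) in simp)
  moreover have "radially_symmetric_on (ball 0 R) u"
    using u by (rule radially_symmetric_onI)
  moreover have "AE x in lebB. u x \<ge> 0"
    unfolding u_def by (intro AE_I2 wint_nonneg steep_ge)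
  moreover have "AE x in lebB. radial_deriv (ball 0 R) u x \<le> - M0"
    unfolding AE_ballM[symmetric] using radial_deriv_radial[OF rprof_steep[OF h(1)] m u]
  proof eventually_elim
    case (elim x)
    have "M0 \<le> steep h (norm x)" unfolding steep_def by (rule bet_ge_plateau[OF _ M0]) simp
    with elim show ?case by simp
  qed
  ultimately show ?thesis by (intro exI[of _ u] conjI)
qed

lemma star_imp_radially_symmetric:
  assumes min: "minimizer R p W G v" and star: "condition_star (ball 0 R) Wt v" and N2: "CARD('n) \<ge> 2"
  shows "radially_symmetric_on (ball 0 R) v"
proof -
  obtain u g e where W: "W0 u g" and vu: "AE x in bal. v x = u x" and vm: "v \<in> borel_measurable lebB"
    and e: "energy R W G v = ereal e" and rd: "AE x in bal. radial_deriv (ball 0 R) v x = g x \<bullet> sgn x"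
    by (rule minimizer_dataE[OF min])
  \<comment> \<open>In \<open>condition_star\<close> the quantifier over \<nu> stands outside the
    almost-everywhere statement. Over the countable set of rationals it may be moved inside; density
    and monotonicity of \<open>Wt\<close> make up for the missing values.\<close>
  have "AE x in bal. \<forall>\<nu>\<in>\<rat>. \<bar>\<nu>\<bar> > \<bar>radial_deriv (ball 0 R) v x\<bar> \<longrightarrow> Wt \<bar>\<nu>\<bar> > Wt \<bar>radial_deriv (ball 0 R) v x\<bar>"
  proof -
    have "\<forall>\<nu>\<in>\<rat>. AE x in bal. \<bar>\<nu>\<bar> > \<bar>radial_deriv (ball 0 R) v x\<bar> \<longrightarrow> Wt \<bar>\<nu>\<bar> > Wt \<bar>radial_deriv (ball 0 R) v x\<bar>"
      using star unfolding condition_star_def AE_ballM by (intro ballI) (rule spec)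
    then show ?thesis unfolding AE_ball_countable[OF countable_rat] .
  qed
  then have "AE x in bal. g x = (g x \<bullet> sgn x) *\<^sub>R sgn x"
    using rd minimizer_profiles(2)[OF min e W vu] AE_bal_nonzero
  proof eventually_elim
    case (elim x)
    define s where "s = sgn x"
    have s: "norm s = 1" "s \<bullet> s = 1" using elim(4) by (simp_all add: s_def norm_sgn power2_norm_eq_inner[symmetric])
    have le: "\<bar>g x \<bullet> s\<bar> \<le> norm (g x)" using Cauchy_Schwarz_ineq2[of "g x" s] s by simp
    have eq: "\<bar>g x \<bullet> s\<bar> = norm (g x)"
    proof (rule ccontr)
      assume "\<bar>g x \<bullet> s\<bar> \<noteq> norm (g x)"
      then have "\<bar>g x \<bullet> s\<bar> < norm (g x)" using le by simp
      \<comment> \<open>A rational value strictly between the modulus of the radial part and the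
        full norm would separate the two values of \<open>Wt\<close>, which are known to be
        equal.\<close>
      from Rats_dense_in_real[OF this]
      obtain q where q: "q \<in> \<rat>" "\<bar>g x \<bullet> s\<bar> < q" "q < norm (g x)" by (elim bexE conjE)
      have q0: "q \<ge> 0" using q(2) by linarith
      have "Wt \<bar>g x \<bullet> s\<bar> < Wt \<bar>q\<bar>"
        using elim(1)[rule_format, OF q(1)] q(2) q0 elim(2) by (simp add: s_def)
      moreover have "Wt q \<le> Wt (norm (g x))"
        using q0 q(3) by (intro mono_onD[OF Wt_mono]) auto
      ultimately show False using elim(3) q0 by (simp add: s_def)
    qed
    \<comment> \<open>Equality in the Cauchy-Schwarz inequality: the tangential part of the gradient
      has norm 0.\<close>
    have "(g x \<bullet> s)\<^sup>2 = g x \<bullet> g x"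
      using arg_cong[OF eq, of "\<lambda>t. t\<^sup>2"] by (simp add: power2_norm_eq_inner)
    then have "(g x - (g x \<bullet> s) *\<^sub>R s) \<bullet> (g x - (g x \<bullet> s) *\<^sub>R s) = 0"
      using s(2) inner_commute[of s "g x"]
      by (simp only: inner_diff_left inner_diff_right inner_scaleR_left inner_scaleR_right power2_eq_square)
        (simp add: algebra_simps)
    then have "g x - (g x \<bullet> s) *\<^sub>R s = 0" by (simp only: inner_eq_zero_iff)
    then show ?case unfolding s_def by (rule eq_iff_diff_eq_0[THEN iffD2])
  qed
  from W0_radial_gradient[OF W this N2] obtain f where f: "AE x in bal. u x = f (norm x)" by (rule exE)
  have "AE x in bal. v x = f (norm x)" using vu f by eventually_elim simp
  then show ?thesis by (rule radially_symmetric_onI)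
qed

lemma minimizing_profile_steep:
  assumes min: "minimizer R p W G v" and e: "energy R W G v = ereal e" and h: "adm h" "J h = e"
    and G: "strict_antimono_on {0..} G" "\<forall>\<mu>>0. G \<mu> \<le> G (- \<mu>)"
  shows "J (steep h) = J h" "adm (steep h)"
proof -
  note Ga = strict_antimono_imp_antimono[OF G(1)]
  show a: "adm (steep h)" by (rule steep_improves(1)[OF h(1) Ga G(2)])
  show "J (steep h) = J h"
    using steep_improves(2)[OF h(1) Ga G(2)] minimizer_le_J[OF min e a] h(2) by simp
qed

text \<open>Symmetry is not known at this stage, so the argument runs on almost every ray
  separately. The sign in \<open>minimal_profile_sign\<close> may differ from ray to ray, but either
  sign makes the modulus of the profile a fixed point of \<open>bet\<close>.\<close>

lemma strict_imp_star:
  assumes min: "minimizer R p W G v" and G: "strict_antimono_on {0..} G" "\<forall>\<mu>>0. G \<mu> \<le> G (- \<mu>)"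
  shows "condition_star (ball 0 R) Wt v"
proof -
  obtain u g e where W: "W0 u g" and vu: "AE x in bal. v x = u x" and vm: "v \<in> borel_measurable lebB"
    and e: "energy R W G v = ereal e" and rd: "AE x in bal. radial_deriv (ball 0 R) v x = g x \<bullet> sgn x"
    by (rule minimizer_dataE[OF min])
  have [measurable]: "g \<in> borel_measurable borel" using W0_measurable[OF W] by auto
  \<comment> \<open>Borel measurability allows the return from almost every ray to almost every
    point.\<close>
  have bm: "(\<lambda>x. bet \<bar>g x \<bullet> sgn x\<bar>) \<in> borel_measurable borel"
    by (rule measurable_compose[OF _ bet_abs_measurable]) measurable
  have "AE x in bal. bet \<bar>g x \<bullet> sgn x\<bar> = \<bar>g x \<bullet> sgn x\<bar>"
  proof (rule AE_polar_conv)
    show "Measurable.pred borel (\<lambda>x. bet \<bar>g x \<bullet> sgn x\<bar> = \<bar>g x \<bullet> sgn x\<bar>)"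
      using bm by measurable
    show "AE y in sph. AE r in (radM TYPE('n) R). bet \<bar>g (r *\<^sub>R sgn y) \<bullet> sgn (r *\<^sub>R sgn y)\<bar> = \<bar>g (r *\<^sub>R sgn y) \<bullet> sgn (r *\<^sub>R sgn y)\<bar>"
      using minimizer_profiles(1)[OF min e W vu] AE_sphM_nonzero
    proof eventually_elim
      case (elim y)
      define h where "h = (\<lambda>r. - (g (r *\<^sub>R sgn y) \<bullet> sgn y))"
      have h: "adm h" "J h = e" using elim(1) by (simp_all only: h_def)
      have hs: "(AE r in (radM TYPE('n) R). steep h r = h r) \<or> (AE r in (radM TYPE('n) R). steep h r = - h r)"
        by (rule minimal_profile_sign(1)[OF h(1) G minimizing_profile_steep(1)[OF min e h G]])
      have ab: "steep h r = h r \<Longrightarrow> steep h r = \<bar>h r\<bar>" "steep h r = - h r \<Longrightarrow> steep h r = \<bar>h r\<bar>" for r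
        using steep_ge(2)[of h r] by linarith+
      have "AE r in (radM TYPE('n) R). steep h r = \<bar>h r\<bar>"
        using hs
      proof
        assume "AE r in (radM TYPE('n) R). steep h r = h r"
        then show ?thesis by eventually_elim (rule ab(1))
      next
        assume "AE r in (radM TYPE('n) R). steep h r = - h r"
        then show ?thesis by eventually_elim (rule ab(2))
      qed
      moreover have "AE r in (radM TYPE('n) R). 0 < r" by (simp add: AE_radM)
      ultimately show ?case
      proof eventually_elim
        case (elim r)
        have "norm (sgn y) = 1" using \<open>y \<noteq> 0\<close> by (simp add: norm_sgn)
        then have "sgn (sgn y) = sgn y" using sgn_div_norm[of "sgn y"] by simp
        then have "sgn (r *\<^sub>R sgn y) = sgn y" using elim(2) by (simp add: sgn_scaleR)
        then have "\<bar>g (r *\<^sub>R sgn y) \<bullet> sgn (r *\<^sub>R sgn y)\<bar> = \<bar>h r\<bar>" by (simp add: h_def)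
        with elim(1) show ?case by (simp add: steep_def)
      qed
    qed
  qed
  \<comment> \<open>The quantifier over \<nu> sits inside, which is stronger than what
    \<open>condition_star\<close> asks for.\<close>
  then have "AE x in bal. \<forall>\<nu>. \<bar>\<nu>\<bar> > \<bar>radial_deriv (ball 0 R) v x\<bar> \<longrightarrow> Wt \<bar>\<nu>\<bar> > Wt \<bar>radial_deriv (ball 0 R) v x\<bar>"
    using rd
  proof eventually_elim
    case (elim x)
    show ?case using bet_strict[of "\<bar>g x \<bullet> sgn x\<bar>"] elim by simp
  qed
  then show ?thesis
    unfolding condition_star_def AE_ballM by (auto elim: eventually_mono)
qed

text \<open>Once \<open>v\<close> is known to be radial, a single ray on which both the symmetry and
  the representation by \<open>wint\<close> hold determines it everywhere; almost every ray is of
  this kind.\<close>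

lemma strict_minimizer_profile:
  assumes min: "minimizer R p W G v" and G: "strict_antimono_on {0..} G" "\<forall>\<mu>>0. G \<mu> \<le> G (- \<mu>)"
    and N2: "CARD('n) \<ge> 2"
  obtains h e where "adm h" "J h = e" "energy R W G v = ereal e" "AE x in bal. v x = wint R h (norm x)"
proof -
  obtain u g e where W: "W0 u g" and vu: "AE x in bal. v x = u x" and vm: "v \<in> borel_measurable lebB"
    and e: "energy R W G v = ereal e" and rd: "AE x in bal. radial_deriv (ball 0 R) v x = g x \<bullet> sgn x"
    by (rule minimizer_dataE[OF min])
  obtain f where f: "AE x in bal. v x = f (norm x)"
    using star_imp_radially_symmetric[OF min strict_imp_star[OF min G] N2]
    unfolding radially_symmetric_on_def AE_ballM by (rule exE)
  have "AE x in bal. u x = f (norm x)" using vu f by eventually_elim simp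
  from AE_polar[OF this] minimizer_profiles(1)[OF min e W vu]
  have "AE y in sph. adm (\<lambda>r. - (g (r *\<^sub>R sgn y) \<bullet> sgn y)) \<and> J (\<lambda>r. - (g (r *\<^sub>R sgn y) \<bullet> sgn y)) = e \<and>
      (AE r in (radM TYPE('n) R). u (r *\<^sub>R sgn y) = wint R (\<lambda>r. - (g (r *\<^sub>R sgn y) \<bullet> sgn y)) r) \<and>
      (AE r in (radM TYPE('n) R). u (r *\<^sub>R sgn y) = f (norm (r *\<^sub>R sgn y)))"
    by eventually_elim (simp only: simp_thms)
  then obtain y :: "real^'n" where y: "y \<noteq> 0"
    and *: "adm (\<lambda>r. - (g (r *\<^sub>R sgn y) \<bullet> sgn y)) \<and> J (\<lambda>r. - (g (r *\<^sub>R sgn y) \<bullet> sgn y)) = e \<and>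
      (AE r in (radM TYPE('n) R). u (r *\<^sub>R sgn y) = wint R (\<lambda>r. - (g (r *\<^sub>R sgn y) \<bullet> sgn y)) r) \<and>
      (AE r in (radM TYPE('n) R). u (r *\<^sub>R sgn y) = f (norm (r *\<^sub>R sgn y)))"
    by (rule AE_sphM_ex)
  define h where "h = (\<lambda>r. - (g (r *\<^sub>R sgn y) \<bullet> sgn y))"
  have h: "adm h" "J h = e" "AE r in (radM TYPE('n) R). u (r *\<^sub>R sgn y) = wint R h r" "AE r in (radM TYPE('n) R). u (r *\<^sub>R sgn y) = f (norm (r *\<^sub>R sgn y))"
    using * by (simp_all only: h_def)
  have "AE r in (radM TYPE('n) R). 0 < r" by (simp add: AE_radM)
  then have "AE r in (radM TYPE('n) R). f r = wint R h r"
    using h(3,4) by eventually_elim (use y in \<open>simp add: norm_sgn\<close>)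
  then have "AE x in bal. f (norm x) = wint R h (norm x)"
    unfolding AE_radial[where 'n = 'n and P = "\<lambda>r. f r = wint R h r"] .
  with f have "AE x in bal. v x = wint R h (norm x)" by eventually_elim simp
  then show ?thesis by (rule that[OF h(1,2) e])
qed

lemma strict_minimizer_properties:
  assumes min: "minimizer R p W G v" and G: "strict_antimono_on {0..} G" "\<forall>\<mu>>0. G \<mu> \<le> G (- \<mu>)"
    and N2: "CARD('n) \<ge> 2" and M0: "M0 \<ge> 0" "Wt constant_on {- M0..M0}"
  shows "(AE x in lebB. v x \<ge> 0) \<or> (AE x in lebB. v x \<le> 0)"
    "AE x in lebB. v x \<le> 0 \<Longrightarrow> AE x in lebB. G (v x) = G (- v x)"
    "minimizer R p W G (\<lambda>x. \<bar>v x\<bar>)"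
    "AE x in lebB. v x \<ge> 0 \<Longrightarrow> AE x in lebB. radial_deriv (ball 0 R) v x \<le> - M0"
    "AE x in lebB. v x \<ge> 0 \<Longrightarrow> radially_decreasing R v"
proof -
  obtain h e where h: "adm h" "J h = e" and e: "energy R W G v = ereal e" and vh: "AE x in bal. v x = wint R h (norm x)"
    by (rule strict_minimizer_profile[OF min G N2])
  have vm: "v \<in> borel_measurable lebB" by (rule minimizer_dataE[OF min])
  have rh: "rprof h" using h(1) by (simp add: adm_def)
  have hm [measurable]: "h \<in> borel_measurable borel" using rh by (rule rprof_measurable)
  have rs: "rprof (steep h)" by (rule rprof_steep[OF h(1)])
  note st = minimizing_profile_steep[OF min e h G]
  note sign = minimal_profile_sign[OF h(1) G st(1)]
  have pos: "wint R h r = wint R (steep h) r" if "AE r in (radM TYPE('n) R). steep h r = h r" "0 < r" for r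
    by (rule wint_cong_AE[OF _ hm steep_measurable[OF hm] that(2)]) (use that(1) in \<open>auto elim: eventually_mono\<close>)
  have neg: "wint R h r = - wint R (steep h) r" if "AE r in (radM TYPE('n) R). steep h r = - h r" "0 < r" for r
  proof -
    have "wint R (steep h) r = wint R (\<lambda>r. - h r) r"
      by (rule wint_cong_AE[OF that(1) steep_measurable[OF hm] _ that(2)]) simp
    then show ?thesis by (simp add: wint_uminus)
  qed
  have sn: "wint R (steep h) r \<ge> 0" for r by (rule wint_nonneg) (rule steep_ge)
  show "(AE x in lebB. v x \<ge> 0) \<or> (AE x in lebB. v x \<le> 0)"
    using sign(1)
  proof
    assume a: "AE r in (radM TYPE('n) R). steep h r = h r"
    have "AE x in bal. v x \<ge> 0"
      using vh AE_bal_nonzero by eventually_elim (simp add: pos[OF a] sn)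
    then show ?thesis unfolding AE_ballM ..
  next
    assume a: "AE r in (radM TYPE('n) R). steep h r = - h r"
    have "AE x in bal. v x \<le> 0"
      using vh AE_bal_nonzero by eventually_elim (simp add: neg[OF a] sn)
    then show ?thesis unfolding AE_ballM ..
  qed
  have G3: "AE x in bal. G (wint R h (norm x)) = G \<bar>wint R h (norm x)\<bar>"
    using sign(3) unfolding AE_radial[where 'n = 'n and P = "\<lambda>r. G (wint R h r) = G \<bar>wint R h r\<bar>"] .
  show "AE x in lebB. G (v x) = G (- v x)" if "AE x in lebB. v x \<le> 0"
    using that G3 vh unfolding AE_ballM by eventually_elim simp
  have abs: "AE x in bal. \<bar>v x\<bar> = wint R (steep h) (norm x)"
  proof -
    have "AE x in bal. wint R (steep h) (norm x) = \<bar>wint R h (norm x)\<bar>"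
      using sign(2) unfolding AE_radial[where 'n = 'n and P = "\<lambda>r. wint R (steep h) r = \<bar>wint R h r\<bar>"] .
    with vh show ?thesis by eventually_elim simp
  qed
  show "minimizer R p W G (\<lambda>x. \<bar>v x\<bar>)"
    by (rule radial_le_imp_minimizer(1)[OF min e st(2) _ _ abs]) (use st(1) h(2) vm in auto)
  \<comment> \<open>With the negative sign, the nonnegative profile \<open>steep h\<close> would
    produce a nonpositive function. It then vanishes, hence so does \<open>h\<close>, and the two
    agree in this case as well.\<close>
  have eq: "AE r in (radM TYPE('n) R). steep h r = h r" if nonneg: "AE x in lebB. v x \<ge> 0"
    using sign(1)
  proof
    assume a: "AE r in (radM TYPE('n) R). steep h r = - h r"
    have "AE x in bal. wint R (steep h) (norm x) \<le> 0"
      using nonneg vh AE_bal_nonzero unfolding AE_ballM by eventually_elim (simp add: neg[OF a])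
    then have "AE r in (radM TYPE('n) R). wint R (steep h) r \<le> 0"
      unfolding AE_radial[where 'n = 'n and P = "\<lambda>r. wint R (steep h) r \<le> 0"] .
    from nonneg_wint_zero[OF rs steep_ge(2) this] a show ?thesis by eventually_elim simp
  qed
  show "AE x in lebB. radial_deriv (ball 0 R) v x \<le> - M0" if nonneg: "AE x in lebB. v x \<ge> 0"
  proof -
    have "AE x in bal. steep h (norm x) = h (norm x)"
      using eq[OF nonneg] unfolding AE_radial[where 'n = 'n and P = "\<lambda>r. steep h r = h r"] .
    then have "AE x in bal. radial_deriv (ball 0 R) v x \<le> - M0"
      using radial_deriv_radial[OF rh vm vh]
    proof eventually_elim
      case (elim x)
      have "M0 \<le> steep h (norm x)" unfolding steep_def by (rule bet_ge_plateau[OF _ M0]) simp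
      with elim show ?case by simp
    qed
    then show ?thesis unfolding AE_ballM .
  qed
  show "radially_decreasing R v" if nonneg: "AE x in lebB. v x \<ge> 0"
    unfolding radially_decreasing_def
  proof (intro exI conjI)
    \<comment> \<open>The witness is built from \<open>steep h\<close>, which is nonnegative at
      every radius, whereas for \<open>h\<close> this is known only almost everywhere.\<close>
    show "antimono_on {0<..<R} (wint R (steep h))" by (rule wint_antimono[OF rs steep_ge(2)])
    show "AE x in lebB. v x = wint R (steep h) (norm x)"
      using nonneg abs unfolding AE_ballM by eventually_elim simp
  qed
qed

end

theorem theorem3p4:
  fixes W :: "real^'n::finite \<Rightarrow> real"
    and Wt G :: "real \<Rightarrow> real"
    and R p M0 :: real
  assumes N: "CARD('n) \<ge> 2" and R: "R > 0" and p: "p > 1"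
    and W: "condition_W p W Wt"
    and G: "condition_G CARD('n) p G"
    and Wt_mono: "mono_on {0..} Wt"
    and ex_min: "\<exists>u. minimizer R p W G u"
    and M0: "M0 \<ge> 0" "Wt constant_on {- M0..M0}"
  shows
    "(\<exists>u. minimizer R p W G u \<and> radially_symmetric_on (ball 0 R) u) \<and>
     (antimono_on {0..} G \<and> (\<forall>\<mu>>0. G \<mu> \<le> G (- \<mu>)) \<longrightarrow>
       (\<exists>u. minimizer R p W G u \<and> radially_symmetric_on (ball 0 R) u \<and>
          (AE x in lebesgue_on (ball 0 R). u x \<ge> 0) \<and>
          (AE x in lebesgue_on (ball 0 R). radial_deriv (ball 0 R) u x \<le> - M0))) \<and>
    (\<forall>u. minimizer R p W G u \<and> condition_star (ball 0 R) Wt u \<longrightarrow>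
       radially_symmetric_on (ball 0 R) u) \<and>
    (strict_antimono_on {0..} G \<and> (\<forall>\<mu>>0. G \<mu> \<le> G (- \<mu>)) \<longrightarrow>
       (\<forall>u. minimizer R p W G u \<longrightarrow>
          condition_star (ball 0 R) Wt u \<and>
          radially_symmetric_on (ball 0 R) u \<and>
          ((AE x in lebesgue_on (ball 0 R). u x \<ge> 0) \<or>
           (AE x in lebesgue_on (ball 0 R). u x \<le> 0)) \<and>
          ((AE x in lebesgue_on (ball 0 R). u x \<le> 0) \<longrightarrow>
             (AE x in lebesgue_on (ball 0 R). G (u x) = G (- u x)) \<and>
             minimizer R p W G (\<lambda>x. \<bar>u x\<bar>)) \<and>
          ((AE x in lebesgue_on (ball 0 R). u x \<ge> 0) \<longrightarrow>
             (AE x in lebesgue_on (ball 0 R). radial_deriv (ball 0 R) u x \<le> - M0) \<and>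
             radially_decreasing R u)))"
proof -
  interpret radial_problem "TYPE('n)" R p W Wt G
    by unfold_locales (rule R p W G Wt_mono)+
  obtain v where v: "minimizer R p W G v" using ex_min by blast
  show ?thesis
  proof (intro conjI allI impI)
    show "\<exists>u. minimizer R p W G u \<and> radially_symmetric_on (ball 0 R) u"
      by (rule ex_radial_minimizer[OF v])
  next
    assume a: "antimono_on {0..} G \<and> (\<forall>\<mu>>0. G \<mu> \<le> G (- \<mu>))"
    show "\<exists>u. minimizer R p W G u \<and> radially_symmetric_on (ball 0 R) u \<and>
          (AE x in lebesgue_on (ball 0 R). u x \<ge> 0) \<and>
          (AE x in lebesgue_on (ball 0 R). radial_deriv (ball 0 R) u x \<le> - M0)"
      by (rule ex_decreasing_radial_minimizer[OF v conjunct1[OF a] conjunct2[OF a] M0])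
  next
    fix u assume a: "minimizer R p W G u \<and> condition_star (ball 0 R) Wt u"
    show "radially_symmetric_on (ball 0 R) u"
      by (rule star_imp_radially_symmetric[OF conjunct1[OF a] conjunct2[OF a] N])
  next
    fix u assume Gs: "strict_antimono_on {0..} G \<and> (\<forall>\<mu>>0. G \<mu> \<le> G (- \<mu>))" and u: "minimizer R p W G u"
    note G1 = conjunct1[OF Gs] and G2 = conjunct2[OF Gs]
    note props = strict_minimizer_properties[OF u G1 G2 N M0]
    show star: "condition_star (ball 0 R) Wt u" by (rule strict_imp_star[OF u G1 G2])
    show "radially_symmetric_on (ball 0 R) u" by (rule star_imp_radially_symmetric[OF u star N])
    show "(AE x in lebesgue_on (ball 0 R). u x \<ge> 0) \<or> (AE x in lebesgue_on (ball 0 R). u x \<le> 0)"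
      by (rule props(1))
    show "minimizer R p W G (\<lambda>x. \<bar>u x\<bar>)" by (rule props(3))
    show "AE x in lebesgue_on (ball 0 R). G (u x) = G (- u x)" if "AE x in lebesgue_on (ball 0 R). u x \<le> 0"
      by (rule props(2)[OF that])
    show "AE x in lebesgue_on (ball 0 R). radial_deriv (ball 0 R) u x \<le> - M0" if "AE x in lebesgue_on (ball 0 R). u x \<ge> 0"
      by (rule props(4)[OF that])
    show "radially_decreasing R u" if "AE x in lebesgue_on (ball 0 R). u x \<ge> 0"
      by (rule props(5)[OF that])
  qed
qed

end
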